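(* Let $X$ be a real Banach space, let $A\subseteq X$ be bounded, let $\varepsilon\geq 0$ and let $E$ be the set of extreme points of $B_{X^*}$. If for each sequence $(x_n)_{n\in\mathbb{N}}$ in $A$ we have $$\bigcap_{k=1}^{\infty}\left(\overline{\operatorname{co}}^{\sigma_E}\{x_n : n\geq k\}+\varepsilon B_X\right)\neq\emptyset,$$ then $A$ is $2\varepsilon$-WRC.
   Context: $B_X$ and $B_{X^*}$ are the closed unit balls of $X$ and of its dual $X^*$. For $S\subseteq X^*$, $\sigma_S$ denotes the topology on $X$ of pointwise convergence on $S$; $\overline{\operatorname{co}}^{\sigma_S} C$ is the $\sigma_S$-closure of the convex hull of $C$. For $\delta\geq 0$, a bounded set $A\subseteq X$ is $\delta$-weakly relatively compact ($\delta$-WRC) if $\operatorname{dist}(x^{**},X)\leq\delta$ for every $x^{**}$ in the weak*-closure of $A$ in $X^{**}$ (with $X$ canonically embedded in $X^{**}$, and the distance taken in the norm of $X^{**}$). *)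

theory Defs
  imports "HOL-Analysis.Analysis"
begin

text \<open>The dual of \<open>'a\<close> is the normed space \<open>'a \<Rightarrow>\<^sub>L real\<close> (operator norm).\<close>

text \<open>The pullback form keeps the whole space as carrier also when \<open>S\<close> is empty.
  The topology need not be Hausdorff.\<close>

definition pointwise_topology_on :: "('a::real_normed_vector \<Rightarrow>\<^sub>L real) set \<Rightarrow> 'a topology"
  where "pointwise_topology_on S =
    pullback_topology UNIV (\<lambda>x. \<lambda>f\<in>S. blinfun_apply f x)
      (product_topology (\<lambda>_. euclideanreal) S)"

definition bidual_embedding ::
    "'a::real_normed_vector \<Rightarrow> (('a \<Rightarrow>\<^sub>L real) \<Rightarrow>\<^sub>L real)"
  where "bidual_embedding x = Blinfun (\<lambda>f. blinfun_apply f x)"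

lemma bidual_embedding_apply [simp]:
  "blinfun_apply (bidual_embedding x) f = blinfun_apply f x"
  unfolding bidual_embedding_def
  by (simp add: bounded_linear_Blinfun_apply
      bounded_bilinear.bounded_linear_left[OF bounded_bilinear_blinfun_apply])

text \<open>On a space of real-valued functionals, the strong operator topology of the library
  is the topology of pointwise convergence, i.e. the weak* topology.\<close>

abbreviation weak_star_topology :: "('b::real_normed_vector \<Rightarrow>\<^sub>L real) topology"
  where "weak_star_topology \<equiv> strong_operator_topology"

definition delta_WRC :: "real \<Rightarrow> 'a::real_normed_vector set \<Rightarrow> bool"
  where "delta_WRC \<delta> A \<longleftrightarrow> bounded A \<and>
    (\<forall>F \<in> weak_star_topology closure_of (bidual_embedding ` A).
       infdist F (range bidual_embedding) \<le> \<delta>)"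

end

theory Submission
  imports Defs
begin

text \<open>Let \<open>K\<close> be the unit ball of the dual space and \<open>E\<close> the set of its extreme points, and suppose that
some \<open>F\<close> in the weak* closure of \<open>A\<close> has distance more than \<open>d > 2 * \<epsilon>\<close> from the space. Eberlein's
construction (lemma \<open>separated_double_sequence\<close>) gives \<open>x n \<in> A\<close> and \<open>h i \<in> K\<close> such that \<open>h i (x n)\<close> is \<open>0\<close>
for \<open>n < i\<close> and exceeds \<open>d\<close> for \<open>n \<ge> i\<close>. A weak* cluster point \<open>f\<close> of the \<open>h i\<close> vanishes at every \<open>x n\<close>.
If some \<open>z\<close> were within \<open>\<epsilon>\<close> of the norm-closed convex hull of every tail of the \<open>x n\<close>, then
\<open>h i z \<ge> d - \<epsilon>\<close> for all \<open>i\<close> but \<open>f z \<le> \<epsilon>\<close>, which is absurd because \<open>f z\<close> is a cluster point of the \<open>h i z\<close>.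

The hypothesis only provides \<open>z\<close> for closures in the topology of pointwise convergence on \<open>E\<close>. It
therefore controls \<open>g z\<close> only for convex combinations \<open>g\<close> of points of \<open>E\<close>: if all late \<open>g (x n)\<close> lie
within \<open>\<delta>\<close> of a number \<open>a\<close>, then \<open>g z\<close> lies within \<open>\<epsilon> + \<delta>\<close> of \<open>a\<close>. Neither representing measures nor
dominated convergence extend this to other \<open>g\<close>, since \<open>z\<close> is a limit of nets and not of sequences.
What replaces them is theorem \<open>extreme_thinning\<close>: after passing to one subsequence of the \<open>x n\<close>, chosen
before \<open>z\<close> is known, every \<open>h\<close> among \<open>f\<close> and the \<open>h i\<close> admits for every vector \<open>y\<close> an average \<open>g\<close> of \<open>N\<close>
extreme points such that \<open>g y \<ge> h y - \<delta>\<close> and all late \<open>g (x n)\<close> lie within \<open>\<delta>\<close> of a cluster value of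
the \<open>h (x n)\<close>. Using it for \<open>y = z\<close> and for \<open>y = - z\<close> bounds \<open>h z\<close> from both sides, and the contradiction
above goes through.

To prove it, represent \<open>h\<close> by a finitely additive mean \<open>L\<close> on \<open>K\<close> that is maximal in Choquet's order
(\<open>maximal_representing_mean\<close>). If \<open>N\<close> points are drawn independently, the average of their values
at \<open>x n\<close> is near its expectation for most \<open>n\<close> but not for all late \<open>n\<close>. They are therefore drawn
dependently. A state is a tuple of \<open>N\<close> densities with respect to \<open>L\<close>. To take a further \<open>x n\<close> into
account, cut every density into cells on which \<open>x n\<close> is nearly constant, and let each entry of the
tuple choose a cell so that the sum over the entries of the means of \<open>x n\<close>, and the sum of
fixed cluster values of these means as \<open>n\<close> varies, do not change. Only two linear constraints have to be
respected, so all but two entries can be confined to a single cell (\<open>rounding\<close>); the error in the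
average is of order \<open>1 / N\<close>, and since both sums are preserved exactly, errors do not accumulate from
one \<open>x n\<close> to the next (\<open>balanced_state_refine\<close>). Iterating this selects the subsequence
(\<open>simultaneous_thinning\<close>). By weak* compactness of \<open>K\<close> some tuple of points satisfies all constraints at
once, and maximality of \<open>L\<close> makes its entries behave like extreme points on a prescribed countable
set of vectors; a face argument then replaces them by extreme points with the same values there
(\<open>extreme_tuple\<close>).\<close>

section \<open>Weak* compactness of the dual ball and extreme points\<close>

lemma compact_box:
  fixes B :: "'i \<Rightarrow> real"
  shows "compact {g. \<forall>i. \<bar>g i\<bar> \<le> B i}"
proof -
  have "compactin (product_topology (\<lambda>_. euclidean) UNIV) (PiE UNIV (\<lambda>i. {- B i..B i}))"
    by (simp add: compactin_PiE)
  moreover have "PiE UNIV (\<lambda>i. {- B i..B i}) = {g. \<forall>i. \<bar>g i\<bar> \<le> B i}"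
    by (auto simp: PiE_def Pi_def abs_le_iff minus_le_iff)
  ultimately show ?thesis by (simp add: euclidean_product_topology)
qed

text \<open>Tychonoff's theorem yields cluster points. Convergent subsequences need not exist because the index
type may be uncountable.\<close>

lemma cluster_point:
  fixes u :: "nat \<Rightarrow> 'i \<Rightarrow> real"
  assumes "\<And>i. \<exists>B. \<forall>n. \<bar>u n i\<bar> \<le> B"
  obtains g where "\<And>k. g \<in> closure (u ` {k..})"
proof -
  obtain B where B: "\<And>i n. \<bar>u n i\<bar> \<le> B i" using assms by metis
  have "{g. \<forall>i. \<bar>g i\<bar> \<le> B i} \<inter> (\<Inter>k\<in>UNIV. closure (u ` {k..})) \<noteq> {}"
  proof (rule compact_imp_fip_image[OF compact_box])
    fix I :: "nat set" assume "finite I"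
    then obtain m where m: "\<And>k. k \<in> I \<Longrightarrow> k \<le> m" by (meson finite_nat_set_iff_bounded_le)
    have "u m \<in> closure (u ` {k..})" if "k \<in> I" for k
      using m[OF that] closure_subset by fastforce
    then show "{g. \<forall>i. \<bar>g i\<bar> \<le> B i} \<inter> (\<Inter>k\<in>I. closure (u ` {k..})) \<noteq> {}"
      using B by blast
  qed simp
  then show ?thesis using that by blast
qed

lemma cluster_point_frequently:
  fixes u :: "nat \<Rightarrow> 'i \<Rightarrow> real"
  assumes g: "\<And>k. g \<in> closure (u ` {k..})" and "finite S" "\<eta> > 0"
  obtains n where "n \<ge> k" "\<And>i. i \<in> S \<Longrightarrow> \<bar>u n i - g i\<bar> < \<eta>"
proof -
  let ?U = "PiE UNIV (\<lambda>i. if i \<in> S then ball (g i) \<eta> else UNIV)"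
  have "{i. (if i \<in> S then ball (g i) \<eta> else UNIV) \<noteq> UNIV} \<subseteq> S" by (auto split: if_splits)
  then have "open ?U"
    using finite_subset[OF _ assms(2)] by (intro open_PiE) (auto split: if_splits)
  moreover have "g \<in> ?U"
    using assms(3) by (simp add: PiE_iff)
  ultimately have "?U \<inter> u ` {k..} \<noteq> {}"
    using open_Int_closure_eq_empty[of ?U "u ` {k..}"] g[of k] by blast
  then obtain n where n: "n \<ge> k" "u n \<in> ?U" by blast
  have "\<bar>u n i - g i\<bar> < \<eta>" if "i \<in> S" for i
    using n(2) that PiE_mem[OF n(2), of i] by (simp add: dist_real_def abs_minus_commute)
  then show ?thesis using that n(1) by blast
qed

lemma cluster_point_closed:
  fixes u :: "nat \<Rightarrow> 'i \<Rightarrow> real"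
  assumes "\<And>k. g \<in> closure (u ` {k..})" "closed Z" "\<And>n. n \<ge> k \<Longrightarrow> u n \<in> Z"
  shows "g \<in> Z"
  using closure_minimal[of "u ` {k..}" Z] assms by blast

text \<open>Viewing functionals as plain functions turns weak* statements about the dual ball into
statements about a closed subset of a product of real lines.\<close>

lemma dual_ball_image:
  "blinfun_apply ` cball (0 :: 'a::real_normed_vector \<Rightarrow>\<^sub>L real) 1 =
    {g. (\<forall>x y. g (x + y) = g x + g y) \<and> (\<forall>c x. g (c *\<^sub>R x) = c * g x) \<and> (\<forall>x. \<bar>g x\<bar> \<le> norm x)}"
  (is "_ = ?R")
proof (intro equalityI subsetI)
  fix g assume "g \<in> blinfun_apply ` cball (0 :: 'a \<Rightarrow>\<^sub>L real) 1"
  then obtain f :: "'a \<Rightarrow>\<^sub>L real" where f: "g = blinfun_apply f" "norm f \<le> 1" by auto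
  have "\<bar>blinfun_apply f x\<bar> \<le> norm x" for x
    using norm_blinfun[of f x] f(2) mult_right_mono[of "norm f" 1 "norm x"] by simp
  then show "g \<in> ?R" using f by (auto simp: blinfun.add_right blinfun.scaleR_right)
next
  fix g assume g: "g \<in> ?R"
  then have bl: "bounded_linear g" by (intro bounded_linear_intro[where K=1]) auto
  have "norm (Blinfun g) \<le> 1"
    by (rule norm_blinfun_bound) (use g bl in \<open>auto simp: bounded_linear_Blinfun_apply\<close>)
  then show "g \<in> blinfun_apply ` cball (0 :: 'a \<Rightarrow>\<^sub>L real) 1"
    by (intro image_eqI[of _ _ "Blinfun g"]) (auto simp: bounded_linear_Blinfun_apply[OF bl])
qed

lemma dual_ball_bound:
  fixes t :: "'a::real_normed_vector \<Rightarrow>\<^sub>L real"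
  assumes "t \<in> cball 0 1" shows "\<bar>blinfun_apply t x\<bar> \<le> norm x"
  using dual_ball_image assms by blast

lemma closed_dual_ball_coordinates:
  fixes h :: "'a::real_normed_vector \<Rightarrow> 'i"
  shows "closed {g :: 'i \<Rightarrow> real. (\<lambda>x. g (h x)) \<in> blinfun_apply ` cball (0 :: 'a \<Rightarrow>\<^sub>L real) 1}"
proof -
  have cont: "continuous_on UNIV (\<lambda>g :: 'i \<Rightarrow> real. g i)" for i
    by (rule continuous_on_product_coordinates)
  have 1: "closed {g :: 'i \<Rightarrow> real. g (h (x + y)) = g (h x) + g (h y)}" for x y
    using closed_Collect_eq[of "\<lambda>g. g (h (x + y))" "\<lambda>g. g (h x) + g (h y)", OF cont]
      continuous_on_add[OF cont[of "h x"] cont[of "h y"]] by blast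
  have 2: "closed {g :: 'i \<Rightarrow> real. g (h (c *\<^sub>R x)) = c * g (h x)}" for c x
    using closed_Collect_eq[of "\<lambda>g. g (h (c *\<^sub>R x))" "\<lambda>g. c * g (h x)", OF cont]
      continuous_on_mult[OF continuous_on_const cont[of "h x"]] by blast
  have 3: "closed {g :: 'i \<Rightarrow> real. \<bar>g (h x)\<bar> \<le> norm x}" for x
    using closed_Collect_le[of "\<lambda>g. \<bar>g (h x)\<bar>" "\<lambda>g. norm x"]
      continuous_on_rabs[OF cont[of "h x"]] by simp
  have "{g. (\<lambda>x. g (h x)) \<in> blinfun_apply ` cball (0 :: 'a \<Rightarrow>\<^sub>L real) 1} =
      (\<Inter>x. \<Inter>y. {g. g (h (x + y)) = g (h x) + g (h y)}) \<inter>
      (\<Inter>c. \<Inter>x. {g. g (h (c *\<^sub>R x)) = c * g (h x)}) \<inter> (\<Inter>x. {g. \<bar>g (h x)\<bar> \<le> norm x})" (is "?L = ?M")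
    unfolding dual_ball_image by (rule set_eqI) (simp only: Int_iff INT_iff mem_Collect_eq UNIV_I simp_thms, simp)
  moreover have "closed ?M" by (intro closed_Int closed_INT ballI 1 2 3)
  ultimately show ?thesis by (simp only:)
qed

lemma closed_dual_ball_image:
  "closed (blinfun_apply ` cball (0 :: 'a::real_normed_vector \<Rightarrow>\<^sub>L real) 1)"
  using closed_dual_ball_coordinates[where h="\<lambda>x::'a. x"] by simp

lemma compact_dual_ball_image:
  "compact (blinfun_apply ` cball (0 :: 'a::real_normed_vector \<Rightarrow>\<^sub>L real) 1)"
proof -
  have "blinfun_apply ` cball (0 :: 'a \<Rightarrow>\<^sub>L real) 1 \<subseteq> {g. \<forall>x. \<bar>g x\<bar> \<le> norm x}"
    using dual_ball_bound by auto
  from Int_absorb1[OF this] show ?thesis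
    using compact_Int_closed[OF compact_box[of "norm :: 'a \<Rightarrow> real"] closed_dual_ball_image] by simp
qed

text \<open>Indexing by pairs of a position and a vector lets a single product space carry a whole tuple of
functionals, so that all entries cluster along the same indices.\<close>

lemma dual_tuple_cluster_point:
  fixes T :: "nat \<Rightarrow> nat \<Rightarrow> 'a::real_normed_vector \<Rightarrow>\<^sub>L real"
  assumes T: "\<And>n j. T n j \<in> cball 0 1"
  obtains t where "\<And>j. t j \<in> cball 0 1"
    "\<And>k. (\<lambda>(j, x). blinfun_apply (t j) x) \<in> closure ((\<lambda>n (j, x). blinfun_apply (T n j) x) ` {k..})"
proof -
  let ?u = "\<lambda>n (j, x). blinfun_apply (T n j) x"
  have "\<exists>B. \<forall>n. \<bar>?u n i\<bar> \<le> B" for i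
    using dual_ball_bound[OF T] by (cases i) auto
  then obtain g where g: "\<And>k. g \<in> closure (?u ` {k..})" using cluster_point[of ?u] by blast
  have "(\<lambda>x. g (j, x)) \<in> blinfun_apply ` cball (0 :: 'a \<Rightarrow>\<^sub>L real) 1" for j
  proof -
    have "closed {g :: nat \<times> 'a \<Rightarrow> real. (\<lambda>x. g (j, x)) \<in> blinfun_apply ` cball (0 :: 'a \<Rightarrow>\<^sub>L real) 1}"
      by (rule closed_dual_ball_coordinates)
    from cluster_point_closed[OF g this, of 0] show ?thesis using T by auto
  qed
  then have "\<forall>j. \<exists>t. t \<in> cball 0 1 \<and> (\<lambda>x. g (j, x)) = blinfun_apply t" by blast
  then obtain t where t: "\<And>j. t j \<in> cball 0 1" "\<And>j. (\<lambda>x. g (j, x)) = blinfun_apply (t j)" by metis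
  have "g = (\<lambda>(j, x). blinfun_apply (t j) x)" using t(2) by (auto simp: fun_eq_iff)
  then show ?thesis using that[of t] t(1) g by simp
qed

text \<open>The argument of Krein and Milman: compactness and Zorn's lemma give a minimal closed face, and
if some vector took two values on it, the points where the larger value is attained would form
a smaller closed face.\<close>

lemma weak_star_closed_face_extreme_point:
  fixes \<Phi> :: "('a::real_normed_vector \<Rightarrow>\<^sub>L real) set"
  assumes face: "\<Phi> face_of cball 0 1" and ne: "\<Phi> \<noteq> {}" and cl: "closed (blinfun_apply ` \<Phi>)"
  obtains e where "e \<in> \<Phi>" "e extreme_point_of cball 0 1"
proof -
  let ?K = "cball (0 :: 'a \<Rightarrow>\<^sub>L real) 1"
  define A where "A = {F. F \<subseteq> \<Phi> \<and> F \<noteq> {} \<and> F face_of ?K \<and> closed (blinfun_apply ` F)}"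
  have inj: "inj (blinfun_apply :: ('a \<Rightarrow>\<^sub>L real) \<Rightarrow> _)" by (rule injI) (simp add: blinfun_apply_inject)
  have "\<exists>m\<in>A. \<forall>a\<in>A. a \<subseteq> m \<longrightarrow> a = m"
  proof (rule predicate_Zorn[where P="\<lambda>x y. y \<subseteq> x"])
    show "partial_order_on A (relation_of (\<lambda>x y. y \<subseteq> x) A)"
      by (rule partial_order_on_relation_ofI) auto
    fix \<C> assume "\<C> \<in> Chains (relation_of (\<lambda>x y. y \<subseteq> x) A)"
    then have CA: "\<C> \<subseteq> A" and chain: "\<And>F G. F \<in> \<C> \<Longrightarrow> G \<in> \<C> \<Longrightarrow> F \<subseteq> G \<or> G \<subseteq> F"
      unfolding Chains_def relation_of_def by auto
    show "\<exists>u\<in>A. \<forall>a\<in>\<C>. u \<subseteq> a"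
    proof (cases "\<C> = {}")
      case True
      then show ?thesis using face ne cl by (auto simp: A_def)
    next
      case C0: False
      have "blinfun_apply ` ?K \<inter> (\<Inter>F\<in>\<C>. blinfun_apply ` F) \<noteq> {}"
      proof (rule compact_imp_fip_image[OF compact_dual_ball_image])
        show "closed (blinfun_apply ` F)" if "F \<in> \<C>" for F using that CA by (auto simp: A_def)
        fix \<D> assume D: "finite \<D>" "\<D> \<subseteq> \<C>"
        have "\<exists>F\<in>\<C>. \<forall>G\<in>\<D>. F \<subseteq> G" using D
        proof (induction \<D>)
          case empty
          then show ?case using C0 by blast
        next
          case (insert G \<D>)
          then obtain F where F: "F \<in> \<C>" "\<forall>H\<in>\<D>. F \<subseteq> H" by auto
          have G: "G \<in> \<C>" using insert.prems by simp
          from chain[OF F(1) G] show ?case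
          proof
            assume "F \<subseteq> G"
            then show ?thesis using F by blast
          next
            assume "G \<subseteq> F"
            then show ?thesis using F G by (intro bexI[OF _ G]) auto
          qed
        qed
        then obtain F where F: "F \<in> \<C>" "\<forall>G\<in>\<D>. F \<subseteq> G" by blast
        then have FA: "F \<in> A" using CA by blast
        then have "F \<noteq> {}" by (simp add: A_def)
        then obtain e where "e \<in> F" by blast
        then have "blinfun_apply e \<in> blinfun_apply ` ?K \<inter> (\<Inter>F\<in>\<D>. blinfun_apply ` F)"
        proof -
          have "e \<in> ?K" using \<open>e \<in> F\<close> FA face_of_imp_subset[of F ?K] unfolding A_def by blast
          then show ?thesis using \<open>e \<in> F\<close> F by blast
        qed
        then show "blinfun_apply ` ?K \<inter> (\<Inter>F\<in>\<D>. blinfun_apply ` F) \<noteq> {}" by blast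
      qed
      then have im: "(\<Inter>F\<in>\<C>. blinfun_apply ` F) \<noteq> {}" by blast
      have eq: "blinfun_apply ` (\<Inter>\<C>) = (\<Inter>F\<in>\<C>. blinfun_apply ` F)"
      proof -
        obtain F0 where "F0 \<in> \<C>" using C0 by blast
        then show ?thesis using image_INT[OF inj, of \<C> "\<lambda>F. F" F0] by simp
      qed
      have "\<Inter>\<C> \<in> A"
        unfolding A_def
      proof (intro CollectI conjI)
        show "\<Inter>\<C> \<subseteq> \<Phi>" using C0 CA by (auto simp: A_def)
        show "\<Inter>\<C> \<noteq> {}" using im eq by auto
        show "\<Inter>\<C> face_of ?K" using C0 CA by (intro face_of_Inter) (auto simp: A_def)
        show "closed (blinfun_apply ` (\<Inter>\<C>))" unfolding eq using CA by (intro closed_INT) (auto simp: A_def)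
      qed
      then show ?thesis by blast
    qed
  qed
  then obtain F where F: "F \<in> A" and min: "\<And>G. G \<in> A \<Longrightarrow> G \<subseteq> F \<Longrightarrow> G = F" by blast
  have "\<exists>e. F = {e}"
  proof -
    from F obtain e where e: "e \<in> F" by (auto simp: A_def)
    have "e' = e" if e': "e' \<in> F" for e'
    proof (rule blinfun_eqI)
      fix x
      have "F \<subseteq> ?K" using F face_of_imp_subset by (auto simp: A_def)
      then have sub: "blinfun_apply ` F \<subseteq> blinfun_apply ` ?K" by (rule image_mono)
      have "closed (blinfun_apply ` F)" using F by (simp add: A_def)
      then have "compact (blinfun_apply ` ?K \<inter> blinfun_apply ` F)"
        by (rule compact_Int_closed[OF compact_dual_ball_image])
      then have "compact (blinfun_apply ` F)" by (simp only: Int_absorb1[OF sub])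
      moreover have "continuous_on (blinfun_apply ` F) (\<lambda>g :: 'a \<Rightarrow> real. g x)"
        by (rule continuous_on_subset[OF continuous_on_product_coordinates]) simp
      ultimately obtain g where "g \<in> blinfun_apply ` F" "\<forall>h\<in>blinfun_apply ` F. h x \<le> g x"
        using continuous_attains_sup[of "blinfun_apply ` F" "\<lambda>g :: 'a \<Rightarrow> real. g x"] e by blast
      then obtain m where m: "m \<in> F" "\<And>h. h \<in> F \<Longrightarrow> blinfun_apply h x \<le> blinfun_apply m x"
        by auto
      let ?G = "{h \<in> F. blinfun_apply h x = blinfun_apply m x}"
      have "?G face_of F"
        unfolding face_of_def
      proof (intro conjI ballI impI)
        have cF: "convex F" using F by (auto simp: A_def face_of_def)
        show "convex ?G"
        proof (rule convexI)
          fix a b :: "'a \<Rightarrow>\<^sub>L real" and r s :: real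
          assume "a \<in> ?G" "b \<in> ?G" "0 \<le> r" "0 \<le> s" "r + s = 1"
          then show "r *\<^sub>R a + s *\<^sub>R b \<in> ?G"
            using convexD[OF cF, of a b r s]
            by (simp add: blinfun.add_left blinfun.scaleR_left distrib_right[symmetric])
        qed
        fix a b h assume a: "a \<in> F" and b: "b \<in> F" and h: "h \<in> ?G" "h \<in> open_segment a b"
        then obtain r where r: "0 < r" "r < 1" "h = (1 - r) *\<^sub>R a + r *\<^sub>R b" by (auto simp: in_segment)
        have eq: "(1 - r) * blinfun_apply a x + r * blinfun_apply b x = blinfun_apply m x"
          using h r by (simp add: blinfun.add_left blinfun.scaleR_left)
        have "(1 - r) * blinfun_apply a x \<le> (1 - r) * blinfun_apply m x"
          "r * blinfun_apply b x \<le> r * blinfun_apply m x" using m(2) a b r by (auto intro: mult_left_mono)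
        moreover have "(1 - r) * blinfun_apply m x + r * blinfun_apply m x = blinfun_apply m x"
          by (simp add: algebra_simps)
        ultimately have "(1 - r) * blinfun_apply a x = (1 - r) * blinfun_apply m x"
          "r * blinfun_apply b x = r * blinfun_apply m x" using eq by linarith+
        then show "a \<in> ?G" "b \<in> ?G" using a b r by auto
      qed auto
      then have "?G face_of ?K" using F face_of_trans by (auto simp: A_def)
      moreover have "blinfun_apply ` ?G = blinfun_apply ` F \<inter> {g. g x = blinfun_apply m x}" by auto
      moreover have "closed {g :: 'a \<Rightarrow> real. g x = blinfun_apply m x}"
        using closed_Collect_eq[of "\<lambda>g :: 'a \<Rightarrow> real. g x" "\<lambda>g. blinfun_apply m x"] by simp
      ultimately have "?G \<in> A" using F m by (auto simp: A_def)
      then have "?G = F" by (rule min) auto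
      then have "e \<in> ?G" "e' \<in> ?G" using e e' by (simp_all only:)
      then show "blinfun_apply e' x = blinfun_apply e x" by simp
    qed
    then show ?thesis using e by blast
  qed
  then obtain e where e: "F = {e}" by blast
  show ?thesis using F e by (intro that[of e]) (auto simp: A_def face_of_singleton)
qed

section \<open>Minimal sublinear functionals\<close>

definition bounded_over :: "'i set \<Rightarrow> ('i \<Rightarrow> real) \<Rightarrow> bool"
  where "bounded_over K \<phi> \<longleftrightarrow> (\<exists>B. \<forall>t\<in>K. \<bar>\<phi> t\<bar> \<le> B)"

lemma bounded_overI: "(\<And>t. t \<in> K \<Longrightarrow> \<bar>\<phi> t\<bar> \<le> B) \<Longrightarrow> bounded_over K \<phi>"
  unfolding bounded_over_def by blast

lemma bounded_over_const [simp]: "bounded_over K (\<lambda>t. c)"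
  by (rule bounded_overI[where B="\<bar>c\<bar>"]) simp

lemma bounded_over_add [simp]:
  assumes "bounded_over K \<phi>" "bounded_over K \<psi>" shows "bounded_over K (\<lambda>t. \<phi> t + \<psi> t)"
proof -
  from assms obtain B B' where "\<forall>t\<in>K. \<bar>\<phi> t\<bar> \<le> B" "\<forall>t\<in>K. \<bar>\<psi> t\<bar> \<le> B'" 
    unfolding bounded_over_def by blast
  then have "\<bar>\<phi> t + \<psi> t\<bar> \<le> B + B'" if "t \<in> K" for t
    using that abs_triangle_ineq[of "\<phi> t" "\<psi> t"] by fastforce
  then show ?thesis by (rule bounded_overI)
qed

lemma bounded_over_mult [simp]:
  assumes "bounded_over K \<phi>" "bounded_over K \<psi>" shows "bounded_over K (\<lambda>t. \<phi> t * \<psi> t)"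
proof -
  from assms obtain B B' where "\<forall>t\<in>K. \<bar>\<phi> t\<bar> \<le> B" "\<forall>t\<in>K. \<bar>\<psi> t\<bar> \<le> B'" 
    unfolding bounded_over_def by blast
  then have "\<bar>\<phi> t * \<psi> t\<bar> \<le> B * B'" if "t \<in> K" for t
  proof -
    have "\<bar>\<phi> t\<bar> \<le> B" "\<bar>\<psi> t\<bar> \<le> B'" using that \<open>\<forall>t\<in>K. \<bar>\<phi> t\<bar> \<le> B\<close> \<open>\<forall>t\<in>K. \<bar>\<psi> t\<bar> \<le> B'\<close> by auto
    then show ?thesis unfolding abs_mult by (intro mult_mono) auto
  qed
  then show ?thesis by (rule bounded_overI)
qed

lemma bounded_over_minus [simp]: "bounded_over K \<phi> \<Longrightarrow> bounded_over K (\<lambda>t. - \<phi> t)"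
  unfolding bounded_over_def by simp

lemma bounded_over_diff [simp]:
  assumes "bounded_over K \<phi>" "bounded_over K \<psi>" shows "bounded_over K (\<lambda>t. \<phi> t - \<psi> t)"
  using bounded_over_add[OF assms(1) bounded_over_minus[OF assms(2)]] by simp

lemma bounded_over_sum [simp]:
  "(\<And>i. i \<in> I \<Longrightarrow> bounded_over K (f i)) \<Longrightarrow> bounded_over K (\<lambda>t. \<Sum>i\<in>I. f i t)"
  by (induction I rule: infinite_finite_induct) simp_all

text \<open>Values outside the bounded functions are pinned to 0 so that the pointwise order is
  antisymmetric on these functionals.\<close>

definition monotone_sublinear :: "'i set \<Rightarrow> (('i \<Rightarrow> real) \<Rightarrow> real) \<Rightarrow> bool"
  where "monotone_sublinear K p \<longleftrightarrow>
    (\<forall>\<phi> \<psi>. bounded_over K \<phi> \<longrightarrow> bounded_over K \<psi> \<longrightarrow> p (\<lambda>t. \<phi> t + \<psi> t) \<le> p \<phi> + p \<psi>) \<and>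
    (\<forall>\<phi> c. bounded_over K \<phi> \<longrightarrow> c \<ge> 0 \<longrightarrow> p (\<lambda>t. c * \<phi> t) = c * p \<phi>) \<and>
    (\<forall>\<phi> \<psi>. bounded_over K \<phi> \<longrightarrow> bounded_over K \<psi> \<longrightarrow> (\<forall>t\<in>K. \<phi> t \<le> \<psi> t) \<longrightarrow> p \<phi> \<le> p \<psi>) \<and>
    (\<forall>\<phi>. \<not> bounded_over K \<phi> \<longrightarrow> p \<phi> = 0)"

lemma monotone_sublinearI:
  assumes "\<And>\<phi> \<psi>. bounded_over K \<phi> \<Longrightarrow> bounded_over K \<psi> \<Longrightarrow> p (\<lambda>t. \<phi> t + \<psi> t) \<le> p \<phi> + p \<psi>"
    and "\<And>\<phi> c. bounded_over K \<phi> \<Longrightarrow> c > 0 \<Longrightarrow> p (\<lambda>t. c * \<phi> t) \<le> c * p \<phi>"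
    and "p (\<lambda>t. 0) = 0"
    and "\<And>\<phi> \<psi>. bounded_over K \<phi> \<Longrightarrow> bounded_over K \<psi> \<Longrightarrow> (\<forall>t\<in>K. \<phi> t \<le> \<psi> t) \<Longrightarrow> p \<phi> \<le> p \<psi>"
    and "\<And>\<phi>. \<not> bounded_over K \<phi> \<Longrightarrow> p \<phi> = 0"
  shows "monotone_sublinear K p"
proof -
  have "p (\<lambda>t. c * \<phi> t) = c * p \<phi>" if \<phi>: "bounded_over K \<phi>" and c: "c \<ge> 0" for \<phi> c
  proof (cases "c = 0")
    case True
    then show ?thesis using assms(3) by simp
  next
    case False
    with c have c0: "c > 0" by simp
    have "p (\<lambda>t. inverse c * (c * \<phi> t)) \<le> inverse c * p (\<lambda>t. c * \<phi> t)"
      using assms(2)[of "\<lambda>t. c * \<phi> t" "inverse c"] \<phi> c0 by simp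
    then have "p \<phi> \<le> inverse c * p (\<lambda>t. c * \<phi> t)" using c0 by (simp add: mult.assoc[symmetric])
    then have "c * p \<phi> \<le> p (\<lambda>t. c * \<phi> t)" using c0 by (simp add: field_simps)
    then show ?thesis using assms(2)[OF \<phi> c0] by simp
  qed
  then show ?thesis unfolding monotone_sublinear_def using assms by (intro conjI allI impI)
qed

context
  fixes K :: "'i set" and p :: "('i \<Rightarrow> real) \<Rightarrow> real"
  assumes p: "monotone_sublinear K p"
begin

lemma msub_add: "bounded_over K \<phi> \<Longrightarrow> bounded_over K \<psi> \<Longrightarrow> p (\<lambda>t. \<phi> t + \<psi> t) \<le> p \<phi> + p \<psi>"
  using p[unfolded monotone_sublinear_def, THEN conjunct1] by simp

lemma msub_scale: "bounded_over K \<phi> \<Longrightarrow> c \<ge> 0 \<Longrightarrow> p (\<lambda>t. c * \<phi> t) = c * p \<phi>"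
  using p[unfolded monotone_sublinear_def, THEN conjunct2, THEN conjunct1] by simp

lemma msub_mono: "bounded_over K \<phi> \<Longrightarrow> bounded_over K \<psi> \<Longrightarrow> (\<And>t. t \<in> K \<Longrightarrow> \<phi> t \<le> \<psi> t) \<Longrightarrow> p \<phi> \<le> p \<psi>"
  using p[unfolded monotone_sublinear_def, THEN conjunct2, THEN conjunct2, THEN conjunct1] by simp

lemma msub_outside: "\<not> bounded_over K \<phi> \<Longrightarrow> p \<phi> = 0"
  using p[unfolded monotone_sublinear_def, THEN conjunct2, THEN conjunct2, THEN conjunct2] by simp

lemma msub_zero: "p (\<lambda>t. 0) = 0"
  using msub_scale[of "\<lambda>t. 0" 0] by simp

lemma msub_neg: "bounded_over K \<phi> \<Longrightarrow> - p (\<lambda>t. - \<phi> t) \<le> p \<phi>"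
  using msub_add[of \<phi> "\<lambda>t. - \<phi> t"] msub_zero by simp

end

text \<open>The cone \<open>C\<close> plays the part of the concave functions in Choquet theory. It contains the constants so
that every function bounded over \<open>K\<close> has a majorant in \<open>C\<close>.\<close>

locale test_cone =
  fixes K :: "'i set" and C :: "('i \<Rightarrow> real) set"
  assumes C_bounded: "v \<in> C \<Longrightarrow> bounded_over K v"
    and C_add: "v \<in> C \<Longrightarrow> w \<in> C \<Longrightarrow> (\<lambda>t. v t + w t) \<in> C"
    and C_scale: "v \<in> C \<Longrightarrow> c \<ge> 0 \<Longrightarrow> (\<lambda>t. c * v t) \<in> C"
    and C_const: "(\<lambda>t. c) \<in> C"
begin

definition above :: "('i \<Rightarrow> real) \<Rightarrow> ('i \<Rightarrow> real) set"
  where "above \<phi> = {v \<in> C. \<forall>t\<in>K. \<phi> t \<le> v t}"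

text \<open>If \<open>p\<close> is the evaluation at a point and \<open>C\<close> the set of continuous concave functions, this is the upper
envelope of \<open>\<phi>\<close> at that point.\<close>

definition envelope :: "(('i \<Rightarrow> real) \<Rightarrow> real) \<Rightarrow> ('i \<Rightarrow> real) \<Rightarrow> real"
  where "envelope p \<phi> = (if bounded_over K \<phi> then (INF v\<in>above \<phi>. p v) else 0)"

lemma above_nonempty: "bounded_over K \<phi> \<Longrightarrow> above \<phi> \<noteq> {}"
proof -
  assume "bounded_over K \<phi>"
  then obtain B where "\<forall>t\<in>K. \<bar>\<phi> t\<bar> \<le> B" unfolding bounded_over_def by blast
  then have "(\<lambda>t. B) \<in> above \<phi>" using C_const unfolding above_def by (auto simp: abs_le_iff)
  then show ?thesis by blast
qed

lemma envelope_lower: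
  assumes "monotone_sublinear K p" "bounded_over K \<phi>" "v \<in> above \<phi>"
  shows "envelope p \<phi> \<le> p v"
proof -
  have "bdd_below (p ` above \<phi>)"
    by (rule bdd_belowI2[where m="p \<phi>"])
       (use assms C_bounded in \<open>auto simp: above_def intro: msub_mono[OF assms(1)]\<close>)
  then show ?thesis unfolding envelope_def using assms by (auto intro: cINF_lower)
qed

lemma envelope_greatest:
  assumes "bounded_over K \<phi>" "\<And>v. v \<in> above \<phi> \<Longrightarrow> m \<le> p v"
  shows "m \<le> envelope p \<phi>"
  unfolding envelope_def using assms above_nonempty by (auto intro: cINF_greatest)

lemma envelope_approx:
  assumes "monotone_sublinear K p" "bounded_over K \<phi>" "\<eta> > 0"
  obtains v where "v \<in> above \<phi>" "p v < envelope p \<phi> + \<eta>"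
  using envelope_greatest[OF assms(2), of "envelope p \<phi> + \<eta>" p] assms(3) by force

lemma envelope_ge:
  assumes "monotone_sublinear K p" shows "p \<phi> \<le> envelope p \<phi>"
proof (cases "bounded_over K \<phi>")
  case True
  then show ?thesis
    by (rule envelope_greatest) (use True C_bounded in \<open>auto simp: above_def intro: msub_mono[OF assms]\<close>)
next
  case False
  then show ?thesis by (simp add: envelope_def msub_outside[OF assms])
qed

lemma envelope_eq:
  assumes "monotone_sublinear K p" "v \<in> C" shows "envelope p v = p v"
  using envelope_lower[OF assms(1), of v v] envelope_ge[OF assms(1), of v] assms C_bounded
  by (auto simp: above_def)

lemma envelope_idem:
  assumes "monotone_sublinear K p" shows "envelope (envelope p) = envelope p"
proof
  fix \<phi>
  have "envelope p ` above \<phi> = p ` above \<phi>"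
    by (rule image_cong) (auto simp: above_def envelope_eq[OF assms])
  then show "envelope (envelope p) \<phi> = envelope p \<phi>" by (simp add: envelope_def[of _ \<phi>])
qed

lemma envelope_monotone_sublinear:
  assumes p: "monotone_sublinear K p" shows "monotone_sublinear K (envelope p)"
proof (rule monotone_sublinearI)
  fix \<phi> \<psi> assume b: "bounded_over K \<phi>" "bounded_over K \<psi>"
  show "envelope p (\<lambda>t. \<phi> t + \<psi> t) \<le> envelope p \<phi> + envelope p \<psi>"
  proof (rule field_le_epsilon)
    fix e :: real assume "e > 0"
    then have e: "e/2 > 0" by simp
    obtain v where v: "v \<in> above \<phi>" "p v < envelope p \<phi> + e/2" by (rule envelope_approx[OF p b(1) e])
    obtain w where w: "w \<in> above \<psi>" "p w < envelope p \<psi> + e/2" by (rule envelope_approx[OF p b(2) e])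
    have "(\<lambda>t. v t + w t) \<in> above (\<lambda>t. \<phi> t + \<psi> t)"
      using v w C_add by (auto simp: above_def intro: add_mono)
    then have "envelope p (\<lambda>t. \<phi> t + \<psi> t) \<le> p (\<lambda>t. v t + w t)"
      using envelope_lower[OF p] b by simp
    also have "\<dots> \<le> p v + p w" using v w C_bounded msub_add[OF p] by (auto simp: above_def)
    finally show "envelope p (\<lambda>t. \<phi> t + \<psi> t) \<le> envelope p \<phi> + envelope p \<psi> + e" using v w by linarith
  qed
next
  fix \<phi> :: "'i \<Rightarrow> real" and c :: real assume b: "bounded_over K \<phi>" and c: "c > 0"
  have "envelope p (\<lambda>t. c * \<phi> t) \<le> c * p v" if "v \<in> above \<phi>" for v
  proof -
    have "(\<lambda>t. c * v t) \<in> above (\<lambda>t. c * \<phi> t)" using that c C_scale by (auto simp: above_def)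
    then have "envelope p (\<lambda>t. c * \<phi> t) \<le> p (\<lambda>t. c * v t)" using envelope_lower[OF p] b by simp
    then show ?thesis using msub_scale[OF p] that C_bounded c by (auto simp: above_def)
  qed
  then have "envelope p (\<lambda>t. c * \<phi> t) / c \<le> envelope p \<phi>"
    using c by (intro envelope_greatest[OF b]) (simp add: field_simps)
  then show "envelope p (\<lambda>t. c * \<phi> t) \<le> c * envelope p \<phi>" using c by (simp add: field_simps)
next
  show "envelope p (\<lambda>t. 0) = 0" using envelope_eq[OF p C_const] msub_zero[OF p] by simp
next
  fix \<phi> \<psi> assume b: "bounded_over K \<phi>" "bounded_over K \<psi>" and le: "\<forall>t\<in>K. \<phi> t \<le> \<psi> t"
  show "envelope p \<phi> \<le> envelope p \<psi>"
    by (rule envelope_greatest[OF b(2)], rule envelope_lower[OF p b(1)])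
       (use le in \<open>auto simp: above_def intro: order_trans\<close>)
qed (simp add: envelope_def)

end

text \<open>This is the largest sublinear functional below \<open>p\<close> whose value at \<open>- q\<close> is at most \<open>- p q\<close>, as in
proofs of the Hahn-Banach theorem.\<close>

definition tilt :: "'i set \<Rightarrow> ('i \<Rightarrow> real) \<Rightarrow> (('i \<Rightarrow> real) \<Rightarrow> real) \<Rightarrow> ('i \<Rightarrow> real) \<Rightarrow> real"
  where "tilt K q p \<phi> =
    (if bounded_over K \<phi> then (INF s\<in>{0..}. p (\<lambda>t. \<phi> t + s * q t) - s * p q) else 0)"

context
  fixes K :: "'i set" and p :: "('i \<Rightarrow> real) \<Rightarrow> real" and q :: "'i \<Rightarrow> real"
  assumes p: "monotone_sublinear K p" and q: "bounded_over K q"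
begin

lemma tilt_bdd: 
  assumes b: "bounded_over K \<phi>"
  shows "bdd_below ((\<lambda>s. p (\<lambda>t. \<phi> t + s * q t) - s * p q) ` {0..})"
proof (rule bdd_belowI2[where m="- p (\<lambda>t. - \<phi> t)"])
  fix s :: real assume s: "s \<in> {0..}"
  have "s * p q = p (\<lambda>t. (\<phi> t + s * q t) + (- \<phi> t))" using msub_scale[OF p q, of s] s by simp
  also have "\<dots> \<le> p (\<lambda>t. \<phi> t + s * q t) + p (\<lambda>t. - \<phi> t)"
    using msub_add[OF p, of "\<lambda>t. \<phi> t + s * q t" "\<lambda>t. - \<phi> t"] b q by simp
  finally show "- p (\<lambda>t. - \<phi> t) \<le> p (\<lambda>t. \<phi> t + s * q t) - s * p q" by simp
qed

lemma tilt_lower: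
  "bounded_over K \<phi> \<Longrightarrow> s \<ge> 0 \<Longrightarrow> tilt K q p \<phi> \<le> p (\<lambda>t. \<phi> t + s * q t) - s * p q"
  unfolding tilt_def using cINF_lower[OF tilt_bdd] by auto

lemma tilt_greatest:
  "bounded_over K \<phi> \<Longrightarrow> (\<And>s. s \<ge> 0 \<Longrightarrow> m \<le> p (\<lambda>t. \<phi> t + s * q t) - s * p q) \<Longrightarrow> m \<le> tilt K q p \<phi>"
  unfolding tilt_def by (auto intro!: cINF_greatest)

lemma tilt_approx:
  assumes "bounded_over K \<phi>" "\<eta> > 0"
  obtains s where "s \<ge> 0" "p (\<lambda>t. \<phi> t + s * q t) - s * p q < tilt K q p \<phi> + \<eta>"
  using tilt_greatest[OF assms(1), of "tilt K q p \<phi> + \<eta>"] assms(2) by force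

lemma tilt_le: "tilt K q p \<phi> \<le> p \<phi>"
  using tilt_lower[of \<phi> 0] msub_outside[OF p, of \<phi>] by (cases "bounded_over K \<phi>") (auto simp: tilt_def)

lemma tilt_neg: "tilt K q p (\<lambda>t. - q t) \<le> - p q"
  using tilt_lower[of "\<lambda>t. - q t" 1] q msub_zero[OF p] by simp

lemma tilt_monotone_sublinear: "monotone_sublinear K (tilt K q p)"
proof (rule monotone_sublinearI)
  fix \<phi> \<psi> assume b: "bounded_over K \<phi>" "bounded_over K \<psi>"
  show "tilt K q p (\<lambda>t. \<phi> t + \<psi> t) \<le> tilt K q p \<phi> + tilt K q p \<psi>"
  proof (rule field_le_epsilon)
    fix e :: real assume "e > 0"
    then have e: "e/2 > 0" by simp
    obtain r where r: "r \<ge> 0" "p (\<lambda>t. \<phi> t + r * q t) - r * p q < tilt K q p \<phi> + e/2"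
      by (rule tilt_approx[OF b(1) e])
    obtain s where s: "s \<ge> 0" "p (\<lambda>t. \<psi> t + s * q t) - s * p q < tilt K q p \<psi> + e/2"
      by (rule tilt_approx[OF b(2) e])
    have "tilt K q p (\<lambda>t. \<phi> t + \<psi> t) \<le> p (\<lambda>t. (\<phi> t + \<psi> t) + (r + s) * q t) - (r + s) * p q"
      using r s b by (intro tilt_lower) auto
    also have "(\<lambda>t. (\<phi> t + \<psi> t) + (r + s) * q t) = (\<lambda>t. (\<phi> t + r * q t) + (\<psi> t + s * q t))"
      by (auto simp: algebra_simps)
    also have "p \<dots> \<le> p (\<lambda>t. \<phi> t + r * q t) + p (\<lambda>t. \<psi> t + s * q t)"
      by (rule msub_add[OF p]) (use b q in auto)
    finally show "tilt K q p (\<lambda>t. \<phi> t + \<psi> t) \<le> tilt K q p \<phi> + tilt K q p \<psi> + e"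
      using r s by (simp add: algebra_simps)
  qed
next
  fix \<phi> :: "'i \<Rightarrow> real" and c :: real assume b: "bounded_over K \<phi>" and c: "c > 0"
  have "tilt K q p (\<lambda>t. c * \<phi> t) / c \<le> p (\<lambda>t. \<phi> t + s * q t) - s * p q" if s: "s \<ge> 0" for s
  proof -
    have "tilt K q p (\<lambda>t. c * \<phi> t) \<le> p (\<lambda>t. c * \<phi> t + (c * s) * q t) - (c * s) * p q"
      using b s c by (intro tilt_lower) auto
    also have "(\<lambda>t. c * \<phi> t + (c * s) * q t) = (\<lambda>t. c * (\<phi> t + s * q t))"
      by (auto simp: algebra_simps)
    also have "p \<dots> = c * p (\<lambda>t. \<phi> t + s * q t)" by (rule msub_scale[OF p]) (use b q c in auto)
    finally show ?thesis using c by (simp add: field_simps)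
  qed
  then have "tilt K q p (\<lambda>t. c * \<phi> t) / c \<le> tilt K q p \<phi>" by (rule tilt_greatest[OF b])
  then show "tilt K q p (\<lambda>t. c * \<phi> t) \<le> c * tilt K q p \<phi>" using c by (simp add: field_simps)
next
  have "0 \<le> tilt K q p (\<lambda>t. 0)"
    by (rule tilt_greatest) (use msub_scale[OF p q] in auto)
  then show "tilt K q p (\<lambda>t. 0) = 0" using tilt_le[of "\<lambda>t. 0"] msub_zero[OF p] by simp
next
  fix \<phi> \<psi> assume b: "bounded_over K \<phi>" "bounded_over K \<psi>" and le: "\<forall>t\<in>K. \<phi> t \<le> \<psi> t"
  show "tilt K q p \<phi> \<le> tilt K q p \<psi>"
  proof (rule tilt_greatest[OF b(2)])
    fix s :: real assume s: "s \<ge> 0"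
    have "p (\<lambda>t. \<phi> t + s * q t) \<le> p (\<lambda>t. \<psi> t + s * q t)"
      by (rule msub_mono[OF p]) (use b q le in auto)
    then show "tilt K q p \<phi> \<le> p (\<lambda>t. \<psi> t + s * q t) - s * p q"
      using tilt_lower[OF b(1) s] by linarith
  qed
qed (simp add: tilt_def)

end

text \<open>All members of the chain lie below \<open>p0\<close>, so by sublinearity their values at \<open>\<phi>\<close> are at least
\<open>- p0 (- \<phi>)\<close>, and the infimum is finite.\<close>

lemma chain_infimum_monotone_sublinear:
  assumes ne: "P \<noteq> {}" and P: "\<And>p. p \<in> P \<Longrightarrow> monotone_sublinear K p \<and> p \<le> p0"
    and p0: "monotone_sublinear K p0"
    and chain: "\<And>p p'. p \<in> P \<Longrightarrow> p' \<in> P \<Longrightarrow> p \<le> p' \<or> p' \<le> p"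
  shows "monotone_sublinear K (\<lambda>\<phi>. INF p\<in>P. p \<phi>)" "\<And>\<phi>. bdd_below ((\<lambda>p. p \<phi>) ` P)"
proof -
  show bdd: "bdd_below ((\<lambda>p. p \<phi>) ` P)" for \<phi>
  proof (cases "bounded_over K \<phi>")
    case True
    show ?thesis
    proof (rule bdd_belowI2[where m="- p0 (\<lambda>t. - \<phi> t)"])
      fix p assume "p \<in> P"
      then have "- p (\<lambda>t. - \<phi> t) \<le> p \<phi>" "p (\<lambda>t. - \<phi> t) \<le> p0 (\<lambda>t. - \<phi> t)"
        using P msub_neg[OF _ True] by (auto simp: le_fun_def)
      then show "- p0 (\<lambda>t. - \<phi> t) \<le> p \<phi>" by linarith
    qed
  next
    case False
    then have "p \<phi> = 0" if "p \<in> P" for p using P that msub_outside by blast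
    then show ?thesis by (intro bdd_belowI2[where m=0]) (metis order_refl)
  qed
  let ?u = "\<lambda>\<phi>. INF p\<in>P. p \<phi>"
  have low: "?u \<phi> \<le> p \<phi>" if "p \<in> P" for p \<phi> using bdd that by (rule cINF_lower)
  have gr: "m \<le> ?u \<phi>" if "\<And>p. p \<in> P \<Longrightarrow> m \<le> p \<phi>" for m \<phi> using ne that by (rule cINF_greatest)
  have appr: "\<exists>p\<in>P. p \<phi> < ?u \<phi> + e" if "e > 0" for \<phi> and e :: real
    using gr[of "?u \<phi> + e" \<phi>] that by force
  show "monotone_sublinear K ?u"
  proof (rule monotone_sublinearI)
    fix \<phi> \<psi> assume b: "bounded_over K \<phi>" "bounded_over K \<psi>"
    show "?u (\<lambda>t. \<phi> t + \<psi> t) \<le> ?u \<phi> + ?u \<psi>"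
    proof (rule field_le_epsilon)
      fix e :: real assume "e > 0"
      then have e: "e/2 > 0" by simp
      obtain r where r: "r \<in> P" "r \<phi> < ?u \<phi> + e/2" using appr[OF e] by blast
      obtain s where s: "s \<in> P" "s \<psi> < ?u \<psi> + e/2" using appr[OF e] by blast
      obtain p where p: "p \<in> P" "p \<le> r" "p \<le> s" using chain[OF r(1) s(1)] r s by blast
      have "?u (\<lambda>t. \<phi> t + \<psi> t) \<le> p (\<lambda>t. \<phi> t + \<psi> t)" by (rule low[OF p(1)])
      also have "\<dots> \<le> p \<phi> + p \<psi>" using P[OF p(1)] b msub_add by blast
      also have "\<dots> \<le> r \<phi> + s \<psi>" using p by (auto simp: le_fun_def intro: add_mono)
      finally show "?u (\<lambda>t. \<phi> t + \<psi> t) \<le> ?u \<phi> + ?u \<psi> + e" using r s by linarith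
    qed
  next
    fix \<phi> :: "'a \<Rightarrow> real" and c :: real assume b: "bounded_over K \<phi>" and c: "c > 0"
    have "?u (\<lambda>t. c * \<phi> t) / c \<le> p \<phi>" if "p \<in> P" for p
      using low[OF that, of "\<lambda>t. c * \<phi> t"] msub_scale[OF _ b, of p c] P[OF that] c
      by (simp add: field_simps)
    then have "?u (\<lambda>t. c * \<phi> t) / c \<le> ?u \<phi>" by (rule gr)
    then show "?u (\<lambda>t. c * \<phi> t) \<le> c * ?u \<phi>" using c by (simp add: field_simps)
  next
    have "p (\<lambda>t. 0) = 0" if "p \<in> P" for p using P[OF that] msub_zero by blast
    then have "?u (\<lambda>t. 0) = (INF p\<in>P. 0)" by (intro INF_cong) auto
    then show "?u (\<lambda>t. 0) = 0" using ne by simp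
  next
    fix \<phi> \<psi> assume b: "bounded_over K \<phi>" "bounded_over K \<psi>" and le: "\<forall>t\<in>K. \<phi> t \<le> \<psi> t"
    show "?u \<phi> \<le> ?u \<psi>"
    proof (rule gr)
      fix p assume p: "p \<in> P"
      then have "p \<phi> \<le> p \<psi>" using P b le msub_mono[of K p \<phi> \<psi>] by blast
      then show "?u \<phi> \<le> p \<psi>" using low[OF p, of \<phi>] by linarith
    qed
  next
    fix \<phi> assume "\<not> bounded_over K \<phi>"
    then have "p \<phi> = 0" if "p \<in> P" for p using P[OF that] msub_outside by blast
    then have "?u \<phi> = (INF p\<in>P. 0)" by (intro INF_cong) auto
    then show "?u \<phi> = 0" using ne by simp
  qed
qed

context test_cone begin

text \<open>Take \<open>p\<close> minimal among the functionals that equal their own envelope. Tilting \<open>p\<close> by \<open>q\<close> and then taking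
the envelope gives a competitor below \<open>p\<close>, hence \<open>p\<close> itself; and the envelope does not disturb the value
at \<open>- q\<close>, which the tilt has made as small as \<open>- p q\<close>. If \<open>C\<close> consists of all bounded functions, this is
the Hahn-Banach theorem. If \<open>C\<close> consists of concave functions, the minimal \<open>p\<close> is given by a representing
measure that is maximal in Choquet's order.\<close>

theorem minimal_envelope:
  assumes p0: "monotone_sublinear K p0" and fix0: "envelope p0 = p0"
  obtains p where "monotone_sublinear K p" "envelope p = p" "p \<le> p0"
    "\<And>q. (\<lambda>t. - q t) \<in> C \<Longrightarrow> p (\<lambda>t. - q t) = - p q"
proof -
  define A where "A = {p. monotone_sublinear K p \<and> envelope p = p \<and> p \<le> p0}"
  have "\<exists>m\<in>A. \<forall>a\<in>A. a \<le> m \<longrightarrow> a = m"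
  proof (rule predicate_Zorn[where P="\<lambda>x y. y \<le> x"])
    show "partial_order_on A (relation_of (\<lambda>x y. y \<le> x) A)"
      by (rule partial_order_on_relation_ofI) auto
    fix P assume "P \<in> Chains (relation_of (\<lambda>x y. y \<le> x) A)"
    then have PA: "P \<subseteq> A" and chain: "\<And>p p'. p \<in> P \<Longrightarrow> p' \<in> P \<Longrightarrow> p \<le> p' \<or> p' \<le> p"
      unfolding Chains_def relation_of_def by auto
    show "\<exists>u\<in>A. \<forall>a\<in>P. u \<le> a"
    proof (cases "P = {}")
      case True
      then show ?thesis using p0 fix0 by (auto simp: A_def)
    next
      case False
      let ?u = "\<lambda>\<phi>. INF p\<in>P. p \<phi>"
      have mem: "\<And>p. p \<in> P \<Longrightarrow> monotone_sublinear K p \<and> p \<le> p0" using PA by (auto simp: A_def)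
      note ci = chain_infimum_monotone_sublinear[OF False mem p0 chain, simplified]
      have low: "?u \<phi> \<le> p \<phi>" if "p \<in> P" for p \<phi> using ci(2) that by (rule cINF_lower)
      have u: "monotone_sublinear K ?u" by (rule ci(1))
      have "envelope ?u \<phi> \<le> ?u \<phi>" for \<phi>
      proof (cases "bounded_over K \<phi>")
        case b: True
        show ?thesis
        proof (rule cINF_greatest[OF False])
          fix p assume p: "p \<in> P"
          then have pe: "envelope p = p" using PA by (auto simp: A_def)
          have "envelope ?u \<phi> \<le> envelope p \<phi>"
          proof (rule envelope_greatest[OF b])
            fix v assume "v \<in> above \<phi>"
            then show "envelope ?u \<phi> \<le> p v"
              using envelope_lower[OF u b] low[OF p, of v] by (meson order_trans)
          qed
          then show "envelope ?u \<phi> \<le> p \<phi>" using pe by simp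
        qed
      next
        case False
        then show ?thesis using msub_outside[OF u] by (simp add: envelope_def)
      qed
      then have "envelope ?u = ?u" using envelope_ge[OF u] by (auto intro!: antisym ext)
      moreover obtain p where "p \<in> P" using False by blast
      then have "?u \<le> p0" using low mem by (fastforce simp: le_fun_def intro: order_trans)
      ultimately have "?u \<in> A" using u by (simp add: A_def)
      moreover have "\<forall>a\<in>P. ?u \<le> a" using low by (auto simp: le_fun_def)
      ultimately show ?thesis by blast
    qed
  qed
  then obtain p where pA: "p \<in> A" and min: "\<And>a. a \<in> A \<Longrightarrow> a \<le> p \<Longrightarrow> a = p" by blast
  from pA have p: "monotone_sublinear K p" "envelope p = p" "p \<le> p0" by (auto simp: A_def)
  have "p (\<lambda>t. - q t) = - p q" if C: "(\<lambda>t. - q t) \<in> C" for q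
  proof -
    have q: "bounded_over K q" using bounded_over_minus[OF C_bounded[OF C]] by simp
    let ?r = "envelope (tilt K q p)"
    note tm = tilt_monotone_sublinear[OF p(1) q]
    have "?r \<phi> \<le> p \<phi>" for \<phi>
    proof (cases "bounded_over K \<phi>")
      case True
      have "?r \<phi> \<le> envelope p \<phi>"
      proof (rule envelope_greatest[OF True])
        fix v assume "v \<in> above \<phi>"
        then show "?r \<phi> \<le> p v"
          using envelope_lower[OF tm True] tilt_le[OF p(1) q, of v] by (meson order_trans)
      qed
      then show ?thesis using p by simp
    next
      case False
      then show ?thesis using msub_outside[OF p(1)] by (simp add: envelope_def)
    qed
    then have "?r \<le> p" by (simp add: le_fun_def)
    moreover have "?r \<in> A" using envelope_monotone_sublinear[OF tm] envelope_idem[OF tm] p(3) \<open>?r \<le> p\<close>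
      by (auto simp: A_def)
    ultimately have "?r = p" using min by blast
    moreover have "?r (\<lambda>t. - q t) = tilt K q p (\<lambda>t. - q t)" by (rule envelope_eq[OF tm C])
    ultimately have "p (\<lambda>t. - q t) \<le> - p q" using tilt_neg[OF p(1) q] by simp
    then show ?thesis using msub_neg[OF p(1) q] by linarith
  qed
  with p show ?thesis using that by blast
qed

end

section \<open>Maximal representing means\<close>

text \<open>A finitely additive probability on \<open>K\<close>, given by its integral. It is defined on all subsets of \<open>K\<close>, so
densities can be cut along any of them.\<close>

definition mean_on :: "'i set \<Rightarrow> (('i \<Rightarrow> real) \<Rightarrow> real) \<Rightarrow> bool"
  where "mean_on K L \<longleftrightarrow>
    (\<forall>\<phi> \<psi>. bounded_over K \<phi> \<longrightarrow> bounded_over K \<psi> \<longrightarrow> L (\<lambda>t. \<phi> t + \<psi> t) = L \<phi> + L \<psi>) \<and>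
    (\<forall>\<phi> c. bounded_over K \<phi> \<longrightarrow> L (\<lambda>t. c * \<phi> t) = c * L \<phi>) \<and>
    (\<forall>\<phi> \<psi>. bounded_over K \<phi> \<longrightarrow> bounded_over K \<psi> \<longrightarrow> (\<forall>t\<in>K. \<phi> t \<le> \<psi> t) \<longrightarrow> L \<phi> \<le> L \<psi>) \<and>
    L (\<lambda>t. 1) = 1"

context
  fixes K :: "'i set" and L :: "('i \<Rightarrow> real) \<Rightarrow> real"
  assumes L: "mean_on K L"
begin

lemma mean_add: "bounded_over K \<phi> \<Longrightarrow> bounded_over K \<psi> \<Longrightarrow> L (\<lambda>t. \<phi> t + \<psi> t) = L \<phi> + L \<psi>"
  using L[unfolded mean_on_def, THEN conjunct1] by simp

lemma mean_scale: "bounded_over K \<phi> \<Longrightarrow> L (\<lambda>t. c * \<phi> t) = c * L \<phi>"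
  using L[unfolded mean_on_def, THEN conjunct2, THEN conjunct1] by simp

lemma mean_mono:
  "bounded_over K \<phi> \<Longrightarrow> bounded_over K \<psi> \<Longrightarrow> (\<And>t. t \<in> K \<Longrightarrow> \<phi> t \<le> \<psi> t) \<Longrightarrow> L \<phi> \<le> L \<psi>"
  using L[unfolded mean_on_def, THEN conjunct2, THEN conjunct2, THEN conjunct1] by simp

lemma mean_const: "L (\<lambda>t. c) = c"
  using mean_scale[of "\<lambda>t. 1" c] L[unfolded mean_on_def, THEN conjunct2, THEN conjunct2, THEN conjunct2]
  by simp

lemma mean_cong:
  "bounded_over K \<phi> \<Longrightarrow> bounded_over K \<psi> \<Longrightarrow> (\<And>t. t \<in> K \<Longrightarrow> \<phi> t = \<psi> t) \<Longrightarrow> L \<phi> = L \<psi>"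
  by (rule antisym; rule mean_mono) auto

lemma mean_minus: "bounded_over K \<phi> \<Longrightarrow> L (\<lambda>t. - \<phi> t) = - L \<phi>"
  using mean_scale[of \<phi> "-1"] by simp

lemma mean_diff: "bounded_over K \<phi> \<Longrightarrow> bounded_over K \<psi> \<Longrightarrow> L (\<lambda>t. \<phi> t - \<psi> t) = L \<phi> - L \<psi>"
  using mean_add[of \<phi> "\<lambda>t. - \<psi> t"] mean_minus[of \<psi>] by simp

lemma mean_sum:
  "finite I \<Longrightarrow> (\<And>i. i \<in> I \<Longrightarrow> bounded_over K (\<phi> i)) \<Longrightarrow> L (\<lambda>t. \<Sum>i\<in>I. \<phi> i t) = (\<Sum>i\<in>I. L (\<phi> i))"
proof (induction I rule: finite_induct)
  case empty
  then show ?case using mean_const[of 0] by simp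
next
  case (insert i I)
  then have "L (\<lambda>t. \<phi> i t + (\<Sum>i\<in>I. \<phi> i t)) = L (\<phi> i) + L (\<lambda>t. \<Sum>i\<in>I. \<phi> i t)"
    by (intro mean_add bounded_over_sum) auto
  then show ?case using insert by simp
qed

lemma mean_nonneg: "bounded_over K \<phi> \<Longrightarrow> (\<And>t. t \<in> K \<Longrightarrow> 0 \<le> \<phi> t) \<Longrightarrow> 0 \<le> L \<phi>"
  using mean_mono[of "\<lambda>t. 0" \<phi>] mean_const[of 0] by simp

end

text \<open>These functions replace the continuous concave functions. Each of them depends on finitely many
vectors only, so a countable set of vectors can be closed under the vectors that occur in chosen
majorants; and the negative of the square of an evaluation is among them.\<close>

definition concave_quadratic ::
    "real \<Rightarrow> 'a \<Rightarrow> 'a list \<Rightarrow> ('a::real_normed_vector \<Rightarrow>\<^sub>L real) \<Rightarrow> real"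
  where "concave_quadratic c x ys t =
    c + blinfun_apply t x - (\<Sum>y\<leftarrow>ys. (blinfun_apply t y)\<^sup>2)"

lemma bounded_over_eval [simp]:
  "bounded_over (cball 0 1) (\<lambda>t :: 'a::real_normed_vector \<Rightarrow>\<^sub>L real. blinfun_apply t x)"
  by (rule bounded_overI[OF dual_ball_bound])

lemma bounded_over_eval_square [simp]:
  "bounded_over (cball 0 1) (\<lambda>t :: 'a::real_normed_vector \<Rightarrow>\<^sub>L real. (blinfun_apply t x)\<^sup>2)"
  unfolding power2_eq_square by simp

lemma bounded_over_concave_quadratic [simp]:
  "bounded_over (cball 0 1) (concave_quadratic c x ys)"
proof -
  have "bounded_over (cball 0 1) (\<lambda>t. \<Sum>y\<leftarrow>ys. (blinfun_apply t y)\<^sup>2)"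
    by (induction ys) simp_all
  then show ?thesis unfolding concave_quadratic_def[abs_def] by simp
qed

lemma concave_quadratic_segment:
  assumes "0 \<le> r" "r \<le> 1"
  shows "(1 - r) * concave_quadratic c x ys a + r * concave_quadratic c x ys b
    \<le> concave_quadratic c x ys ((1 - r) *\<^sub>R a + r *\<^sub>R b)"
proof -
  have ev: "blinfun_apply ((1 - r) *\<^sub>R a + r *\<^sub>R b) y = (1 - r) * blinfun_apply a y + r * blinfun_apply b y" for y
    by (simp only: blinfun.add_left blinfun.scaleR_left real_scaleR_def)
  have "(\<Sum>y\<leftarrow>ys. (blinfun_apply ((1 - r) *\<^sub>R a + r *\<^sub>R b) y)\<^sup>2)
      \<le> (1 - r) * (\<Sum>y\<leftarrow>ys. (blinfun_apply a y)\<^sup>2) + r * (\<Sum>y\<leftarrow>ys. (blinfun_apply b y)\<^sup>2)"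
  proof (induction ys)
    case (Cons y ys)
    have "(1 - r) * (blinfun_apply a y)\<^sup>2 + r * (blinfun_apply b y)\<^sup>2
        - (blinfun_apply ((1 - r) *\<^sub>R a + r *\<^sub>R b) y)\<^sup>2
        = (1 - r) * r * (blinfun_apply a y - blinfun_apply b y)\<^sup>2"
      unfolding ev by (simp add: power2_eq_square algebra_simps)
    also have "\<dots> \<ge> 0" using assms by simp
    finally show ?case using Cons by (simp only: list.map sum_list.Cons distrib_left)
  qed simp
  then show ?thesis
    unfolding concave_quadratic_def ev by (simp add: algebra_simps)
qed

lemma test_cone_concave_quadratics:
  "test_cone (cball 0 1) {concave_quadratic c x ys | c (x :: 'a::real_normed_vector) ys. True}"
proof
  fix v w :: "('a \<Rightarrow>\<^sub>L real) \<Rightarrow> real" and k :: real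
  let ?C = "{concave_quadratic c x ys | c (x :: 'a) ys. True}"
  assume "v \<in> ?C"
  then obtain c x ys where v: "v = concave_quadratic c x ys" by blast
  then show "bounded_over (cball 0 1) v" by simp
  {
    assume "w \<in> ?C"
    then obtain c' x' ys' where w: "w = concave_quadratic c' x' ys'" by blast
    have "(\<lambda>t. v t + w t) = concave_quadratic (c + c') (x + x') (ys @ ys')"
      by (auto simp: v w concave_quadratic_def blinfun.add_right)
    then show "(\<lambda>t. v t + w t) \<in> ?C" by blast
  }
  assume k: "k \<ge> 0"
  have "(\<Sum>y\<leftarrow>map (\<lambda>y. sqrt k *\<^sub>R y) ys. (blinfun_apply t y)\<^sup>2) = k * (\<Sum>y\<leftarrow>ys. (blinfun_apply t y)\<^sup>2)"
    for t :: "'a \<Rightarrow>\<^sub>L real"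
    using k by (induction ys) (auto simp: blinfun.scaleR_right power_mult_distrib algebra_simps)
  then have "(\<lambda>t. k * v t) = concave_quadratic (k * c) (k *\<^sub>R x) (map (\<lambda>y. sqrt k *\<^sub>R y) ys)"
    by (auto simp: v concave_quadratic_def blinfun.scaleR_right algebra_simps)
  then show "(\<lambda>t. k * v t) \<in> ?C" by blast
next
  fix k :: real
  have "(\<lambda>t. k) = concave_quadratic k (0 :: 'a) []"
    by (auto simp: concave_quadratic_def)
  then show "(\<lambda>t. k) \<in> {concave_quadratic c x ys | c (x :: 'a) ys. True}" by blast
qed

text \<open>With all bounded functions as test cone every functional equals its envelope, and a minimal one is
linear.\<close>

lemma mean_below_sublinear:
  assumes p: "monotone_sublinear K p" and one: "p (\<lambda>t. 1) \<le> 1" "p (\<lambda>t. - 1) \<le> - 1"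
  obtains L where "mean_on K L" "L \<le> p"
proof -
  interpret all: test_cone K "{\<phi>. bounded_over K \<phi>}"
    by unfold_locales auto
  have "all.envelope p \<phi> = p \<phi>" for \<phi>
    using all.envelope_eq[OF p, of \<phi>] msub_outside[OF p] by (cases "bounded_over K \<phi>") (auto simp: all.envelope_def)
  then have "all.envelope p = p" by blast
  from all.minimal_envelope[OF p this] obtain L where
    L: "monotone_sublinear K L" "L \<le> p" and neg: "\<And>\<phi>. bounded_over K (\<lambda>t. - \<phi> t) \<Longrightarrow> L (\<lambda>t. - \<phi> t) = - L \<phi>"
    by auto
  have neg': "L (\<lambda>t. - \<phi> t) = - L \<phi>" if "bounded_over K \<phi>" for \<phi> using neg that by simp
  have "mean_on K L"
    unfolding mean_on_def
  proof (intro conjI allI impI)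
    fix \<phi> \<psi> assume b: "bounded_over K \<phi>" "bounded_over K \<psi>"
    have "L (\<lambda>t. - \<phi> t + - \<psi> t) \<le> L (\<lambda>t. - \<phi> t) + L (\<lambda>t. - \<psi> t)"
      by (rule msub_add[OF L(1)]) (use b in simp_all)
    moreover have "L (\<lambda>t. - \<phi> t + - \<psi> t) = - L (\<lambda>t. \<phi> t + \<psi> t)"
      using neg'[of "\<lambda>t. \<phi> t + \<psi> t"] b by simp
    ultimately show "L (\<lambda>t. \<phi> t + \<psi> t) = L \<phi> + L \<psi>"
      using msub_add[OF L(1) b] neg'[OF b(1)] neg'[OF b(2)] by linarith
  next
    fix \<phi> and c :: real assume b: "bounded_over K \<phi>"
    show "L (\<lambda>t. c * \<phi> t) = c * L \<phi>"
    proof (cases "c \<ge> 0")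
      case True
      then show ?thesis using msub_scale[OF L(1) b] by simp
    next
      case False
      then have "L (\<lambda>t. (- c) * \<phi> t) = (- c) * L \<phi>" using msub_scale[OF L(1) b, of "- c"] by simp
      then show ?thesis using neg'[of "\<lambda>t. c * \<phi> t"] b by simp
    qed
  next
    fix \<phi> \<psi> assume "bounded_over K \<phi>" "bounded_over K \<psi>" "\<forall>t\<in>K. \<phi> t \<le> \<psi> t"
    then show "L \<phi> \<le> L \<psi>" using msub_mono[OF L(1)] by blast
  next
    show "L (\<lambda>t. 1) = 1"
      using le_funD[OF L(2), of "\<lambda>t. 1"] le_funD[OF L(2), of "\<lambda>t. - 1"] neg'[of "\<lambda>t. 1"] one by simp
  qed
  then show ?thesis using that L(2) by blast
qed

text \<open>A finitely additive form of the existence of maximal representing measures. The last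
property says that the square of every evaluation has the same mean as its upper envelope.
Where the two agree at a point, the point cannot be split into two points of the ball on which the
evaluation differs. In this sense \<open>L\<close> lives on points that look extreme to any countable set of vectors.

The minimal functional \<open>p\<close> below the envelope of the evaluation at \<open>f\<close> is linear on the span of the
concave quadratics; \<open>L\<close> is a linear functional below \<open>p\<close> and agrees with it there, and the majorants
come from \<open>p\<close> being its own envelope.\<close>

theorem maximal_representing_mean:
  fixes f :: "'a::real_normed_vector \<Rightarrow>\<^sub>L real"
  assumes f: "f \<in> cball 0 1"
  obtains L where "mean_on (cball 0 1) L" "\<And>x. L (\<lambda>t. blinfun_apply t x) = blinfun_apply f x"
    "\<And>y \<eta>. \<eta> > 0 \<Longrightarrow> \<exists>c x ys. (\<forall>t\<in>cball 0 1. (blinfun_apply t y)\<^sup>2 \<le> concave_quadratic c x ys t) \<and>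
        L (concave_quadratic c x ys) \<le> L (\<lambda>t. (blinfun_apply t y)\<^sup>2) + \<eta>"
proof -
  let ?K = "cball (0 :: 'a \<Rightarrow>\<^sub>L real) 1"
  let ?C = "{concave_quadratic c x ys | c (x :: 'a) ys. True}"
  interpret test_cone ?K ?C by (rule test_cone_concave_quadratics)
  define p00 where "p00 \<phi> = (if bounded_over ?K \<phi> then \<phi> f else 0)" for \<phi> :: "('a \<Rightarrow>\<^sub>L real) \<Rightarrow> real"
  have p00: "monotone_sublinear ?K p00"
    by (rule monotone_sublinearI) (use f in \<open>auto simp: p00_def\<close>)
  obtain p where p: "monotone_sublinear ?K p" "envelope p = p" "p \<le> envelope p00"
      and pneg: "\<And>q. (\<lambda>t. - q t) \<in> ?C \<Longrightarrow> p (\<lambda>t. - q t) = - p q"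
    by (rule minimal_envelope[OF envelope_monotone_sublinear[OF p00] envelope_idem[OF p00]]) blast
  have pC: "p v \<le> v f" if "v \<in> ?C" for v
    using le_funD[OF p(3), of v] envelope_eq[OF p00 that] C_bounded[OF that] by (simp add: p00_def)
  obtain L where mean: "mean_on ?K L" and Lle: "L \<le> p"
    using mean_below_sublinear[OF p(1) pC[OF C_const] pC[OF C_const]] by blast
  note Lneg = mean_minus[OF mean]
  have Lp: "L v = p v" if "v \<in> ?C" for v
  proof -
    have "p (\<lambda>t. - (- v t)) = - p (\<lambda>t. - v t)" using pneg[of "\<lambda>t. - v t"] that by simp
    moreover have "L v \<le> p v" "L (\<lambda>t. - v t) \<le> p (\<lambda>t. - v t)" using le_funD[OF Lle] by blast+
    ultimately show ?thesis using Lneg C_bounded[OF that] by simp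
  qed
  have affine: "L v = v f" if "v \<in> ?C" "(\<lambda>t. - v t) \<in> ?C" for v
    using pC[OF that(1)] pC[OF that(2)] Lp[OF that(1)] Lp[OF that(2)] Lneg C_bounded[OF that(1)] by simp
  have rep: "L (\<lambda>t. blinfun_apply t x) = blinfun_apply f x" for x
  proof -
    have "(\<lambda>t. blinfun_apply t x) = concave_quadratic 0 x []"
      "(\<lambda>t. - blinfun_apply t x) = concave_quadratic 0 (- x) []"
      by (auto simp: concave_quadratic_def blinfun.minus_right)
    then show ?thesis by (intro affine CollectI) blast+
  qed
  have max: "\<exists>c x ys. (\<forall>t\<in>?K. (blinfun_apply t y)\<^sup>2 \<le> concave_quadratic c x ys t) \<and>
        L (concave_quadratic c x ys) \<le> L (\<lambda>t. (blinfun_apply t y)\<^sup>2) + \<eta>" if \<eta>: "\<eta> > 0" for y \<eta>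
  proof -
    let ?q = "\<lambda>t. (blinfun_apply t y)\<^sup>2"
    have b: "bounded_over ?K ?q" by simp
    have "(\<lambda>t. - ?q t) = concave_quadratic 0 0 [y]" by (auto simp: concave_quadratic_def)
    then have C: "(\<lambda>t. - ?q t) \<in> ?C" by blast
    have Lq: "L ?q = p ?q" using Lp[OF C] pneg[OF C] Lneg[OF b] by simp
    obtain v where v: "v \<in> above ?q" "p v < envelope p ?q + \<eta>" by (rule envelope_approx[OF p(1) b \<eta>])
    then have vC: "v \<in> ?C" and le: "\<forall>t\<in>?K. ?q t \<le> v t" unfolding above_def by blast+
    from vC obtain c x ys where "v = concave_quadratic c x ys" by blast
    moreover have "L v \<le> L ?q + \<eta>" using Lp[OF vC] Lq p(2) v(2) by simp
    ultimately show ?thesis using le by blast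
  qed
  show ?thesis by (rule that[OF mean rep max])
qed

section \<open>Rounding stochastic matrices\<close>

lemma two_equations_three_unknowns:
  fixes a1 a2 a3 b1 b2 b3 :: real
  obtains c1 c2 c3 where "c1 \<noteq> 0 \<or> c2 \<noteq> 0 \<or> c3 \<noteq> 0"
    "c1 * a1 + c2 * a2 + c3 * a3 = 0" "c1 * b1 + c2 * b2 + c3 * b3 = 0"
proof (cases "a2 * b3 - a3 * b2 = 0 \<and> a3 * b1 - a1 * b3 = 0 \<and> a1 * b2 - a2 * b1 = 0")
  case False
  (* the cross product of the two coefficient vectors *)
  then show ?thesis
    by (intro that[of "a2 * b3 - a3 * b2" "a3 * b1 - a1 * b3" "a1 * b2 - a2 * b1"])
       (auto simp: algebra_simps)
next
  case cross: True
  consider "a1 \<noteq> 0" | "a1 = 0" "a2 \<noteq> 0 \<or> a3 \<noteq> 0" | "a1 = 0" "a2 = 0" "a3 = 0" by blast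
  then show ?thesis
  proof cases
    case 1
    with cross show ?thesis by (intro that[of "- a2" a1 0]) (auto simp: algebra_simps)
  next
    case 2
    with cross show ?thesis by (intro that[of 1 0 0]) auto
  next
    case 3
    then show ?thesis
    proof (cases "b1 = 0")
      case True
      with 3 show ?thesis by (intro that[of 1 0 0]) auto
    next
      case False
      with 3 show ?thesis by (intro that[of "b2" "- b1" 0]) auto
    qed
  qed
qed

text \<open>The step \<open>s\<close> is the largest one that keeps all entries nonnegative.\<close>

lemma push_to_boundary:
  fixes p d :: "'x \<Rightarrow> real"
  assumes I: "finite I" and p: "\<And>x. x \<in> I \<Longrightarrow> p x \<ge> 0" and supp: "\<And>x. x \<in> I \<Longrightarrow> p x = 0 \<Longrightarrow> d x = 0"
    and neg: "\<exists>x\<in>I. d x < 0"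
  shows "\<exists>s>0. (\<forall>x\<in>I. p x + s * d x \<ge> 0) \<and> (\<exists>x\<in>I. p x > 0 \<and> p x + s * d x = 0)"
proof -
  let ?R = "(\<lambda>x. p x / (- d x)) ` {x \<in> I. d x < 0}"
  have fin: "finite ?R" and ne: "?R \<noteq> {}" using I neg by auto
  define s where "s = Min ?R"
  obtain x0 where x0: "x0 \<in> I" "d x0 < 0" "s = p x0 / (- d x0)"
    using Min_in[OF fin ne] unfolding s_def[symmetric] by auto
  have px0: "p x0 > 0" using p[OF x0(1)] supp[OF x0(1)] x0(2) by force
  show ?thesis
  proof (intro exI[of _ s] conjI ballI)
    show s: "s > 0" using x0 px0 by (simp add: divide_pos_neg)
    fix x assume x: "x \<in> I"
    show "p x + s * d x \<ge> 0"
    proof (cases "d x < 0")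
      case True
      then have "s \<le> p x / (- d x)" unfolding s_def using fin x by (intro Min_le) auto
      moreover have "0 < - d x" using True by simp
      ultimately have "s * (- d x) \<le> p x" by (simp only: pos_le_divide_eq)
      then show ?thesis by simp
    next
      case False
      then show ?thesis using s p[OF x] by simp
    qed
  next
    show "\<exists>x\<in>I. p x > 0 \<and> p x + s * d x = 0"
      using x0 px0 by (intro bexI[of _ x0]) (auto simp: field_simps)
  qed
qed

definition stochastic :: "'j set \<Rightarrow> 'l set \<Rightarrow> ('j \<times> 'l \<Rightarrow> real) \<Rightarrow> bool"
  where "stochastic J M p \<longleftrightarrow> (\<forall>x\<in>J \<times> M. p x \<ge> 0) \<and> (\<forall>j\<in>J. (\<Sum>l\<in>M. p (j, l)) = 1)"

definition fractional_rows :: "'j set \<Rightarrow> 'l set \<Rightarrow> ('j \<times> 'l \<Rightarrow> real) \<Rightarrow> 'j set"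
  where "fractional_rows J M p = {j \<in> J. \<exists>l\<in>M. 0 < p (j, l) \<and> p (j, l) < 1}"

lemma fractional_row_two_entries:
  assumes p: "stochastic J M p" and fin: "finite M" and j: "j \<in> fractional_rows J M p"
  obtains l l' where "l \<in> M" "l' \<in> M" "l \<noteq> l'" "p (j, l) > 0" "p (j, l') > 0"
proof -
  obtain l where l: "j \<in> J" "l \<in> M" "0 < p (j, l)" "p (j, l) < 1"
    using j by (auto simp: fractional_rows_def)
  have "(\<Sum>l'\<in>M - {l}. p (j, l')) = 1 - p (j, l)"
    using p l fin by (simp add: stochastic_def sum_diff1)
  then have "(\<Sum>l'\<in>M - {l}. p (j, l')) \<noteq> 0" using l by simp
  then obtain l' where "l' \<in> M - {l}" "p (j, l') \<noteq> 0" by (meson sum.neutral)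
  then show ?thesis using that[of l l'] l p by (force simp: stochastic_def)
qed

text \<open>If three rows are fractional, there is a nonzero direction that shifts mass between two positive
entries in each of these rows and respects the two linear constraints, because three unknown
amounts meet two equations. Moving from \<open>p\<close> along this direction in both senses until an entry
vanishes places \<open>p\<close> between two matrices with fewer positive entries, and any linear
functional \<open>h\<close> is at most its value at \<open>p\<close> on one of them. That one finite set \<open>Q\<close> serves all \<open>h\<close> is the
dual form of saying that \<open>p\<close> lies in the convex hull of \<open>Q\<close>.\<close>

lemma rounding:
  fixes p \<alpha> \<beta> :: "'j \<times> 'l \<Rightarrow> real"
  assumes J: "finite J" and M: "finite M" and p: "stochastic J M p"
  shows "\<exists>Q. finite Q \<and>
    (\<forall>q\<in>Q. stochastic J M q \<and> (\<forall>x\<in>J \<times> M. p x = 0 \<longrightarrow> q x = 0) \<and>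
      (\<Sum>x\<in>J \<times> M. \<alpha> x * q x) = (\<Sum>x\<in>J \<times> M. \<alpha> x * p x) \<and>
      (\<Sum>x\<in>J \<times> M. \<beta> x * q x) = (\<Sum>x\<in>J \<times> M. \<beta> x * p x) \<and>
      card (fractional_rows J M q) \<le> 2) \<and>
    (\<forall>h. \<exists>q\<in>Q. (\<Sum>x\<in>J \<times> M. h x * q x) \<le> (\<Sum>x\<in>J \<times> M. h x * p x))"
    (is "\<exists>Q. ?good p Q")
  using p
proof (induction "card {x \<in> J \<times> M. p x > 0}" arbitrary: p rule: less_induct)
  case less
  let ?I = "J \<times> M"
  have I: "finite ?I" using J M by simp
  have p0: "p x \<ge> 0" if "x \<in> ?I" for x using less.prems that by (auto simp: stochastic_def)
  show ?case
  proof (cases "card (fractional_rows J M p) \<le> 2")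
    case True
    then show ?thesis using less.prems by (intro exI[of _ "{p}"]) simp
  next
    case False
    then have "card (fractional_rows J M p) \<ge> 3" by simp
    then obtain T where T: "T \<subseteq> fractional_rows J M p" "card T = 3"
      by (rule obtain_subset_with_card_n)
    then obtain j1 j2 j3 where j: "T = {j1, j2, j3}" "j1 \<noteq> j2" "j1 \<noteq> j3" "j2 \<noteq> j3"
      using T(2) unfolding card_3_iff by blast
    have jf: "j1 \<in> fractional_rows J M p" "j2 \<in> fractional_rows J M p" "j3 \<in> fractional_rows J M p"
      using T j by auto
    then have jJ: "j1 \<in> J" "j2 \<in> J" "j3 \<in> J" by (auto simp: fractional_rows_def)
    obtain l1 m1 where 1: "l1 \<in> M" "m1 \<in> M" "l1 \<noteq> m1" "p (j1, l1) > 0" "p (j1, m1) > 0"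
      by (rule fractional_row_two_entries[OF less.prems M jf(1)])
    obtain l2 m2 where 2: "l2 \<in> M" "m2 \<in> M" "l2 \<noteq> m2" "p (j2, l2) > 0" "p (j2, m2) > 0"
      by (rule fractional_row_two_entries[OF less.prems M jf(2)])
    obtain l3 m3 where 3: "l3 \<in> M" "m3 \<in> M" "l3 \<noteq> m3" "p (j3, l3) > 0" "p (j3, m3) > 0"
      by (rule fractional_row_two_entries[OF less.prems M jf(3)])
    obtain c1 c2 c3 where c: "c1 \<noteq> 0 \<or> c2 \<noteq> 0 \<or> c3 \<noteq> 0"
      "c1 * (\<alpha> (j1, l1) - \<alpha> (j1, m1)) + c2 * (\<alpha> (j2, l2) - \<alpha> (j2, m2)) + c3 * (\<alpha> (j3, l3) - \<alpha> (j3, m3)) = 0"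
      "c1 * (\<beta> (j1, l1) - \<beta> (j1, m1)) + c2 * (\<beta> (j2, l2) - \<beta> (j2, m2)) + c3 * (\<beta> (j3, l3) - \<beta> (j3, m3)) = 0"
      by (rule two_equations_three_unknowns)
    define e where "e y z x = (if x = y then 1 else 0 :: real) - (if x = z then 1 else 0)" for y z x :: "'j \<times> 'l"
    define d where "d x = c1 * e (j1, l1) (j1, m1) x + c2 * e (j2, l2) (j2, m2) x
        + c3 * e (j3, l3) (j3, m3) x" for x
    have e_sum: "(\<Sum>x\<in>?I. h x * e y z x) = h y - h z" if "y \<in> ?I" "z \<in> ?I" for h y z
    proof -
      have "h x * e y z x = (if x = y then h x else 0) - (if x = z then h x else 0)" for x
        by (simp add: e_def)
      then show ?thesis using that I by (simp add: sum_subtractf)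
    qed
    have d_sum: "(\<Sum>x\<in>?I. h x * d x) = c1 * (h (j1, l1) - h (j1, m1)) + c2 * (h (j2, l2) - h (j2, m2))
        + c3 * (h (j3, l3) - h (j3, m3))" for h
    proof -
      have "(\<Sum>x\<in>?I. h x * d x) = c1 * (\<Sum>x\<in>?I. h x * e (j1, l1) (j1, m1) x)
          + c2 * (\<Sum>x\<in>?I. h x * e (j2, l2) (j2, m2) x) + c3 * (\<Sum>x\<in>?I. h x * e (j3, l3) (j3, m3) x)"
        unfolding d_def sum_distrib_left sum.distrib[symmetric]
        by (intro sum.cong refl) (simp add: algebra_simps)
      then show ?thesis using e_sum jJ 1 2 3 by simp
    qed
    have row: "(\<Sum>l\<in>M. e (i, l') (i, m') (j, l)) = 0" if "l' \<in> M" "m' \<in> M" for i j l' m'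
      using that M by (cases "i = j") (simp_all add: e_def sum_subtractf)
    have d_row: "(\<Sum>l\<in>M. d (j, l)) = 0" for j
      using row[of l1 m1 j1 j] row[of l2 m2 j2 j] row[of l3 m3 j3 j] 1 2 3
      by (simp add: d_def sum.distrib sum_distrib_left[symmetric])
    have d_supp: "d x = 0" if "p x = 0" for x
    proof -
      have "x \<noteq> y" if "p y > 0" for y using that \<open>p x = 0\<close> by auto
      with 1 2 3 have "x \<noteq> (j1, l1)" "x \<noteq> (j1, m1)" "x \<noteq> (j2, l2)" "x \<noteq> (j2, m2)" "x \<noteq> (j3, l3)" "x \<noteq> (j3, m3)"
        by blast+
      then show ?thesis by (simp add: d_def e_def)
    qed
    have "d (j1, l1) = c1" "d (j1, m1) = - c1" "d (j2, l2) = c2" "d (j2, m2) = - c2"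
        "d (j3, l3) = c3" "d (j3, m3) = - c3"
      using j 1 2 3 by (simp_all add: d_def e_def)
    moreover have "(j1, l1) \<in> ?I" "(j1, m1) \<in> ?I" "(j2, l2) \<in> ?I" "(j2, m2) \<in> ?I" "(j3, l3) \<in> ?I" "(j3, m3) \<in> ?I"
      using jJ 1 2 3 by simp_all
    moreover have "(\<exists>x\<in>?I. d x < 0) \<and> (\<exists>x\<in>?I. d x > 0)"
      if "u \<in> ?I" "w \<in> ?I" "d u = c" "d w = - c" "c \<noteq> 0" for u w c
    proof (cases "c < 0")
      case True
      with that show ?thesis by (intro conjI bexI[of _ u] bexI[of _ w]) simp_all
    next
      case False
      with that show ?thesis by (intro conjI bexI[of _ u] bexI[of _ w]) simp_all
    qed
    ultimately have neg: "\<exists>x\<in>?I. d x < 0" and pos: "\<exists>x\<in>?I. d x > 0"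
      using c(1) by blast+
    have step: "\<exists>s. s > 0 \<and> (\<exists>Q. ?good (\<lambda>x. p x + s * (r * d x)) Q)" if r: "r = 1 \<or> r = -1" for r :: real
    proof -
      have neg': "\<exists>x\<in>?I. r * d x < 0"
      proof (cases "r = 1")
        case True
        then show ?thesis using neg by simp
      next
        case False
        then have "r = -1" using r by simp
        then show ?thesis using pos by simp
      qed
      have supp': "r * d x = 0" if "p x = 0" for x using d_supp[OF that] by simp
      have "\<exists>s>0. (\<forall>x\<in>?I. p x + s * (r * d x) \<ge> 0) \<and> (\<exists>x\<in>?I. p x > 0 \<and> p x + s * (r * d x) = 0)"
        by (rule push_to_boundary[OF I p0 supp' neg'])
      then obtain s where s: "s > 0" "\<forall>x\<in>?I. p x + s * (r * d x) \<ge> 0"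
          "\<exists>x\<in>?I. p x > 0 \<and> p x + s * (r * d x) = 0" by blast
      let ?q = "\<lambda>x. p x + s * (r * d x)"
      have "(\<Sum>l\<in>M. ?q (j, l)) = 1" if "j \<in> J" for j
        using less.prems d_row[of j] that
        by (simp add: stochastic_def sum.distrib sum_distrib_left[symmetric])
      then have st: "stochastic J M ?q"
        unfolding stochastic_def using s(2) by blast
      have "{x \<in> ?I. ?q x > 0} \<subseteq> {x \<in> ?I. p x > 0}"
      proof
        fix x assume "x \<in> {x \<in> ?I. ?q x > 0}"
        then have "x \<in> ?I" "?q x \<noteq> 0" by simp_all
        then show "x \<in> {x \<in> ?I. p x > 0}" using d_supp[of x] p0[of x] by (cases "p x = 0") simp_all
      qed
      moreover obtain x where "x \<in> ?I" "p x > 0" "?q x = 0" using s(3) by blast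
      then have "x \<in> {x \<in> ?I. p x > 0}" "x \<notin> {x \<in> ?I. ?q x > 0}" by simp_all
      ultimately have "{x \<in> ?I. ?q x > 0} \<subset> {x \<in> ?I. p x > 0}" by blast
      then have "card {x \<in> ?I. ?q x > 0} < card {x \<in> ?I. p x > 0}"
        using I by (intro psubset_card_mono) auto
      from less.hyps[OF this st] show ?thesis using s(1) by (intro exI[of _ s] conjI)
    qed
    obtain s where s': "s > 0 \<and> (\<exists>Q. ?good (\<lambda>x. p x + s * (1 * d x)) Q)"
      by (rule exE[OF step[OF disjI1[OF refl]]])
    note s = s'[THEN conjunct1]
    obtain Q where Q: "?good (\<lambda>x. p x + s * (1 * d x)) Q" by (rule exE[OF s'[THEN conjunct2]])
    obtain s' where s'': "s' > 0 \<and> (\<exists>Q. ?good (\<lambda>x. p x + s' * (-1 * d x)) Q)"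
      by (rule exE[OF step[OF disjI2[OF refl]]])
    note s' = s''[THEN conjunct1]
    obtain Q' where Q': "?good (\<lambda>x. p x + s' * (-1 * d x)) Q'" by (rule exE[OF s''[THEN conjunct2]])
    define q where "q x = p x + s * (1 * d x)" for x
    define q' where "q' x = p x + s' * (-1 * d x)" for x
    note Q = Q[folded q_def] note Q' = Q'[folded q'_def]
    have supp: "\<And>x. p x = 0 \<Longrightarrow> q x = 0" "\<And>x. p x = 0 \<Longrightarrow> q' x = 0" using d_supp by (simp_all add: q_def q'_def)
    have sum_q: "(\<Sum>x\<in>?I. h x * q x) = (\<Sum>x\<in>?I. h x * p x) + s * (\<Sum>x\<in>?I. h x * d x)" for h
      by (simp add: q_def sum_distrib_left sum.distrib[symmetric] algebra_simps)
    have sum_q': "(\<Sum>x\<in>?I. h x * q' x) = (\<Sum>x\<in>?I. h x * p x) - s' * (\<Sum>x\<in>?I. h x * d x)" for h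
      by (simp add: q'_def sum_distrib_left sum_subtractf[symmetric] algebra_simps)
    have zero: "(\<Sum>x\<in>?I. \<alpha> x * d x) = 0" "(\<Sum>x\<in>?I. \<beta> x * d x) = 0" unfolding d_sum using c by simp_all
    have sums: "(\<Sum>x\<in>?I. \<alpha> x * q x) = (\<Sum>x\<in>?I. \<alpha> x * p x)" "(\<Sum>x\<in>?I. \<beta> x * q x) = (\<Sum>x\<in>?I. \<beta> x * p x)"
        "(\<Sum>x\<in>?I. \<alpha> x * q' x) = (\<Sum>x\<in>?I. \<alpha> x * p x)" "(\<Sum>x\<in>?I. \<beta> x * q' x) = (\<Sum>x\<in>?I. \<beta> x * p x)"
      by (simp_all only: sum_q sum_q' zero mult_zero_right add_0_right diff_0_right)
    note Q1 = Q[THEN conjunct1] Q'[THEN conjunct1]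
    note Q2 = Q[unfolded sums(1,2), THEN conjunct2, THEN conjunct1, THEN bspec]
    note Q2' = Q'[unfolded sums(3,4), THEN conjunct2, THEN conjunct1, THEN bspec]
    note Q3 = Q[THEN conjunct2, THEN conjunct2, THEN spec] Q'[THEN conjunct2, THEN conjunct2, THEN spec]
    have "?good p (Q \<union> Q')"
    proof (intro conjI allI)
      show "finite (Q \<union> Q')" by (rule finite_UnI[OF Q1])
      show "\<forall>r\<in>Q \<union> Q'. stochastic J M r \<and> (\<forall>x\<in>?I. p x = 0 \<longrightarrow> r x = 0) \<and>
          (\<Sum>x\<in>?I. \<alpha> x * r x) = (\<Sum>x\<in>?I. \<alpha> x * p x) \<and>
          (\<Sum>x\<in>?I. \<beta> x * r x) = (\<Sum>x\<in>?I. \<beta> x * p x) \<and> card (fractional_rows J M r) \<le> 2"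
        (is "\<forall>r\<in>_. ?round r")
      proof (intro ballI, elim UnE)
        fix r assume r: "r \<in> Q"
        have "\<forall>x\<in>?I. p x = 0 \<longrightarrow> r x = 0"
        proof (intro ballI impI)
          fix x assume "x \<in> ?I" "p x = 0"
          from Q2[OF r, THEN conjunct2, THEN conjunct1, THEN bspec, OF this(1), THEN mp, OF supp(1)[OF this(2)]]
          show "r x = 0" .
        qed
        with Q2[OF r] show "?round r" by (elim conjE) (intro conjI; assumption)
      next
        fix r assume r: "r \<in> Q'"
        have "\<forall>x\<in>?I. p x = 0 \<longrightarrow> r x = 0"
        proof (intro ballI impI)
          fix x assume "x \<in> ?I" "p x = 0"
          from Q2'[OF r, THEN conjunct2, THEN conjunct1, THEN bspec, OF this(1), THEN mp, OF supp(2)[OF this(2)]]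
          show "r x = 0" .
        qed
        with Q2'[OF r] show "?round r" by (elim conjE) (intro conjI; assumption)
      qed
      fix h
      obtain r where r: "r \<in> Q" "(\<Sum>x\<in>?I. h x * r x) \<le> (\<Sum>x\<in>?I. h x * q x)" using Q3(1) by blast
      obtain r' where r': "r' \<in> Q'" "(\<Sum>x\<in>?I. h x * r' x) \<le> (\<Sum>x\<in>?I. h x * q' x)" using Q3(2) by blast
      show "\<exists>q\<in>Q \<union> Q'. (\<Sum>x\<in>?I. h x * q x) \<le> (\<Sum>x\<in>?I. h x * p x)"
      proof (cases "(\<Sum>x\<in>?I. h x * d x) \<le> 0")
        case True
        then have "s * (\<Sum>x\<in>?I. h x * d x) \<le> 0" using s by (simp add: mult_le_0_iff)
        then show ?thesis using r sum_q[of h] by (intro bexI[of _ r]) auto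
      next
        case False
        then have "s' * (\<Sum>x\<in>?I. h x * d x) \<ge> 0" using s' by simp
        then show ?thesis using r' sum_q'[of h] by (intro bexI[of _ r']) auto
      qed
    qed
    then show ?thesis by (intro exI[of _ "Q \<union> Q'"])
  qed
qed

section \<open>Balanced tuples of densities\<close>

lemma mean_weighted_bound:
  assumes L: "mean_on K L" and w: "bounded_over K w" "\<And>t. t \<in> K \<Longrightarrow> 0 \<le> w t"
    and \<psi>: "bounded_over K \<psi>" "\<And>t. t \<in> K \<Longrightarrow> w t \<noteq> 0 \<Longrightarrow> \<bar>\<psi> t - b\<bar> \<le> B"
  shows "\<bar>L (\<lambda>t. w t * \<psi> t) - b * L w\<bar> \<le> B * L w"
proof -
  have 1: "w t * \<psi> t \<le> (b + B) * w t" "(b - B) * w t \<le> w t * \<psi> t" if t: "t \<in> K" for t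
  proof -
    have "w t * (\<psi> t - b) \<le> w t * B" "w t * (- B) \<le> w t * (\<psi> t - b)"
    proof (atomize (full), cases "w t = 0")
      case False
      then have "\<psi> t - b \<le> B" "- B \<le> \<psi> t - b" using \<psi>(2)[OF t] by linarith+
      then show "w t * (\<psi> t - b) \<le> w t * B \<and> w t * (- B) \<le> w t * (\<psi> t - b)"
        using w(2)[OF t] mult_left_mono by blast
    qed simp
    then show "w t * \<psi> t \<le> (b + B) * w t" "(b - B) * w t \<le> w t * \<psi> t"
      by (simp_all add: algebra_simps)
  qed
  have "L (\<lambda>t. w t * \<psi> t) \<le> L (\<lambda>t. (b + B) * w t)"
    by (rule mean_mono[OF L]) (use w(1) \<psi>(1) 1 in simp_all)
  moreover have "L (\<lambda>t. (b - B) * w t) \<le> L (\<lambda>t. w t * \<psi> t)"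
    by (rule mean_mono[OF L]) (use w(1) \<psi>(1) 1 in simp_all)
  ultimately show ?thesis
    using mean_scale[OF L w(1), of "b + B"] mean_scale[OF L w(1), of "b - B"]
    by (simp add: abs_le_iff algebra_simps)
qed

text \<open>A state is a tuple of \<open>N\<close> probability densities with respect to \<open>L\<close>. The functional \<open>G\<close> stands for a cluster value
of the means of \<open>\<phi> n\<close> as \<open>n\<close> grows, and \<open>c\<close> for its value at the constant density. The last conjunct
constrains every tuple of points at which the densities are positive, not just almost all of them,
so that it survives in weak* cluster points.\<close>

definition balanced_state ::
    "'i set \<Rightarrow> (('i \<Rightarrow> real) \<Rightarrow> real) \<Rightarrow> (('i \<Rightarrow> real) \<Rightarrow> real) \<Rightarrow> (nat \<Rightarrow> 'i \<Rightarrow> real)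
      \<Rightarrow> nat \<Rightarrow> real \<Rightarrow> real \<Rightarrow> nat set \<Rightarrow> (nat \<Rightarrow> 'i \<Rightarrow> real) \<Rightarrow> bool"
  where "balanced_state K L G \<phi> N c \<delta> a u \<longleftrightarrow>
    (\<forall>j<N. bounded_over K (u j) \<and> (\<forall>t\<in>K. 0 \<le> u j t) \<and> L (u j) = 1) \<and>
    (\<Sum>j<N. G (u j)) = real N * c \<and>
    (\<forall>t. (\<forall>j<N. t j \<in> K \<and> u j (t j) > 0) \<longrightarrow>
      (\<forall>n\<in>a. \<bar>(\<Sum>j<N. \<phi> n (t j)) - real N * c\<bar> \<le> real N * \<delta>))"

text \<open>The functionals for which it is harmless to drop cells of mean zero. Integration against a
bounded function and the limit functional of a sequence of such integrals are of this kind.\<close>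

definition linear_abs_cont :: "'i set \<Rightarrow> (('i \<Rightarrow> real) \<Rightarrow> real) \<Rightarrow> (('i \<Rightarrow> real) \<Rightarrow> real) \<Rightarrow> bool"
  where "linear_abs_cont K L \<Lambda> \<longleftrightarrow>
    (\<forall>v w. bounded_over K v \<longrightarrow> bounded_over K w \<longrightarrow> \<Lambda> (\<lambda>t. v t + w t) = \<Lambda> v + \<Lambda> w) \<and>
    (\<forall>w c. bounded_over K w \<longrightarrow> \<Lambda> (\<lambda>t. c * w t) = c * \<Lambda> w) \<and>
    (\<forall>w. bounded_over K w \<longrightarrow> (\<forall>t\<in>K. 0 \<le> w t) \<longrightarrow> L w = 0 \<longrightarrow> \<Lambda> w = 0) \<and>
    (\<forall>v w. bounded_over K v \<longrightarrow> bounded_over K w \<longrightarrow> (\<forall>t\<in>K. v t = w t) \<longrightarrow> \<Lambda> v = \<Lambda> w)"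

context
  fixes K :: "'i set" and L \<Lambda> :: "('i \<Rightarrow> real) \<Rightarrow> real"
  assumes \<Lambda>: "linear_abs_cont K L \<Lambda>"
begin

lemma lac_add: "bounded_over K v \<Longrightarrow> bounded_over K w \<Longrightarrow> \<Lambda> (\<lambda>t. v t + w t) = \<Lambda> v + \<Lambda> w"
  using \<Lambda>[unfolded linear_abs_cont_def, THEN conjunct1] by simp

lemma lac_scale: "bounded_over K w \<Longrightarrow> \<Lambda> (\<lambda>t. c * w t) = c * \<Lambda> w"
  using \<Lambda>[unfolded linear_abs_cont_def, THEN conjunct2, THEN conjunct1] by simp

lemma lac_null: "bounded_over K w \<Longrightarrow> (\<And>t. t \<in> K \<Longrightarrow> 0 \<le> w t) \<Longrightarrow> L w = 0 \<Longrightarrow> \<Lambda> w = 0"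
  by (rule \<Lambda>[unfolded linear_abs_cont_def, THEN conjunct2, THEN conjunct2, THEN conjunct1, rule_format])

lemma lac_cong: "bounded_over K v \<Longrightarrow> bounded_over K w \<Longrightarrow> (\<And>t. t \<in> K \<Longrightarrow> v t = w t) \<Longrightarrow> \<Lambda> v = \<Lambda> w"
  by (rule \<Lambda>[unfolded linear_abs_cont_def, THEN conjunct2, THEN conjunct2, THEN conjunct2, rule_format])

lemma lac_sum:
  "finite I \<Longrightarrow> (\<And>i. i \<in> I \<Longrightarrow> bounded_over K (f i)) \<Longrightarrow>
    \<Lambda> (\<lambda>t. \<Sum>i\<in>I. f i t) = (\<Sum>i\<in>I. \<Lambda> (f i))"
proof (induction I rule: finite_induct)
  case empty
  then show ?case using lac_scale[of "\<lambda>t. 0" 0] by simp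
next
  case (insert i I)
  then have "\<Lambda> (\<lambda>t. f i t + (\<Sum>i\<in>I. f i t)) = \<Lambda> (f i) + \<Lambda> (\<lambda>t. \<Sum>i\<in>I. f i t)"
    by (intro lac_add bounded_over_sum) auto
  then show ?case using insert by simp
qed

end

context
  fixes K :: "'i set" and L :: "('i \<Rightarrow> real) \<Rightarrow> real"
  assumes L: "mean_on K L"
begin

lemma linear_abs_cont_weighted:
  assumes "bounded_over K \<psi>" shows "linear_abs_cont K L (\<lambda>w. L (\<lambda>t. w t * \<psi> t))"
  unfolding linear_abs_cont_def
proof (intro conjI allI impI)
  fix v w assume "bounded_over K v" "bounded_over K w"
  then show "L (\<lambda>t. (v t + w t) * \<psi> t) = L (\<lambda>t. v t * \<psi> t) + L (\<lambda>t. w t * \<psi> t)"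
    using mean_add[OF L, of "\<lambda>t. v t * \<psi> t" "\<lambda>t. w t * \<psi> t"] assms by (simp add: distrib_right)
next
  fix w c assume "bounded_over K w"
  then show "L (\<lambda>t. c * w t * \<psi> t) = c * L (\<lambda>t. w t * \<psi> t)"
    using mean_scale[OF L, of "\<lambda>t. w t * \<psi> t" c] assms by (simp add: mult.assoc)
next
  fix w assume w: "bounded_over K w" "\<forall>t\<in>K. 0 \<le> w t" "L w = 0"
  obtain B where B: "\<forall>t\<in>K. \<bar>\<psi> t\<bar> \<le> B" using assms unfolding bounded_over_def by blast
  have "\<bar>L (\<lambda>t. w t * \<psi> t) - 0 * L w\<bar> \<le> B * L w"
    by (rule mean_weighted_bound[OF L]) (use w assms B in auto)
  then show "L (\<lambda>t. w t * \<psi> t) = 0" using w by simp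
next
  fix v w assume "bounded_over K v" "bounded_over K w" "\<forall>t\<in>K. v t = w t"
  then show "L (\<lambda>t. v t * \<psi> t) = L (\<lambda>t. w t * \<psi> t)" using assms by (intro mean_cong[OF L]) auto
qed

lemma linear_abs_cont_L: "linear_abs_cont K L L"
  using linear_abs_cont_weighted[of "\<lambda>t. 1"] by simp

text \<open>Given a stochastic matrix \<open>q\<close>, replace each density \<open>u j\<close> by the density \<open>v q j\<close> that puts mass
\<open>q (j, l)\<close> on the cell \<open>l\<close> and is proportional to \<open>u j\<close> inside every cell; for \<open>q = p\<close> this changes nothing.
Cells with \<open>p (j, l) = 0\<close> drop out by the convention for division by zero.\<close>

lemma split_by_cells:
  fixes cell :: "'i \<Rightarrow> 'l" and q :: "nat \<times> 'l \<Rightarrow> real" and u :: "nat \<Rightarrow> 'i \<Rightarrow> real"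
  assumes M: "finite M" and cell': "\<forall>t\<in>K. cell t \<in> M"
    and u': "\<forall>j<N. bounded_over K (u j)" "\<forall>j<N. \<forall>t\<in>K. 0 \<le> u j t"
  defines "w \<equiv> (\<lambda>(j, l) t. if cell t = l then u j t else 0)"
  defines "p \<equiv> (\<lambda>x. L (w x))"
  defines "v \<equiv> (\<lambda>q j t. \<Sum>l\<in>M. (q (j, l) / p (j, l)) * w (j, l) t)"
  shows "\<And>j l. j < N \<Longrightarrow> bounded_over K (w (j, l))"
    and "\<And>j q. j < N \<Longrightarrow> bounded_over K (v q j)"
    and "\<And>j t q. j < N \<Longrightarrow> t \<in> K \<Longrightarrow> v q j t = (q (j, cell t) / p (j, cell t)) * u j t"
    and "\<And>j l. j < N \<Longrightarrow> p (j, l) \<ge> 0"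
    and "\<And>j. j < N \<Longrightarrow> (\<Sum>l\<in>M. p (j, l)) = L (u j)"
    and "\<And>\<Lambda> j q. linear_abs_cont K L \<Lambda> \<Longrightarrow> j < N \<Longrightarrow> \<Lambda> (v q j) = (\<Sum>l\<in>M. \<Lambda> (w (j, l)) / p (j, l) * q (j, l))"
    and "\<And>\<Lambda> j. linear_abs_cont K L \<Lambda> \<Longrightarrow> j < N \<Longrightarrow> (\<Sum>l\<in>M. \<Lambda> (w (j, l)) / p (j, l) * p (j, l)) = \<Lambda> (u j)"
proof -
  note cell = cell'[rule_format] and u = u'[rule_format]
  show wb: "bounded_over K (w (j, l))" if j: "j < N" for j l
  proof -
    obtain B where B: "\<forall>t\<in>K. \<bar>u j t\<bar> \<le> B" using u(1)[OF j] unfolding bounded_over_def by blast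
    show ?thesis
    proof (rule bounded_overI[where B=B])
      fix t assume "t \<in> K"
      then have "\<bar>u j t\<bar> \<le> B" using B by blast
      then show "\<bar>w (j, l) t\<bar> \<le> B" unfolding w_def by (cases "cell t = l") simp_all
    qed
  qed
  show vb: "bounded_over K (v q j)" if j: "j < N" for j q
    unfolding v_def using wb[OF j] by (intro bounded_over_sum bounded_over_mult) simp_all
  have w0: "0 \<le> w (j, l) t" if "j < N" "t \<in> K" for j l t using u(2)[OF that] by (simp add: w_def)
  show "v q j t = (q (j, cell t) / p (j, cell t)) * u j t" if "j < N" "t \<in> K" for j t q
  proof -
    have "v q j t = (\<Sum>l\<in>M. if cell t = l then (q (j, l) / p (j, l)) * u j t else 0)"
      unfolding v_def w_def by (intro sum.cong) simp_all
    then show ?thesis using cell[OF that(2)] M by simp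
  qed
  show "p (j, l) \<ge> 0" if "j < N" for j l
    unfolding p_def by (rule mean_nonneg[OF L wb[OF that]]) (rule w0[OF that])
  have uw: "(\<Sum>l\<in>M. w (j, l) t) = u j t" if "t \<in> K" for j t
    using cell[OF that] M by (simp add: w_def)
  have \<Lambda>w: "(\<Sum>l\<in>M. \<Lambda> (w (j, l))) = \<Lambda> (u j)" if \<Lambda>: "linear_abs_cont K L \<Lambda>" and j: "j < N" for \<Lambda> j
  proof -
    have "\<Lambda> (\<lambda>t. \<Sum>l\<in>M. w (j, l) t) = \<Lambda> (u j)"
      by (rule lac_cong[OF \<Lambda>]) (intro bounded_over_sum wb[OF j] u(1)[OF j] uw | assumption)+
    then show ?thesis using lac_sum[OF \<Lambda> M wb[OF j]] by simp
  qed
  show "(\<Sum>l\<in>M. p (j, l)) = L (u j)" if "j < N" for j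
    using \<Lambda>w[OF linear_abs_cont_L that] by (simp add: p_def)
  show "\<Lambda> (v q j) = (\<Sum>l\<in>M. \<Lambda> (w (j, l)) / p (j, l) * q (j, l))"
    if \<Lambda>: "linear_abs_cont K L \<Lambda>" and j: "j < N" for \<Lambda> j q
  proof -
    have "\<Lambda> (v q j) = (\<Sum>l\<in>M. \<Lambda> (\<lambda>t. (q (j, l) / p (j, l)) * w (j, l) t))"
      unfolding v_def by (rule lac_sum[OF \<Lambda> M]) (intro bounded_over_mult bounded_over_const wb[OF j])
    also have "\<dots> = (\<Sum>l\<in>M. (q (j, l) / p (j, l)) * \<Lambda> (w (j, l)))"
      by (rule sum.cong[OF refl]) (rule lac_scale[OF \<Lambda> wb[OF j]])
    finally show ?thesis by (simp add: mult.commute)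
  qed
  show "(\<Sum>l\<in>M. \<Lambda> (w (j, l)) / p (j, l) * p (j, l)) = \<Lambda> (u j)"
    if \<Lambda>: "linear_abs_cont K L \<Lambda>" and j: "j < N" for \<Lambda> j
  proof -
    have "\<Lambda> (w (j, l)) / p (j, l) * p (j, l) = \<Lambda> (w (j, l))" for l
    proof (cases "p (j, l) = 0")
      case True
      have "\<Lambda> (w (j, l)) = 0"
        by (rule lac_null[OF \<Lambda> wb[OF j] w0[OF j]]) (use True in \<open>simp_all add: p_def\<close>)
      then show ?thesis by simp
    qed simp
    then show ?thesis using \<Lambda>w[OF \<Lambda> j] by simp
  qed
qed

text \<open>Cut the densities into cells on which \<open>\<phi> n\<close> varies by at most \<open>\<delta> / 3\<close> and round the matrix of cell
masses, keeping the sum of the means of \<open>\<phi> n\<close> and the sum of the values of \<open>G\<close>. An entry whose row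
is not fractional is confined to one cell, so \<open>\<phi> n\<close> stays within \<open>\<delta> / 3\<close> of its mean there. The at most
two other entries cost at most \<open>2 * R\<close> each, and \<open>N\<close> is large enough to absorb them. The sum of the
values of \<open>G\<close> stays exactly \<open>N * c\<close>, so the next function meets the same situation again.\<close>

lemma balanced_state_refine:
  assumes G: "linear_abs_cont K L G" and R: "\<And>t. t \<in> K \<Longrightarrow> \<bar>\<phi> n t\<bar> \<le> R"
    and \<delta>: "\<delta> > 0" and N: "12 * R \<le> real N * \<delta>"
    and u: "balanced_state K L G \<phi> N c \<delta> a u"
    and close: "\<And>j. j < N \<Longrightarrow> \<bar>L (\<lambda>t. u j t * \<phi> n t) - G (u j)\<bar> \<le> \<delta> / 3"
  shows "\<exists>T. finite T \<and> (\<forall>v\<in>T. balanced_state K L G \<phi> N c \<delta> (insert n a) v) \<and>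
    (\<forall>\<psi>. bounded_over K \<psi> \<longrightarrow>
      (\<exists>v\<in>T. (\<Sum>j<N. L (\<lambda>t. v j t * \<psi> t)) \<le> (\<Sum>j<N. L (\<lambda>t. u j t * \<psi> t))))"
proof -
  (* one third each for the width of the cells, for the distance of the means from G,
     and for the rows that remain fractional *)
  define d where "d = \<delta> / 3"
  have d: "d > 0" using \<delta> by (simp add: d_def)
  define cell where "cell t = \<lfloor>\<phi> n t / d\<rfloor>" for t
  define M where "M = {\<lfloor>- R / d\<rfloor>..\<lfloor>R / d\<rfloor>}"
  have finM: "finite M" by (simp add: M_def)
  have cellM: "cell t \<in> M" if "t \<in> K" for t
  proof -
    have "- R / d \<le> \<phi> n t / d" "\<phi> n t / d \<le> R / d"
      using R[OF that] d by (intro divide_right_mono; simp)+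
    then show ?thesis unfolding cell_def M_def by (simp add: floor_mono)
  qed
  have cell_diff: "\<bar>\<phi> n t - \<phi> n s\<bar> \<le> d" if "cell t = cell s" for s t
  proof -
    have "\<bar>\<phi> n t / d - \<phi> n s / d\<bar> \<le> 1" using that unfolding cell_def by linarith
    then have "\<bar>\<phi> n t - \<phi> n s\<bar> / d \<le> 1" using d by (simp add: diff_divide_distrib[symmetric])
    then show ?thesis using d by (simp add: divide_le_eq)
  qed
  have ub: "bounded_over K (u j)" and u0: "\<And>t. t \<in> K \<Longrightarrow> 0 \<le> u j t" and u1: "L (u j) = 1" if "j < N" for j
    using u that unfolding balanced_state_def by blast+
  have uG: "(\<Sum>j<N. G (u j)) = real N * c" using u unfolding balanced_state_def by blast
  have ua: "\<bar>(\<Sum>j<N. \<phi> m (t j)) - real N * c\<bar> \<le> real N * \<delta>"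
    if "\<And>j. j < N \<Longrightarrow> t j \<in> K \<and> u j (t j) > 0" "m \<in> a" for t m
    using u that unfolding balanced_state_def by blast
  have \<phi>b: "bounded_over K (\<phi> n)" using R by (rule bounded_overI)
  define w where "w = (\<lambda>(j, l) t. if cell t = l then u j t else 0)"
  define p where "p x = L (w x)" for x
  define v where "v q j t = (\<Sum>l\<in>M. (q (j, l) / p (j, l)) * w (j, l) t)" for q j t
  have "\<forall>t\<in>K. cell t \<in> M" "\<forall>j<N. bounded_over K (u j)" "\<forall>j<N. \<forall>t\<in>K. 0 \<le> u j t"
    using cellM ub u0 by blast+
  note sp = split_by_cells[OF finM this, folded w_def, folded p_def, folded v_def]
  let ?J = "{..<N}"
  have p: "stochastic ?J M p" unfolding stochastic_def
  proof (intro conjI ballI)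
    fix x assume "x \<in> ?J \<times> M"
    then show "p x \<ge> 0" using sp(4) by auto
  next
    fix j assume "j \<in> ?J"
    then show "(\<Sum>l\<in>M. p (j, l)) = 1" using sp(5)[of j] u1[of j] by simp
  qed
  define coeff where "coeff \<Lambda> x = \<Lambda> (w x) / p x" for \<Lambda> :: "('i \<Rightarrow> real) \<Rightarrow> real" and x
  define Lw where "Lw \<psi> f = L (\<lambda>t. f t * \<psi> t)" for \<psi> f
  have lacL: "linear_abs_cont K L (Lw \<psi>)" if "bounded_over K \<psi>" for \<psi>
    using linear_abs_cont_weighted[OF that] unfolding Lw_def[abs_def] .
  have coeff_v: "(\<Sum>x\<in>?J \<times> M. coeff \<Lambda> x * q x) = (\<Sum>j<N. \<Lambda> (v q j))" if "linear_abs_cont K L \<Lambda>" for \<Lambda> q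
    unfolding sum.cartesian_product' coeff_def
    by (rule sum.cong[OF refl]) (simp only: lessThan_iff sp(6)[OF that])
  have coeff_p: "(\<Sum>x\<in>?J \<times> M. coeff \<Lambda> x * p x) = (\<Sum>j<N. \<Lambda> (u j))" if "linear_abs_cont K L \<Lambda>" for \<Lambda>
    unfolding sum.cartesian_product' coeff_def
    by (rule sum.cong[OF refl]) (simp only: lessThan_iff sp(7)[OF that])
  obtain Q where Qfin: "finite Q"
    and Qq: "\<forall>q\<in>Q. stochastic ?J M q \<and> (\<forall>x\<in>?J \<times> M. p x = 0 \<longrightarrow> q x = 0) \<and>
      (\<Sum>x\<in>?J \<times> M. coeff (Lw (\<phi> n)) x * q x) = (\<Sum>x\<in>?J \<times> M. coeff (Lw (\<phi> n)) x * p x) \<and>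
      (\<Sum>x\<in>?J \<times> M. coeff G x * q x) = (\<Sum>x\<in>?J \<times> M. coeff G x * p x) \<and>
      card (fractional_rows ?J M q) \<le> 2"
    and Qh: "\<forall>h. \<exists>q\<in>Q. (\<Sum>x\<in>?J \<times> M. h x * q x) \<le> (\<Sum>x\<in>?J \<times> M. h x * p x)"
    using rounding[OF finite_lessThan finM p, of "coeff (Lw (\<phi> n))" "coeff G"] by (elim exE conjE)
  have "balanced_state K L G \<phi> N c \<delta> (insert n a) (v q)" if q: "q \<in> Q" for q
  proof -
    note Qb = bspec[OF Qq q]
    have qst: "stochastic ?J M q" using Qb by (rule conjunct1)
    have qsupp: "q (j, l) = 0" if "j < N" "l \<in> M" "p (j, l) = 0" for j l
      using Qb[THEN conjunct2, THEN conjunct1] that by simp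
    have q\<phi>: "(\<Sum>j<N. Lw (\<phi> n) (v q j)) = (\<Sum>j<N. Lw (\<phi> n) (u j))"
      using Qb[THEN conjunct2, THEN conjunct2, THEN conjunct1]
      unfolding coeff_p[OF lacL[OF \<phi>b]] coeff_v[OF lacL[OF \<phi>b], of q] .
    have qG: "(\<Sum>j<N. G (v q j)) = real N * c"
      using Qb[THEN conjunct2, THEN conjunct2, THEN conjunct2, THEN conjunct1]
      unfolding coeff_p[OF G] coeff_v[OF G, of q] uG .
    have frac: "card (fractional_rows ?J M q) \<le> 2"
      using Qb[THEN conjunct2, THEN conjunct2, THEN conjunct2, THEN conjunct2] .
    have q0: "q (j, l) \<ge> 0" if "j < N" "l \<in> M" for j l using qst that by (auto simp: stochastic_def)
    have qsum: "(\<Sum>l\<in>M. q (j, l)) = 1" if "j < N" for j using qst that by (auto simp: stochastic_def)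
    have vb: "bounded_over K (v q j)" if "j < N" for j using sp(2)[OF that] .
    have v0: "v q j t \<ge> 0" if "j < N" "t \<in> K" for j t
      unfolding sp(3)[OF that] using q0[OF that(1) cellM[OF that(2)]] sp(4)[OF that(1)] u0[OF that]
      by (intro mult_nonneg_nonneg divide_nonneg_nonneg)
    have v1: "L (v q j) = 1" if j: "j < N" for j
    proof -
      have "L (v q j) = (\<Sum>l\<in>M. L (w (j, l)) / p (j, l) * q (j, l))" by (rule sp(6)[OF linear_abs_cont_L j])
      also have "\<dots> = (\<Sum>l\<in>M. q (j, l))"
      proof (rule sum.cong[OF refl])
        fix l assume "l \<in> M"
        then show "L (w (j, l)) / p (j, l) * q (j, l) = q (j, l)"
          using qsupp[OF j, of l] by (cases "p (j, l) = 0") (simp_all add: p_def)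
      qed
      finally show ?thesis using qsum[OF j] by simp
    qed
    have vpos: "u j t > 0 \<and> q (j, cell t) \<noteq> 0" if "j < N" "t \<in> K" "v q j t \<noteq> 0" for j t
      using that(3) u0[OF that(1,2)] unfolding sp(3)[OF that(1,2)] by auto
    have row: "\<bar>\<phi> n t - Lw (\<phi> n) (v q j)\<bar> \<le> (if j \<in> fractional_rows ?J M q then 2 * R else d)"
      if j: "j < N" and t: "t \<in> K" "v q j t > 0" for j t
    proof (cases "j \<in> fractional_rows ?J M q")
      case True
      have "\<bar>L (\<lambda>s. v q j s * \<phi> n s) - \<phi> n t * L (v q j)\<bar> \<le> (2 * R) * L (v q j)"
      proof (rule mean_weighted_bound[OF L vb[OF j] _ \<phi>b])
        show "0 \<le> v q j s" if "s \<in> K" for s using v0[OF j that] .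
        fix s assume "s \<in> K"
        then show "\<bar>\<phi> n s - \<phi> n t\<bar> \<le> 2 * R" using R[of s] R[OF t(1)] by linarith
      qed
      then show ?thesis using True v1[OF j] by (simp add: Lw_def abs_minus_commute)
    next
      case False
      have ct: "q (j, cell t) \<noteq> 0" using vpos[OF j t(1)] t(2) by simp
      have "q (j, l) = 0" if l: "l \<in> M" "l \<noteq> cell t" for l
      proof -
        have "q (j, cell t) + q (j, l) = (\<Sum>l\<in>{cell t, l}. q (j, l))" using l by simp
        also have "\<dots> \<le> (\<Sum>l\<in>M. q (j, l))"
          using l cellM[OF t(1)] finM q0[OF j] by (intro sum_mono2) auto
        finally have le: "q (j, cell t) + q (j, l) \<le> 1" using qsum[OF j] by simp
        have "\<not> (0 < q (j, cell t) \<and> q (j, cell t) < 1)"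
          using False j cellM[OF t(1)] unfolding fractional_rows_def by blast
        then have "q (j, cell t) \<ge> 1" using ct q0[OF j cellM[OF t(1)]] by linarith
        then show ?thesis using le q0[OF j l(1)] by linarith
      qed
      then have same: "cell s = cell t" if "s \<in> K" "v q j s \<noteq> 0" for s
        using vpos[OF j that] cellM[OF that(1)] by blast
      have "\<bar>L (\<lambda>s. v q j s * \<phi> n s) - \<phi> n t * L (v q j)\<bar> \<le> d * L (v q j)"
      proof (rule mean_weighted_bound[OF L vb[OF j] _ \<phi>b])
        show "0 \<le> v q j s" if "s \<in> K" for s using v0[OF j that] .
        show "\<bar>\<phi> n s - \<phi> n t\<bar> \<le> d" if "s \<in> K" "v q j s \<noteq> 0" for s
          by (rule cell_diff[OF same[OF that]])
      qed
      then show ?thesis using False v1[OF j] by (simp add: Lw_def abs_minus_commute)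
    qed
    have new: "\<bar>(\<Sum>j<N. \<phi> n (t j)) - real N * c\<bar> \<le> real N * \<delta>"
      if t: "\<And>j. j < N \<Longrightarrow> t j \<in> K \<and> v q j (t j) > 0" for t
    proof -
      have "\<bar>(\<Sum>j<N. \<phi> n (t j)) - (\<Sum>j<N. Lw (\<phi> n) (v q j))\<bar>
          \<le> (\<Sum>j<N. \<bar>\<phi> n (t j) - Lw (\<phi> n) (v q j)\<bar>)"
        unfolding sum_subtractf[symmetric] by (rule sum_abs)
      also have "\<dots> \<le> (\<Sum>j<N. d + (if j \<in> fractional_rows ?J M q then 2 * R else 0))"
      proof (rule sum_mono)
        fix j assume "j \<in> {..<N}"
        then show "\<bar>\<phi> n (t j) - Lw (\<phi> n) (v q j)\<bar> \<le> d + (if j \<in> fractional_rows ?J M q then 2 * R else 0)"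
          using row[of j "t j"] t[of j] d by (auto split: if_splits)
      qed
      also have "\<dots> = real N * d + real (card (fractional_rows ?J M q)) * (2 * R)"
      proof -
        have "{..<N} \<inter> fractional_rows ?J M q = fractional_rows ?J M q" by (auto simp: fractional_rows_def)
        then show ?thesis by (simp add: sum.distrib sum.If_cases)
      qed
      finally have 1: "\<bar>(\<Sum>j<N. \<phi> n (t j)) - (\<Sum>j<N. Lw (\<phi> n) (v q j))\<bar>
          \<le> real N * d + real (card (fractional_rows ?J M q)) * (2 * R)" .
      have "\<bar>(\<Sum>j<N. Lw (\<phi> n) (u j)) - real N * c\<bar> = \<bar>\<Sum>j<N. Lw (\<phi> n) (u j) - G (u j)\<bar>"
        using uG by (simp add: sum_subtractf)
      also have "\<dots> \<le> (\<Sum>j<N. \<bar>Lw (\<phi> n) (u j) - G (u j)\<bar>)" by (rule sum_abs)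
      also have "\<dots> \<le> (\<Sum>j<N. d)" using close by (intro sum_mono) (simp add: Lw_def d_def)
      finally have 2: "\<bar>(\<Sum>j<N. Lw (\<phi> n) (u j)) - real N * c\<bar> \<le> real N * d" by simp
      have R0: "0 \<le> R" if "N \<noteq> 0" using R[of "t 0"] t[of 0] that by fastforce
      have 3: "real (card (fractional_rows ?J M q)) * (2 * R) \<le> real N * d"
      proof (cases "N = 0")
        case False
        have "real (card (fractional_rows ?J M q)) * (2 * R) \<le> 2 * (2 * R)"
          using frac R0[OF False] by (intro mult_right_mono) auto
        also have "\<dots> \<le> real N * d" using N by (simp add: d_def)
        finally show ?thesis .
      qed (simp add: fractional_rows_def)
      have "real N * \<delta> = real N * d + real N * d + real N * d" by (simp add: d_def)
      with 1 2 3 q\<phi> show ?thesis by linarith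
    qed
    show ?thesis unfolding balanced_state_def
    proof (intro conjI allI impI ballI)
      fix t m assume t: "\<forall>j<N. t j \<in> K \<and> 0 < v q j (t j)" and m: "m \<in> insert n a"
      show "\<bar>(\<Sum>j<N. \<phi> m (t j)) - real N * c\<bar> \<le> real N * \<delta>"
      proof (cases "m = n")
        case True
        then show ?thesis using new t by blast
      next
        case False
        show ?thesis
        proof (rule ua)
          show "m \<in> a" using m False by blast
          show "t j \<in> K \<and> u j (t j) > 0" if "j < N" for j
            using t that vpos[OF that, of "t j"] by fastforce
        qed
      qed
    qed (use vb v0 v1 qG in blast)+
  qed
  moreover have "\<exists>f\<in>v ` Q. (\<Sum>j<N. L (\<lambda>t. f j t * \<psi> t)) \<le> (\<Sum>j<N. L (\<lambda>t. u j t * \<psi> t))"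
    if \<psi>: "bounded_over K \<psi>" for \<psi>
  proof -
    obtain q where "q \<in> Q" "(\<Sum>x\<in>?J \<times> M. coeff (Lw \<psi>) x * q x) \<le> (\<Sum>x\<in>?J \<times> M. coeff (Lw \<psi>) x * p x)"
      using Qh by blast
    then show ?thesis unfolding coeff_p[OF lacL[OF \<psi>]] coeff_v[OF lacL[OF \<psi>], of q] Lw_def by blast
  qed
  ultimately show ?thesis using Qfin by (intro exI[of _ "v ` Q"]) blast
qed

end

section \<open>Thinning a sequence of bounded functions\<close>

text \<open>Otherwise \<open>\<psi>\<close> would exceed its mean with respect to the density by \<open>\<kappa>\<close> wherever the density is positive.\<close>

lemma choose_below_mean:
  assumes L: "mean_on K L" and u: "bounded_over K u" "\<forall>t\<in>K. 0 \<le> u t" "L u = 1"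
    and \<psi>: "bounded_over K \<psi>" and \<kappa>: "\<kappa> > 0"
  shows "\<exists>t\<in>K. u t > 0 \<and> \<psi> t \<le> L (\<lambda>t. u t * \<psi> t) + \<kappa>"
proof (rule ccontr)
  define b where "b = L (\<lambda>t. u t * \<psi> t)"
  assume "\<not> ?thesis"
  then have *: "\<psi> t > b + \<kappa>" if "t \<in> K" "u t > 0" for t using that unfolding b_def by force
  have "(b + \<kappa>) * u t \<le> u t * \<psi> t" if "t \<in> K" for t
  proof (cases "u t > 0")
    case True
    then show ?thesis using *[OF that] by (simp add: mult.commute)
  next
    case False
    then have "u t = 0" using u(2) that by force
    then show ?thesis by simp
  qed
  then have "L (\<lambda>t. (b + \<kappa>) * u t) \<le> L (\<lambda>t. u t * \<psi> t)"
    by (intro mean_mono[OF L]) (use u \<psi> in simp_all)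
  then show False using mean_scale[OF L u(1), of "b + \<kappa>"] u(3) \<kappa> by (simp add: b_def)
qed

text \<open>The dual form of saying that \<open>L\<close> is a convex combination of the averaged densities of the states in \<open>T\<close>.
The form with \<open>\<psi>\<close> is the one that is used in the end, and it needs no coefficients.\<close>

definition balanced_decomposition ::
    "'i set \<Rightarrow> (('i \<Rightarrow> real) \<Rightarrow> real) \<Rightarrow> (('i \<Rightarrow> real) \<Rightarrow> real) \<Rightarrow> (nat \<Rightarrow> 'i \<Rightarrow> real)
      \<Rightarrow> nat \<Rightarrow> real \<Rightarrow> real \<Rightarrow> nat set \<Rightarrow> (nat \<Rightarrow> 'i \<Rightarrow> real) set \<Rightarrow> bool"
  where "balanced_decomposition K L G \<phi> N c \<delta> a T \<longleftrightarrow>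
    finite T \<and> (\<forall>u\<in>T. balanced_state K L G \<phi> N c \<delta> a u) \<and>
    (\<forall>\<psi>. bounded_over K \<psi> \<longrightarrow> (\<exists>u\<in>T. (\<Sum>j<N. L (\<lambda>t. u j t * \<psi> t)) \<le> real N * L \<psi>))"

lemma balanced_decomposition_start:
  assumes "mean_on K L" "c = G (\<lambda>t. 1)"
  shows "balanced_decomposition K L G \<phi> N c \<delta> {} {\<lambda>j t. 1}"
  using assms mean_const[OF assms(1), of 1]
  by (simp add: balanced_decomposition_def balanced_state_def)

lemma balanced_decomposition_refine:
  assumes L: "mean_on K L" and G: "linear_abs_cont K L G"
    and R: "\<And>t. t \<in> K \<Longrightarrow> \<bar>\<phi> n t\<bar> \<le> R"
    and \<delta>: "\<delta> > 0" and N: "12 * R \<le> real N * \<delta>"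
    and T: "balanced_decomposition K L G \<phi> N c \<delta> a T"
    and close: "\<And>u j. u \<in> T \<Longrightarrow> j < N \<Longrightarrow> \<bar>L (\<lambda>t. u j t * \<phi> n t) - G (u j)\<bar> \<le> \<delta> / 3"
  shows "\<exists>T'. balanced_decomposition K L G \<phi> N c \<delta> (insert n a) T'"
proof -
  have fin: "finite T" and bal: "\<And>u. u \<in> T \<Longrightarrow> balanced_state K L G \<phi> N c \<delta> a u"
    and dom: "\<And>\<psi>. bounded_over K \<psi> \<Longrightarrow> \<exists>u\<in>T. (\<Sum>j<N. L (\<lambda>t. u j t * \<psi> t)) \<le> real N * L \<psi>"
    using T unfolding balanced_decomposition_def by blast+
  have "\<forall>u\<in>T. \<exists>S. finite S \<and> (\<forall>v\<in>S. balanced_state K L G \<phi> N c \<delta> (insert n a) v) \<and>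
    (\<forall>\<psi>. bounded_over K \<psi> \<longrightarrow>
      (\<exists>v\<in>S. (\<Sum>j<N. L (\<lambda>t. v j t * \<psi> t)) \<le> (\<Sum>j<N. L (\<lambda>t. u j t * \<psi> t))))"
  proof
    fix u assume u: "u \<in> T"
    show "\<exists>S. finite S \<and> (\<forall>v\<in>S. balanced_state K L G \<phi> N c \<delta> (insert n a) v) \<and>
      (\<forall>\<psi>. bounded_over K \<psi> \<longrightarrow>
        (\<exists>v\<in>S. (\<Sum>j<N. L (\<lambda>t. v j t * \<psi> t)) \<le> (\<Sum>j<N. L (\<lambda>t. u j t * \<psi> t))))"
      by (rule balanced_state_refine[OF L G R \<delta> N bal[OF u] close[OF u]])
  qed
  from bchoice[OF this] obtain S where S: "\<forall>u\<in>T. finite (S u) \<and>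
    (\<forall>v\<in>S u. balanced_state K L G \<phi> N c \<delta> (insert n a) v) \<and>
    (\<forall>\<psi>. bounded_over K \<psi> \<longrightarrow>
      (\<exists>v\<in>S u. (\<Sum>j<N. L (\<lambda>t. v j t * \<psi> t)) \<le> (\<Sum>j<N. L (\<lambda>t. u j t * \<psi> t))))" ..
  have "balanced_decomposition K L G \<phi> N c \<delta> (insert n a) (\<Union>u\<in>T. S u)"
    unfolding balanced_decomposition_def
  proof (intro conjI allI impI)
    show "finite (\<Union>u\<in>T. S u)" using fin S by simp
    show "\<forall>u\<in>\<Union>u\<in>T. S u. balanced_state K L G \<phi> N c \<delta> (insert n a) u" using S by simp
    fix \<psi> assume \<psi>: "bounded_over K \<psi>"
    obtain u where u: "u \<in> T" "(\<Sum>j<N. L (\<lambda>t. u j t * \<psi> t)) \<le> real N * L \<psi>" using dom[OF \<psi>] by blast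
    then obtain v where "v \<in> S u" "(\<Sum>j<N. L (\<lambda>t. v j t * \<psi> t)) \<le> (\<Sum>j<N. L (\<lambda>t. u j t * \<psi> t))"
      using S \<psi> by blast
    then show "\<exists>v\<in>\<Union>u\<in>T. S u. (\<Sum>j<N. L (\<lambda>t. v j t * \<psi> t)) \<le> real N * L \<psi>"
      using u by (intro bexI[of _ v]) auto
  qed
  then show ?thesis by blast
qed

lemma balanced_decomposition_points:
  assumes L: "mean_on K L" and T: "balanced_decomposition K L G \<phi> N c \<delta> a T"
    and \<psi>: "bounded_over K \<psi>" and \<kappa>: "\<kappa> > 0"
  shows "\<exists>t. (\<forall>j<N. t j \<in> K) \<and> (\<Sum>j<N. \<psi> (t j)) \<le> real N * (L \<psi> + \<kappa>) \<and>
    (\<forall>n\<in>a. \<bar>(\<Sum>j<N. \<phi> n (t j)) - real N * c\<bar> \<le> real N * \<delta>)"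
proof -
  obtain u where uT: "u \<in> T" and le: "(\<Sum>j<N. L (\<lambda>t. u j t * \<psi> t)) \<le> real N * L \<psi>"
    using T \<psi> unfolding balanced_decomposition_def by blast
  have u: "\<And>j. j < N \<Longrightarrow> bounded_over K (u j) \<and> (\<forall>t\<in>K. 0 \<le> u j t) \<and> L (u j) = 1"
    and con: "\<And>t. (\<forall>j<N. t j \<in> K \<and> u j (t j) > 0) \<Longrightarrow>
      (\<forall>n\<in>a. \<bar>(\<Sum>j<N. \<phi> n (t j)) - real N * c\<bar> \<le> real N * \<delta>)"
    using T uT unfolding balanced_decomposition_def balanced_state_def by blast+
  have "\<forall>j. \<exists>t. j < N \<longrightarrow> t \<in> K \<and> u j t > 0 \<and> \<psi> t \<le> L (\<lambda>t. u j t * \<psi> t) + \<kappa>"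
    using choose_below_mean[OF L _ _ _ \<psi> \<kappa>] u by blast
  from choice[OF this] obtain t where
    t: "\<And>j. j < N \<Longrightarrow> t j \<in> K \<and> u j (t j) > 0 \<and> \<psi> (t j) \<le> L (\<lambda>t. u j t * \<psi> t) + \<kappa>" by blast
  have "(\<Sum>j<N. \<psi> (t j)) \<le> (\<Sum>j<N. L (\<lambda>t. u j t * \<psi> t) + \<kappa>)" using t by (intro sum_mono) simp
  also have "\<dots> \<le> real N * (L \<psi> + \<kappa>)" using le by (simp add: sum.distrib algebra_simps)
  finally show ?thesis using t con by (intro exI[of _ t] conjI) auto
qed

text \<open>Let \<open>G i\<close> be a cluster point, as \<open>n\<close> grows, of the functionals that send a density \<open>w\<close> to the mean of
\<open>w * \<phi> n\<close> under \<open>L i\<close>. Then arbitrarily late \<open>n\<close> bring these functionals close to \<open>G i\<close> on any finite set of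
densities, which is what refining finitely many states requires. The mean \<open>L i\<close> is taken into account
only from stage \<open>i\<close> on, so that each stage deals with finitely many states.\<close>

theorem simultaneous_thinning:
  fixes K :: "'i set" and \<phi> :: "nat \<Rightarrow> 'i \<Rightarrow> real" and L :: "nat \<Rightarrow> ('i \<Rightarrow> real) \<Rightarrow> real"
  assumes L: "\<And>i. mean_on K (L i)" and R: "\<And>n t. t \<in> K \<Longrightarrow> \<bar>\<phi> n t\<bar> \<le> R"
    and \<delta>: "\<delta> > 0" and N: "12 * R \<le> real N * \<delta>"
  obtains s c where "strict_mono s"
    "\<And>i k \<eta>. \<eta> > 0 \<Longrightarrow> \<exists>n\<ge>k. \<bar>L i (\<phi> n) - c i\<bar> < \<eta>"
    "\<And>i k \<psi> \<kappa>. bounded_over K \<psi> \<Longrightarrow> \<kappa> > 0 \<Longrightarrow>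
      \<exists>t. (\<forall>j<N. t j \<in> K) \<and> (\<Sum>j<N. \<psi> (t j)) \<le> real N * (L i \<psi> + \<kappa>) \<and>
        (\<forall>m\<in>{i..<k}. \<bar>(\<Sum>j<N. \<phi> (s m) (t j)) - real N * c i\<bar> \<le> real N * \<delta>)"
proof -
  have \<phi>b: "bounded_over K (\<phi> n)" for n using R by (rule bounded_overI)
  define u where "u n = (\<lambda>(i, w). if bounded_over K w then L i (\<lambda>t. w t * \<phi> n t) else 0)" for n
  have "\<exists>B. \<forall>n. \<bar>u n x\<bar> \<le> B" for x
  proof -
    obtain i w where x: "x = (i, w)" by (cases x)
    show ?thesis
    proof (cases "bounded_over K w")
      case True
      then obtain B where B: "\<forall>t\<in>K. \<bar>w t\<bar> \<le> B" unfolding bounded_over_def by blast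
      have "\<bar>L i (\<lambda>t. w t * \<phi> n t)\<bar> \<le> B * R" for n
      proof -
        have *: "\<bar>w t * \<phi> n t\<bar> \<le> B * R" if "t \<in> K" for t
        proof -
          have "\<bar>w t\<bar> \<le> B" "\<bar>\<phi> n t\<bar> \<le> R" using B R[OF that] that by blast+
          then show ?thesis unfolding abs_mult by (intro mult_mono) auto
        qed
        have "L i (\<lambda>t. w t * \<phi> n t) \<le> L i (\<lambda>t. B * R)"
          by (rule mean_mono[OF L]) (use True \<phi>b * in \<open>simp_all add: abs_le_iff\<close>)
        moreover have "L i (\<lambda>t. - (B * R)) \<le> L i (\<lambda>t. w t * \<phi> n t)"
          by (rule mean_mono[OF L]) (use True \<phi>b * in \<open>simp_all add: abs_le_iff minus_le_iff\<close>)
        ultimately show ?thesis unfolding mean_const[OF L] by (simp add: abs_le_iff)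
      qed
      then show ?thesis using True by (auto simp: u_def x)
    next
      case False
      then show ?thesis by (auto simp: u_def x)
    qed
  qed
  then obtain g where g: "\<And>k. g \<in> closure (u ` {k..})" using cluster_point[of u] by blast
  define G where "G i w = g (i, w)" for i w
  have cont: "continuous_on UNIV (\<lambda>g :: nat \<times> ('i \<Rightarrow> real) \<Rightarrow> real. g i)" for i
    by (rule continuous_on_product_coordinates)
  have G: "linear_abs_cont K (L i) (G i)" for i
    unfolding linear_abs_cont_def
  proof (intro conjI allI impI)
    fix v w assume b: "bounded_over K v" "bounded_over K w"
    have "closed {g :: nat \<times> ('i \<Rightarrow> real) \<Rightarrow> real. g (i, \<lambda>t. v t + w t) = g (i, v) + g (i, w)}"
      by (rule closed_Collect_eq[OF cont continuous_on_add[OF cont cont]])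
    from cluster_point_closed[OF g this, of 0] show "G i (\<lambda>t. v t + w t) = G i v + G i w"
      using mean_add[OF L, of "\<lambda>t. v t * \<phi> n t" "\<lambda>t. w t * \<phi> n t" for n] b \<phi>b
      by (simp add: u_def G_def distrib_right)
  next
    fix w c assume b: "bounded_over K w"
    have "closed {g :: nat \<times> ('i \<Rightarrow> real) \<Rightarrow> real. g (i, \<lambda>t. c * w t) = c * g (i, w)}"
      by (rule closed_Collect_eq[OF cont continuous_on_mult[OF continuous_on_const cont]])
    from cluster_point_closed[OF g this, of 0] show "G i (\<lambda>t. c * w t) = c * G i w"
      using mean_scale[OF L, of "\<lambda>t. w t * \<phi> n t" for n] b \<phi>b
      by (simp add: u_def G_def mult.assoc)
  next
    fix w assume w: "bounded_over K w" "\<forall>t\<in>K. 0 \<le> w t" "L i w = 0"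
    have "L i (\<lambda>t. w t * \<phi> n t) = 0" for n
      by (rule lac_null[OF linear_abs_cont_weighted[OF L \<phi>b] w(1)]) (use w in auto)
    moreover have "closed {g :: nat \<times> ('i \<Rightarrow> real) \<Rightarrow> real. g (i, w) = 0}"
      by (rule closed_Collect_eq[OF cont continuous_on_const])
    ultimately show "G i w = 0" using cluster_point_closed[OF g, of "{g. g (i, w) = 0}" 0] w(1)
      by (simp add: u_def G_def)
  next
    fix v w assume b: "bounded_over K v" "bounded_over K w" and eq: "\<forall>t\<in>K. v t = w t"
    have "L i (\<lambda>t. v t * \<phi> n t) = L i (\<lambda>t. w t * \<phi> n t)" for n
      by (rule mean_cong[OF L]) (use b \<phi>b eq in simp_all)
    moreover have "closed {g :: nat \<times> ('i \<Rightarrow> real) \<Rightarrow> real. g (i, v) = g (i, w)}"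
      by (rule closed_Collect_eq[OF cont cont])
    ultimately show "G i v = G i w" using cluster_point_closed[OF g, of "{g. g (i, v) = g (i, w)}" 0] b
      by (simp add: u_def G_def)
  qed
  define c where "c i = G i (\<lambda>t. 1)" for i
  define Dec where "Dec i a \<longleftrightarrow> (\<exists>T. balanced_decomposition K (L i) (G i) \<phi> N (c i) \<delta> a T)" for i a
  have Dec_empty: "Dec i {}" for i
    unfolding Dec_def by (rule exI, rule balanced_decomposition_start[OF L]) (simp add: c_def)
  have "\<exists>s. \<forall>k. (\<forall>m<k. s m < s k) \<and> (\<forall>i\<le>k. Dec i (s ` {i..<k}) \<longrightarrow> Dec i (insert (s k) (s ` {i..<k})))"
  proof (rule dependent_wellorder_choice)
    fix r k and f f' :: "nat \<Rightarrow> nat"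
    assume "\<And>m. m < k \<Longrightarrow> f m = f' m"
    then have "\<forall>m<k. f m = f' m" "\<And>i. f ` {i..<k} = f' ` {i..<k}" by (auto intro!: image_cong)
    then show "((\<forall>m<k. f m < r) \<and> (\<forall>i\<le>k. Dec i (f ` {i..<k}) \<longrightarrow> Dec i (insert r (f ` {i..<k})))) =
      ((\<forall>m<k. f' m < r) \<and> (\<forall>i\<le>k. Dec i (f' ` {i..<k}) \<longrightarrow> Dec i (insert r (f' ` {i..<k}))))"
      by simp
  next
    fix k and f :: "nat \<Rightarrow> nat"
    have "\<forall>i. \<exists>T. Dec i (f ` {i..<k}) \<longrightarrow> balanced_decomposition K (L i) (G i) \<phi> N (c i) \<delta> (f ` {i..<k}) T"
      unfolding Dec_def by blast
    from choice[OF this] obtain T where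
      T: "\<And>i. Dec i (f ` {i..<k}) \<Longrightarrow> balanced_decomposition K (L i) (G i) \<phi> N (c i) \<delta> (f ` {i..<k}) (T i)"
      by blast
    define I where "I = {i. i \<le> k \<and> Dec i (f ` {i..<k})}"
    define S where "S = (\<Union>i\<in>I. \<Union>w\<in>T i. (\<lambda>j. (i, w j)) ` {..<N})"
    have "finite I" unfolding I_def by simp
    moreover have "finite (T i)" if "i \<in> I" for i
      using T[of i] that unfolding I_def balanced_decomposition_def by blast
    ultimately have finS: "finite S" unfolding S_def by blast
    obtain b where b: "\<And>m. m < k \<Longrightarrow> f m < b"
      using finite_nat_set_iff_bounded[of "f ` {..<k}"] by auto
    have "\<delta> / 3 > 0" using \<delta> by simp
    then obtain n where n: "n \<ge> b" "\<And>x. x \<in> S \<Longrightarrow> \<bar>u n x - g x\<bar> < \<delta> / 3"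
      using cluster_point_frequently[OF g finS] by metis
    have "Dec i (insert n (f ` {i..<k}))" if i: "i \<le> k" and D: "Dec i (f ` {i..<k})" for i
    proof -
      have iI: "i \<in> I" using i D by (simp add: I_def)
      have close: "\<bar>L i (\<lambda>t. w j t * \<phi> n t) - G i (w j)\<bar> \<le> \<delta> / 3" if w: "w \<in> T i" "j < N" for w j
      proof -
        have "(i, w j) \<in> S" using iI w by (auto simp: S_def)
        moreover have "bounded_over K (w j)"
          using T[OF D] w unfolding balanced_decomposition_def balanced_state_def by blast
        ultimately show ?thesis using n(2)[of "(i, w j)"] by (simp add: u_def G_def)
      qed
      show ?thesis unfolding Dec_def
        by (rule balanced_decomposition_refine[where R=R and T="T i", OF L[of i] G[of i] _ \<delta> N T[OF D]])
          (use R close in blast)+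
    qed
    moreover have "f m < n" if "m < k" for m using b[OF that] n(1) by simp
    ultimately show "\<exists>r. (\<forall>m<k. f m < r) \<and> (\<forall>i\<le>k. Dec i (f ` {i..<k}) \<longrightarrow> Dec i (insert r (f ` {i..<k})))"
      by (intro exI[of _ n]) simp
  qed
  then obtain s where s: "\<And>k m. m < k \<Longrightarrow> s m < s k"
    and step: "\<And>k i. i \<le> k \<Longrightarrow> Dec i (s ` {i..<k}) \<Longrightarrow> Dec i (insert (s k) (s ` {i..<k}))" by blast
  have Dec: "Dec i (s ` {i..<k})" for i k
  proof (induction k)
    case (Suc k)
    show ?case
    proof (cases "i \<le> k")
      case True
      then have "s ` {i..<Suc k} = insert (s k) (s ` {i..<k})" by (simp add: atLeastLessThanSuc)
      then show ?thesis using step[OF True Suc] by simp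
    qed (simp add: Dec_empty)
  qed (simp add: Dec_empty)
  show ?thesis
  proof (rule that[of s c])
    show "strict_mono s" using s by (rule strict_monoI)
    fix i k and \<eta> :: real assume \<eta>: "\<eta> > 0"
    obtain n where "n \<ge> k" "\<And>x. x \<in> {(i, \<lambda>t. 1)} \<Longrightarrow> \<bar>u n x - g x\<bar> < \<eta>"
      using cluster_point_frequently[OF g _ \<eta>, of "{(i, \<lambda>t. 1)}" k] by auto
    then show "\<exists>n\<ge>k. \<bar>L i (\<phi> n) - c i\<bar> < \<eta>" by (intro exI[of _ n]) (simp add: u_def c_def G_def)
  next
    fix i k \<psi> and \<kappa> :: real assume \<psi>: "bounded_over K \<psi>" and \<kappa>: "\<kappa> > 0"
    obtain T where "balanced_decomposition K (L i) (G i) \<phi> N (c i) \<delta> (s ` {i..<k}) T"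
      using Dec unfolding Dec_def by blast
    from balanced_decomposition_points[OF L this \<psi> \<kappa>]
    show "\<exists>t. (\<forall>j<N. t j \<in> K) \<and> (\<Sum>j<N. \<psi> (t j)) \<le> real N * (L i \<psi> + \<kappa>) \<and>
        (\<forall>m\<in>{i..<k}. \<bar>(\<Sum>j<N. \<phi> (s m) (t j)) - real N * c i\<bar> \<le> real N * \<delta>)"
      by simp
  qed
qed

section \<open>From tuples of functionals to tuples of extreme points\<close>

lemma countable_closure_under_choices:
  fixes gens :: "'a \<Rightarrow> nat \<Rightarrow> 'a set"
  assumes Y0: "countable Y0" and gens: "\<And>z m. countable (gens z m)"
  obtains Y where "countable Y" "Y0 \<subseteq> Y" "\<And>z m. z \<in> Y \<Longrightarrow> gens z m \<subseteq> Y"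
proof -
  define W where "W = rec_nat Y0 (\<lambda>_ Z. Z \<union> (\<Union>z\<in>Z. \<Union>m. gens z m))"
  have W0: "W 0 = Y0" and WS: "\<And>k. W (Suc k) = W k \<union> (\<Union>z\<in>W k. \<Union>m. gens z m)"
    by (simp_all add: W_def)
  have "countable (W k)" for k
    by (induction k) (use Y0 gens in \<open>simp_all add: W0 WS\<close>)
  then have "countable (\<Union>k. W k)" by simp
  moreover have "Y0 \<subseteq> (\<Union>k. W k)" using W0 by blast
  moreover have "gens z m \<subseteq> (\<Union>k. W k)" if z: "z \<in> (\<Union>k. W k)" for z m
  proof -
    obtain k where "z \<in> W k" using z by blast
    then have "gens z m \<subseteq> W (Suc k)" using WS by blast
    then show ?thesis by blast
  qed
  ultimately show ?thesis by (rule that)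
qed

lemma continuous_on_concave_quadratic_coordinates:
  "continuous_on UNIV (\<lambda>g :: 'j \<times> 'a \<Rightarrow> real. c + g (j, x) - (\<Sum>y\<leftarrow>ys. (g (j, y))\<^sup>2))"
proof -
  have cont: "continuous_on UNIV (\<lambda>g :: 'j \<times> 'a \<Rightarrow> real. g i)" for i
    by (rule continuous_on_product_coordinates)
  have "continuous_on UNIV (\<lambda>g :: 'j \<times> 'a \<Rightarrow> real. \<Sum>y\<leftarrow>ys. (g (j, y))\<^sup>2)"
  proof (induction ys)
    case (Cons y ys)
    have "continuous_on UNIV (\<lambda>g :: 'j \<times> 'a \<Rightarrow> real. (g (j, y))\<^sup>2 + (\<Sum>y\<leftarrow>ys. (g (j, y))\<^sup>2))"
      by (rule continuous_on_add[OF continuous_on_power[OF cont] Cons])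
    then show ?case by simp
  qed simp
  then show ?thesis
    by (intro continuous_on_diff continuous_on_add continuous_on_const cont)
qed

text \<open>The functionals in the ball that agree with \<open>t\<close> on \<open>Y\<close> form a closed set, which contains an extreme
point of the ball as soon as it is a face. It is one: if one of them is a proper convex combination of \<open>a\<close> and
\<open>b\<close>, then the concave majorants of the square of \<open>z\<close>, which involve only vectors of \<open>Y\<close> and so take the same
values as at \<open>t\<close>, leave no room for \<open>a\<close> and \<open>b\<close> to differ at \<open>z\<close>.\<close>

lemma extreme_extension:
  fixes t :: "'a::real_normed_vector \<Rightarrow>\<^sub>L real"
  assumes t: "t \<in> cball 0 1"
    and tight: "\<And>z \<eta>. z \<in> Y \<Longrightarrow> \<eta> > 0 \<Longrightarrow> \<exists>c x ys. insert x (set ys) \<subseteq> Y \<and>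
      (\<forall>e\<in>cball 0 1. (blinfun_apply e z)\<^sup>2 \<le> concave_quadratic c x ys e) \<and>
      concave_quadratic c x ys t \<le> (blinfun_apply t z)\<^sup>2 + \<eta>"
  obtains e where "e extreme_point_of cball 0 1" "\<And>z. z \<in> Y \<Longrightarrow> blinfun_apply e z = blinfun_apply t z"
proof -
  let ?K = "cball (0 :: 'a \<Rightarrow>\<^sub>L real) 1"
  define \<Phi> where "\<Phi> = {e \<in> ?K. \<forall>z\<in>Y. blinfun_apply e z = blinfun_apply t z}"
  have "\<Phi> face_of ?K"
    unfolding face_of_def
  proof (intro conjI ballI impI)
    show "\<Phi> \<subseteq> ?K" by (auto simp: \<Phi>_def)
    show "convex \<Phi>"
    proof (rule convexI)
      fix a b and r s :: real
      assume ab: "a \<in> \<Phi>" "b \<in> \<Phi>" and rs: "0 \<le> r" "0 \<le> s" "r + s = 1"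
      have "r *\<^sub>R a + s *\<^sub>R b \<in> ?K"
        using convexD[OF convex_cball, of a 0 1 b r s] ab rs by (simp add: \<Phi>_def)
      moreover have "blinfun_apply (r *\<^sub>R a + s *\<^sub>R b) z = blinfun_apply t z" if "z \<in> Y" for z
      proof -
        have "blinfun_apply (r *\<^sub>R a + s *\<^sub>R b) z = (r + s) * blinfun_apply t z"
          using ab that by (simp add: \<Phi>_def blinfun.add_left blinfun.scaleR_left distrib_right)
        then show ?thesis using rs by simp
      qed
      ultimately show "r *\<^sub>R a + s *\<^sub>R b \<in> \<Phi>" by (simp add: \<Phi>_def)
    qed
    fix a b e assume a: "a \<in> ?K" and b: "b \<in> ?K" and e: "e \<in> \<Phi>" and seg: "e \<in> open_segment a b"
    obtain r where r: "0 < r" "r < 1" "e = (1 - r) *\<^sub>R a + r *\<^sub>R b" using seg by (auto simp: in_segment)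
    have eq: "blinfun_apply a z = blinfun_apply t z \<and> blinfun_apply b z = blinfun_apply t z" if z: "z \<in> Y" for z
    proof -
      let ?a = "blinfun_apply a z" and ?b = "blinfun_apply b z"
      have ez: "blinfun_apply e z = blinfun_apply t z" using e z by (simp add: \<Phi>_def)
      have ez': "blinfun_apply e z = (1 - r) * ?a + r * ?b"
        unfolding r(3) by (simp only: blinfun.add_left blinfun.scaleR_left real_scaleR_def)
      have "r * (1 - r) * (?a - ?b)\<^sup>2 \<le> 0 + \<eta>" if \<eta>: "\<eta> > 0" for \<eta> :: real
      proof -
        obtain c x ys where v: "insert x (set ys) \<subseteq> Y"
            "\<forall>e\<in>?K. (blinfun_apply e z)\<^sup>2 \<le> concave_quadratic c x ys e"
            "concave_quadratic c x ys t \<le> (blinfun_apply t z)\<^sup>2 + \<eta>"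
          using tight[OF z \<eta>] by blast
        have same: "blinfun_apply e y = blinfun_apply t y" if "y \<in> insert x (set ys)" for y
          using e v(1) that by (auto simp: \<Phi>_def)
        have "(\<Sum>y\<leftarrow>ys. (blinfun_apply e y)\<^sup>2) = (\<Sum>y\<leftarrow>ys. (blinfun_apply t y)\<^sup>2)"
          using same by (intro arg_cong[where f=sum_list] map_cong) simp_all
        then have "concave_quadratic c x ys e = concave_quadratic c x ys t"
          using same by (simp add: concave_quadratic_def)
        moreover have "(1 - r) * concave_quadratic c x ys a + r * concave_quadratic c x ys b
            \<le> concave_quadratic c x ys e"
          unfolding r(3) using r by (intro concave_quadratic_segment) simp_all
        moreover have "(1 - r) * ?a\<^sup>2 \<le> (1 - r) * concave_quadratic c x ys a"
          "r * ?b\<^sup>2 \<le> r * concave_quadratic c x ys b"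
          using v(2) a b r by (intro mult_left_mono; simp)+
        ultimately have "(1 - r) * ?a\<^sup>2 + r * ?b\<^sup>2 \<le> (blinfun_apply e z)\<^sup>2 + \<eta>"
          using v(3) ez by simp
        moreover have "(1 - r) * ?a\<^sup>2 + r * ?b\<^sup>2 - (blinfun_apply e z)\<^sup>2 = r * (1 - r) * (?a - ?b)\<^sup>2"
          unfolding ez' by (simp add: power2_eq_square algebra_simps)
        ultimately show ?thesis by linarith
      qed
      then have "r * (1 - r) * (?a - ?b)\<^sup>2 \<le> 0" by (rule field_le_epsilon)
      then have "?a = ?b" using r by (simp add: mult_le_0_iff)
      then show ?thesis using ez ez' by (simp add: algebra_simps)
    qed
    show "a \<in> \<Phi>" "b \<in> \<Phi>" using a b eq by (simp_all add: \<Phi>_def)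
  qed
  moreover have "t \<in> \<Phi>" using t by (simp add: \<Phi>_def)
  then have "\<Phi> \<noteq> {}" by blast
  moreover have "closed (blinfun_apply ` \<Phi>)"
  proof -
    have "blinfun_apply ` \<Phi> = blinfun_apply ` ?K \<inter> (\<Inter>z\<in>Y. {g. g z = blinfun_apply t z})"
      by (auto simp: \<Phi>_def)
    moreover have "closed {g :: 'a \<Rightarrow> real. g z = blinfun_apply t z}" for z
      by (rule closed_Collect_eq[OF continuous_on_product_coordinates continuous_on_const])
    ultimately show ?thesis by (simp only:) (intro closed_Int closed_dual_ball_image closed_INT ballI)
  qed
  ultimately obtain e where "e \<in> \<Phi>" "e extreme_point_of ?K"
    by (rule weak_star_closed_face_extreme_point)
  then show ?thesis using that by (simp add: \<Phi>_def)
qed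

text \<open>Choose concave majorants of the squares of all vectors in a countable set \<open>Y\<close> that contains \<open>y\<close>, all
\<open>x m\<close>, and every vector occurring in the majorants chosen for its members. Add to \<open>- y\<close> a small multiple
of a weighted sum of the gaps between majorants and squares; by maximality its mean stays small.
Tuples on which this sum is at most its mean, up to \<open>\<kappa>\<close>, have a cluster point at which all
constraints hold, the value at \<open>y\<close> is nearly as large as that of \<open>f\<close>, and all gaps tend to \<open>0\<close>. Its
entries can then be replaced by extreme points without changing their values on \<open>Y\<close>.\<close>

theorem extreme_tuple:
  fixes x :: "nat \<Rightarrow> 'a::real_normed_vector" and L f
  assumes L: "mean_on (cball 0 1) L" and rep: "\<And>x. L (\<lambda>t. blinfun_apply t x) = blinfun_apply f x"
    and max: "\<And>y \<eta>. \<eta> > 0 \<Longrightarrow> \<exists>c x ys. (\<forall>t\<in>cball 0 1. (blinfun_apply t y)\<^sup>2 \<le> concave_quadratic c x ys t) \<and>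
        L (concave_quadratic c x ys) \<le> L (\<lambda>t. (blinfun_apply t y)\<^sup>2) + \<eta>"
    and tuples: "\<And>k \<psi> \<kappa>. bounded_over (cball 0 1) \<psi> \<Longrightarrow> \<kappa> > 0 \<Longrightarrow>
      \<exists>t. (\<forall>j<N. t j \<in> cball 0 1) \<and> (\<Sum>j<N. \<psi> (t j)) \<le> real N * (L \<psi> + \<kappa>) \<and>
        (\<forall>m\<in>{i..<k}. \<bar>(\<Sum>j<N. blinfun_apply (t j) (x m)) - C\<bar> \<le> D)"
    and \<kappa>: "\<kappa> > 0"
  shows "\<exists>e. (\<forall>j<N. e j extreme_point_of cball 0 1) \<and>
    real N * (blinfun_apply f y - \<kappa>) \<le> (\<Sum>j<N. blinfun_apply (e j) y) \<and>
    (\<forall>m\<ge>i. \<bar>(\<Sum>j<N. blinfun_apply (e j) (x m)) - C\<bar> \<le> D)"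
proof -
  let ?K = "cball (0 :: 'a \<Rightarrow>\<^sub>L real) 1"
  (* the triple v encodes a concave quadratic above the square of z with excess mean at most 4^-m *)
  define P where "P z m v \<longleftrightarrow> (\<forall>t\<in>?K. (blinfun_apply t z)\<^sup>2 \<le> concave_quadratic (fst v) (fst (snd v)) (snd (snd v)) t) \<and>
      L (concave_quadratic (fst v) (fst (snd v)) (snd (snd v))) \<le> L (\<lambda>t. (blinfun_apply t z)\<^sup>2) + (1/4)^m"
    for z m and v :: "real \<times> 'a \<times> 'a list"
  define v where "v z m = (SOME v. P z m v)" for z m
  have v: "P z m (v z m)" for z m
  proof -
    have "(1/4 :: real) ^ m > 0" by simp
    from max[OF this, of z] obtain c x ys where
      "(\<forall>t\<in>?K. (blinfun_apply t z)\<^sup>2 \<le> concave_quadratic c x ys t) \<and>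
        L (concave_quadratic c x ys) \<le> L (\<lambda>t. (blinfun_apply t z)\<^sup>2) + (1/4) ^ m" by blast
    then have "P z m (c, x, ys)" by (simp add: P_def)
    then show ?thesis unfolding v_def by (rule someI)
  qed
  define q where "q z m = concave_quadratic (fst (v z m)) (fst (snd (v z m))) (snd (snd (v z m)))" for z m
  have q: "\<forall>t\<in>?K. (blinfun_apply t z)\<^sup>2 \<le> q z m t" "L (q z m) \<le> L (\<lambda>t. (blinfun_apply t z)\<^sup>2) + (1/4)^m" for z m
    using v[of z m] unfolding P_def q_def by blast+
  define gens where "gens z m = insert (fst (snd (v z m))) (set (snd (snd (v z m))))" for z m
  have "countable (insert y (range x))" by simp
  moreover have "countable (gens z m)" for z m by (simp add: gens_def countable_finite)
  ultimately obtain Y where Y: "countable Y" "insert y (range x) \<subseteq> Y" "\<And>z m. z \<in> Y \<Longrightarrow> gens z m \<subseteq> Y"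
    using countable_closure_under_choices[of "insert y (range x)" gens] by blast
  define zf where "zf = from_nat_into Y"
  have zf: "range zf = Y" unfolding zf_def using Y by (intro range_from_nat_into) auto
  define gap where "gap a t = q (zf (fst a)) (snd a) t - (blinfun_apply t (zf (fst a)))\<^sup>2" for a :: "nat \<times> nat" and t
  have gap0: "0 \<le> gap a t" if "t \<in> ?K" for a t using q(1) that unfolding gap_def by simp
  have gapb: "bounded_over ?K (gap a)" for a unfolding gap_def[abs_def] q_def by simp
  have Lgap: "L (gap a) \<le> (1/4)^snd a" for a
    using mean_diff[OF L, of "q (zf (fst a)) (snd a)" "\<lambda>t. (blinfun_apply t (zf (fst a)))\<^sup>2"] q(2)[of "zf (fst a)" "snd a"]
    unfolding gap_def[abs_def] q_def by simp
  (* the factor 2^m forces the gaps to 0 as m grows, and 4^-m makes the weighted sum of means finite *)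
  define wt where "wt a = (1/2 :: real)^fst a * 2^snd a" for a :: "nat \<times> nat"
  have wt: "wt a > 0" for a by (simp add: wt_def)
  define S where "S M t = (\<Sum>a\<in>{..<M}\<times>{..<M}. wt a * gap a t)" for M t
  have Sb: "bounded_over ?K (S M)" for M
    unfolding S_def[abs_def] by (intro bounded_over_sum bounded_over_mult bounded_over_const gapb)
  have S_mono: "S M t \<le> S M' t" if "M \<le> M'" "t \<in> ?K" for M M' t
    unfolding S_def by (rule sum_mono2) (use that gap0 less_imp_le[OF wt] in auto)
  have S_term: "wt a * gap a t \<le> S M t" if "fst a < M" "snd a < M" "t \<in> ?K" for a t M
  proof -
    have "a \<in> {..<M} \<times> {..<M}" using that by (cases a) simp
    then show ?thesis unfolding S_def
      by (intro member_le_sum) (use that gap0 less_imp_le[OF wt] in auto)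
  qed
  have LS: "L (S M) \<le> 4" for M
  proof -
    have geo: "(\<Sum>i<M. (1/2 :: real)^i) \<le> 2" by (simp add: sum_gp_strict)
    have "L (S M) = (\<Sum>a\<in>{..<M}\<times>{..<M}. L (\<lambda>t. wt a * gap a t))"
      unfolding S_def[abs_def] by (rule mean_sum[OF L]) (use gapb in simp_all)
    also have "\<dots> = (\<Sum>a\<in>{..<M}\<times>{..<M}. wt a * L (gap a))"
      by (rule sum.cong[OF refl]) (rule mean_scale[OF L gapb])
    also have "\<dots> \<le> (\<Sum>a\<in>{..<M}\<times>{..<M}. (1/2)^fst a * (1/2)^snd a)"
    proof (rule sum_mono)
      fix a :: "nat \<times> nat"
      have "wt a * L (gap a) \<le> wt a * (1/4)^snd a"
        using Lgap wt[of a] by (intro mult_left_mono) auto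
      also have "\<dots> = (1/2)^fst a * (2 * (1/4))^snd a" unfolding power_mult_distrib wt_def by simp
      finally show "wt a * L (gap a) \<le> (1/2)^fst a * (1/2)^snd a" by simp
    qed
    also have "\<dots> = (\<Sum>i<M. (1/2)^i) * (\<Sum>i<M. (1/2 :: real)^i)"
      by (simp add: sum_product sum.cartesian_product case_prod_unfold)
    also have "\<dots> \<le> 2 * 2" by (rule mult_mono[OF geo geo]) (simp_all add: sum_nonneg)
    finally show ?thesis by simp
  qed
  (* the mean of the penalty is at most 4 * \<kappa> / 8, half of the admitted error *)
  define \<psi> where "\<psi> M t = \<kappa>/8 * S M t - blinfun_apply t y" for M t
  have \<psi>b: "bounded_over ?K (\<psi> M)" for M unfolding \<psi>_def[abs_def]
    by (intro bounded_over_diff bounded_over_mult bounded_over_const Sb bounded_over_eval)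
  have L\<psi>: "L (\<psi> M) \<le> \<kappa>/2 - blinfun_apply f y" for M
  proof -
    have "L (\<psi> M) = \<kappa>/8 * L (S M) - blinfun_apply f y"
      unfolding \<psi>_def[abs_def] rep[symmetric] mean_scale[OF L Sb, symmetric]
      by (intro mean_diff[OF L] bounded_over_mult bounded_over_const Sb bounded_over_eval)
    moreover have "\<kappa>/8 * L (S M) \<le> \<kappa>/8 * 4" using \<kappa> LS by (intro mult_left_mono) auto
    ultimately show ?thesis by simp
  qed
  have "\<forall>M. \<exists>t. (\<forall>j. t j \<in> ?K) \<and> (\<Sum>j<N. \<psi> M (t j)) \<le> real N * (\<kappa> - blinfun_apply f y) \<and>
        (\<forall>m\<in>{i..<M}. \<bar>(\<Sum>j<N. blinfun_apply (t j) (x m)) - C\<bar> \<le> D)"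
  proof
    fix M
    have "\<kappa>/2 > 0" using \<kappa> by simp
    from tuples[OF \<psi>b this, of M M] obtain t where t: "\<forall>j<N. t j \<in> ?K"
      "(\<Sum>j<N. \<psi> M (t j)) \<le> real N * (L (\<psi> M) + \<kappa>/2)"
      "\<forall>m\<in>{i..<M}. \<bar>(\<Sum>j<N. blinfun_apply (t j) (x m)) - C\<bar> \<le> D" by blast
    have "real N * (L (\<psi> M) + \<kappa>/2) \<le> real N * (\<kappa> - blinfun_apply f y)"
      using L\<psi>[of M] by (intro mult_left_mono) auto
    with t show "\<exists>t. (\<forall>j. t j \<in> ?K) \<and> (\<Sum>j<N. \<psi> M (t j)) \<le> real N * (\<kappa> - blinfun_apply f y) \<and>
        (\<forall>m\<in>{i..<M}. \<bar>(\<Sum>j<N. blinfun_apply (t j) (x m)) - C\<bar> \<le> D)"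
      by (intro exI[of _ "\<lambda>j. if j < N then t j else 0"]) auto
  qed
  from choice[OF this] obtain T where T: "\<And>M j. T M j \<in> ?K"
      "\<And>M. (\<Sum>j<N. \<psi> M (T M j)) \<le> real N * (\<kappa> - blinfun_apply f y)"
      "\<And>M m. m \<in> {i..<M} \<Longrightarrow> \<bar>(\<Sum>j<N. blinfun_apply (T M j) (x m)) - C\<bar> \<le> D" by blast
  obtain t where t: "\<And>j. t j \<in> ?K"
    and clu: "\<And>k. (\<lambda>(j, x). blinfun_apply (t j) x) \<in> closure ((\<lambda>n (j, x). blinfun_apply (T n j) x) ` {k..})"
    using dual_tuple_cluster_point[of T, OF T(1)] by blast
  have cont: "continuous_on UNIV (\<lambda>g :: nat \<times> 'a \<Rightarrow> real. g i)" for i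
    by (rule continuous_on_product_coordinates)
  have t\<psi>: "(\<Sum>j<N. \<psi> M (t j)) \<le> real N * (\<kappa> - blinfun_apply f y)" for M
  proof -
    define qc where "qc z m j g = fst (v z m) + g (j, fst (snd (v z m))) - (\<Sum>y\<leftarrow>snd (snd (v z m)). (g (j, y))\<^sup>2)"
      for z m j and g :: "nat \<times> 'a \<Rightarrow> real"
    define \<psi>c where "\<psi>c g = (\<Sum>j<N. \<kappa>/8 * (\<Sum>a\<in>{..<M}\<times>{..<M}. wt a *
        (qc (zf (fst a)) (snd a) j g - (g (j, zf (fst a)))\<^sup>2)) - g (j, y))" for g :: "nat \<times> 'a \<Rightarrow> real"
    have qcc: "continuous_on UNIV (qc z m j)" for z m j
      unfolding qc_def[abs_def] by (rule continuous_on_concave_quadratic_coordinates)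
    have "continuous_on UNIV \<psi>c"
      unfolding \<psi>c_def[abs_def]
      by (intro continuous_on_sum continuous_on_diff continuous_on_mult continuous_on_const continuous_on_power cont qcc)
    then have closed: "closed {g. \<psi>c g \<le> real N * (\<kappa> - blinfun_apply f y)}"
      by (rule closed_Collect_le[OF _ continuous_on_const])
    have eval: "\<psi>c (\<lambda>(j, x). blinfun_apply (s j) x) = (\<Sum>j<N. \<psi> M (s j))" for s
      by (simp add: \<psi>c_def \<psi>_def S_def gap_def qc_def q_def concave_quadratic_def)
    have "(\<lambda>(j, x). blinfun_apply (T n j) x) \<in> {g. \<psi>c g \<le> real N * (\<kappa> - blinfun_apply f y)}" if n: "n \<ge> M" for n
    proof -
      have "(\<Sum>j<N. \<psi> M (T n j)) \<le> (\<Sum>j<N. \<psi> n (T n j))"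
        unfolding \<psi>_def using S_mono[OF n T(1)] \<kappa> by (intro sum_mono diff_right_mono mult_left_mono) auto
      then show ?thesis using T(2)[of n] eval[of "T n"] by simp
    qed
    from cluster_point_closed[OF clu closed this] show ?thesis using eval[of t] by simp
  qed
  have tcon: "\<bar>(\<Sum>j<N. blinfun_apply (t j) (x m)) - C\<bar> \<le> D" if m: "m \<ge> i" for m
  proof -
    have "continuous_on UNIV (\<lambda>g :: nat \<times> 'a \<Rightarrow> real. \<bar>(\<Sum>j<N. g (j, x m)) - C\<bar>)"
      by (intro continuous_on_rabs continuous_on_diff continuous_on_sum continuous_on_const cont)
    then have "closed {g :: nat \<times> 'a \<Rightarrow> real. \<bar>(\<Sum>j<N. g (j, x m)) - C\<bar> \<le> D}"
      by (rule closed_Collect_le[OF _ continuous_on_const])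
    from cluster_point_closed[OF clu this, of "Suc m"] show ?thesis using T(3)[of m] m by simp
  qed
  have ty: "real N * (blinfun_apply f y - \<kappa>) \<le> (\<Sum>j<N. blinfun_apply (t j) y)"
    using t\<psi>[of 0] by (simp add: \<psi>_def S_def sum_negf algebra_simps)
  define B where "B = 8 / \<kappa> * (real N * (\<kappa> - blinfun_apply f y) + real N * norm y)"
  have gap_bound: "wt a * gap a (t j) \<le> B" if j: "j < N" for a j
  proof -
    define M where "M = Suc (max (fst a) (snd a))"
    have S0: "0 \<le> S M (t j)" for j
      unfolding S_def using gap0[OF t] less_imp_le[OF wt] by (intro sum_nonneg) simp
    have "wt a * gap a (t j) \<le> S M (t j)" by (rule S_term[OF _ _ t]) (simp_all add: M_def)
    also have "\<dots> \<le> (\<Sum>j<N. S M (t j))" using j S0 by (intro member_le_sum) auto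
    also have "\<dots> \<le> B"
    proof -
      have "\<kappa>/8 * (\<Sum>j<N. S M (t j)) \<le> real N * (\<kappa> - blinfun_apply f y) + (\<Sum>j<N. blinfun_apply (t j) y)"
        using t\<psi>[of M] by (simp add: \<psi>_def sum_subtractf sum_distrib_left)
      also have "\<dots> \<le> real N * (\<kappa> - blinfun_apply f y) + (\<Sum>j<N. norm y)"
        using dual_ball_bound[OF t] by (intro add_left_mono sum_mono) (simp add: abs_le_iff)
      finally show ?thesis using \<kappa> by (simp add: B_def field_simps)
    qed
    finally show ?thesis .
  qed
  have "\<exists>e. e extreme_point_of ?K \<and> (\<forall>z\<in>Y. blinfun_apply e z = blinfun_apply (t j) z)" if j: "j < N" for j
  proof -
    have tight: "\<exists>c x ys. insert x (set ys) \<subseteq> Y \<and>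
      (\<forall>e\<in>?K. (blinfun_apply e z)\<^sup>2 \<le> concave_quadratic c x ys e) \<and>
      concave_quadratic c x ys (t j) \<le> (blinfun_apply (t j) z)\<^sup>2 + \<eta>" if z: "z \<in> Y" and \<eta>: "\<eta> > 0" for z \<eta>
    proof -
      obtain n where n: "z = zf n" using z zf by blast
      obtain b where b: "B * 2^n / \<eta> < 2^b" using real_arch_pow[of 2] by force
      have "(1/2)^n * 2^b * gap (n, b) (t j) \<le> B" using gap_bound[OF j, of "(n, b)"] by (simp add: wt_def)
      then have "2^b * gap (n, b) (t j) \<le> B * 2^n" by (simp add: power_divide field_simps)
      also have "\<dots> \<le> 2^b * \<eta>" using b \<eta> by (simp add: field_simps)
      finally have "gap (n, b) (t j) \<le> \<eta>" by simp
      then have "q z b (t j) \<le> (blinfun_apply (t j) z)\<^sup>2 + \<eta>" by (simp add: gap_def n)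
      moreover have "gens z b \<subseteq> Y" using Y(3) z by blast
      ultimately show ?thesis using q(1)[of z b] unfolding q_def gens_def by blast
    qed
    show ?thesis by (rule extreme_extension[OF t tight]) blast+
  qed
  then have "\<forall>j. \<exists>e. j < N \<longrightarrow> e extreme_point_of ?K \<and> (\<forall>z\<in>Y. blinfun_apply e z = blinfun_apply (t j) z)" by blast
  from choice[OF this] obtain e where
    e: "\<And>j. j < N \<Longrightarrow> e j extreme_point_of ?K" "\<And>j z. j < N \<Longrightarrow> z \<in> Y \<Longrightarrow> blinfun_apply (e j) z = blinfun_apply (t j) z"
    by blast
  have "(\<Sum>j<N. blinfun_apply (e j) z) = (\<Sum>j<N. blinfun_apply (t j) z)" if "z \<in> Y" for z
    using e(2) that by (intro sum.cong) simp_all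
  moreover have "y \<in> Y" "x m \<in> Y" for m using Y(2) by blast+
  ultimately show ?thesis using e(1) ty tcon by (intro exI[of _ e]) simp
qed

section \<open>Separated double sequences and thinning against extreme points\<close>

text \<open>Removing one of the vanishing conditions at a time, the bound is restored by subtracting a multiple
\<open>c\<close> of the evaluation at \<open>x n\<close>. A suitable \<open>c\<close> exists because the lower bounds for it, coming from
functionals with value \<open>1\<close> at \<open>x n\<close>, lie below the upper bounds: the difference of two such
functionals vanishes at \<open>x n\<close>.\<close>

lemma helly_codimension:
  fixes F :: "('a::real_normed_vector \<Rightarrow>\<^sub>L real) \<Rightarrow>\<^sub>L real" and x :: "nat \<Rightarrow> 'a"
  assumes "d \<ge> 0"
    and "\<And>f. (\<forall>i<n. blinfun_apply f (x i) = 0) \<Longrightarrow> blinfun_apply F f \<le> d * norm f"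
  shows "\<exists>y. \<forall>f. blinfun_apply F f - blinfun_apply f y \<le> d * norm f"
  using assms(2)
proof (induction n arbitrary: F)
  case 0
  then show ?case by (intro exI[of _ 0]) simp
next
  case (Suc n)
  define W where "W = {f :: 'a \<Rightarrow>\<^sub>L real. \<forall>i<n. blinfun_apply f (x i) = 0}"
  have W_diff: "f - g \<in> W" if "f \<in> W" "g \<in> W" for f g using that by (simp add: W_def blinfun.diff_left)
  have W_scale: "r *\<^sub>R f \<in> W" if "f \<in> W" for f r using that by (simp add: W_def blinfun.scaleR_left)
  have hyp: "blinfun_apply F f \<le> d * norm f" if "f \<in> W" "blinfun_apply f (x n) = 0" for f
    using that by (intro Suc.prems) (auto simp: W_def less_Suc_eq)
  define V where "V = {f \<in> W. blinfun_apply f (x n) = 1}"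
  have between: "blinfun_apply F f - d * norm f \<le> blinfun_apply F g + d * norm g" if "f \<in> V" "g \<in> V" for f g
  proof -
    have "blinfun_apply F (f - g) \<le> d * norm (f - g)"
      using that W_diff by (intro hyp) (auto simp: V_def blinfun.diff_left)
    also have "\<dots> \<le> d * (norm f + norm g)" using assms(1) by (intro mult_left_mono norm_triangle_ineq4)
    finally show ?thesis by (simp add: blinfun.diff_right algebra_simps)
  qed
  have "\<exists>c. \<forall>f\<in>V. blinfun_apply F f - d * norm f \<le> c \<and> c \<le> blinfun_apply F f + d * norm f"
  proof (cases "V = {}")
    case False
    define c where "c = (SUP f\<in>V. blinfun_apply F f - d * norm f)"
    have bdd: "bdd_above ((\<lambda>f. blinfun_apply F f - d * norm f) ` V)"
    proof -
      obtain g where "g \<in> V" using False by blast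
      then show ?thesis using between
        by (intro bdd_aboveI2[where M="blinfun_apply F g + d * norm g"]) blast
    qed
    have "blinfun_apply F f - d * norm f \<le> c" if "f \<in> V" for f
      unfolding c_def using bdd that by (rule cSUP_upper2[OF _ _ order_refl])
    moreover have "c \<le> blinfun_apply F f + d * norm f" if "f \<in> V" for f
      unfolding c_def using False between that by (intro cSUP_least) blast+
    ultimately show ?thesis by blast
  qed simp
  then obtain c where c: "\<And>f. f \<in> V \<Longrightarrow> blinfun_apply F f - d * norm f \<le> c"
      "\<And>f. f \<in> V \<Longrightarrow> c \<le> blinfun_apply F f + d * norm f" by blast
  have ext: "blinfun_apply F f - c * blinfun_apply f (x n) \<le> d * norm f" if f: "f \<in> W" for f
  proof (cases "blinfun_apply f (x n) = 0")
    case True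
    then show ?thesis using hyp[OF f] by simp
  next
    case False
    define s where "s = blinfun_apply f (x n)"
    have s: "s \<noteq> 0" using False by (simp add: s_def)
    define g where "g = (1/s) *\<^sub>R f"
    have g: "g \<in> V" using W_scale[OF f] s by (simp add: V_def g_def blinfun.scaleR_left s_def)
    have Fg: "blinfun_apply F g = blinfun_apply F f / s" by (simp add: g_def blinfun.scaleR_right)
    have ng: "norm g = norm f / \<bar>s\<bar>" by (simp add: g_def)
    show ?thesis
    proof (cases "s > 0")
      case True
      have "blinfun_apply F f / s - d * norm f / s \<le> c" using c(1)[OF g] True by (simp add: Fg ng)
      then have "(blinfun_apply F f - d * norm f) / s \<le> c" by (simp add: diff_divide_distrib)
      then have "blinfun_apply F f - d * norm f \<le> c * s" using True by (simp add: pos_divide_le_eq)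
      then show ?thesis by (simp add: s_def)
    next
      case False
      then have neg: "s < 0" using s by simp
      have "c \<le> blinfun_apply F f / s - d * norm f / s" using c(2)[OF g] neg by (simp add: Fg ng)
      then have "c \<le> (blinfun_apply F f - d * norm f) / s" by (simp add: diff_divide_distrib)
      then have "blinfun_apply F f - d * norm f \<le> c * s" using neg by (simp add: neg_le_divide_eq)
      then show ?thesis by (simp add: s_def)
    qed
  qed
  let ?F = "F - c *\<^sub>R bidual_embedding (x n)"
  have "\<exists>y. \<forall>f. blinfun_apply ?F f - blinfun_apply f y \<le> d * norm f"
  proof (rule Suc.IH)
    fix f :: "'a \<Rightarrow>\<^sub>L real" assume "\<forall>i<n. blinfun_apply f (x i) = 0"
    then have "f \<in> W" by (simp add: W_def)
    then show "blinfun_apply ?F f \<le> d * norm f"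
      using ext by (simp add: blinfun.diff_left blinfun.scaleR_left)
  qed
  then obtain y where y: "\<And>f. blinfun_apply ?F f - blinfun_apply f y \<le> d * norm f" by blast
  have "blinfun_apply F f - blinfun_apply f (y + c *\<^sub>R x n) \<le> d * norm f" for f
    using y[of f] by (simp add: blinfun.diff_left blinfun.scaleR_left blinfun.add_right blinfun.scaleR_right)
  then show ?case by blast
qed

text \<open>If \<open>F\<close> were bounded by \<open>d\<close> on the common annihilator of the \<open>x i\<close>, it would lie within \<open>d\<close> of an evaluation.\<close>

lemma annihilating_functional:
  fixes F :: "('a::real_normed_vector \<Rightarrow>\<^sub>L real) \<Rightarrow>\<^sub>L real" and x :: "nat \<Rightarrow> 'a"
  assumes d: "0 \<le> d" "d < infdist F (range bidual_embedding)"
  shows "\<exists>f. f \<in> cball 0 1 \<and> (\<forall>i<n. blinfun_apply f (x i) = 0) \<and> blinfun_apply F f > d"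
proof -
  have "\<exists>f. (\<forall>i<n. blinfun_apply f (x i) = 0) \<and> blinfun_apply F f > d * norm f"
  proof (rule ccontr)
    assume "\<not> ?thesis"
    then have "blinfun_apply F f \<le> d * norm f" if "\<forall>i<n. blinfun_apply f (x i) = 0" for f
      using that by force
    from helly_codimension[OF d(1) this] obtain y where
      y: "\<And>f. blinfun_apply F f - blinfun_apply f y \<le> d * norm f" by blast
    have "norm (blinfun_apply (F - bidual_embedding y) f) \<le> d * norm f" for f
      using y[of f] y[of "- f"] by (simp add: blinfun.diff_left blinfun.minus_right blinfun.minus_left abs_le_iff)
    then have "norm (F - bidual_embedding y) \<le> d" using d(1) by (intro norm_blinfun_bound)
    moreover have "infdist F (range bidual_embedding) \<le> dist F (bidual_embedding y)"
      by (rule infdist_le) simp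
    ultimately show False using d(2) by (simp add: dist_norm)
  qed
  then obtain f where f: "\<forall>i<n. blinfun_apply f (x i) = 0" "blinfun_apply F f > d * norm f" by blast
  have "f \<noteq> 0" using f(2) by auto
  then have n0: "norm f > 0" by simp
  let ?f = "(1 / norm f) *\<^sub>R f"
  have "blinfun_apply F ?f > d" using f(2) n0 by (simp add: blinfun.scaleR_right field_simps)
  moreover have "?f \<in> cball 0 1" using n0 by simp
  moreover have "\<forall>i<n. blinfun_apply ?f (x i) = 0" using f(1) by (simp add: blinfun.scaleR_left)
  ultimately show ?thesis by blast
qed

text \<open>Eberlein's construction, choosing alternately \<open>h k\<close> that annihilates the earlier vectors and \<open>x k\<close> in \<open>A\<close> that
imitates \<open>F\<close> on \<open>h 0, \<dots>, h k\<close>.\<close>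

lemma separated_double_sequence:
  fixes F :: "('a::real_normed_vector \<Rightarrow>\<^sub>L real) \<Rightarrow>\<^sub>L real"
  assumes F: "F \<in> weak_star_topology closure_of (bidual_embedding ` A)"
    and d: "0 \<le> d" "d < infdist F (range bidual_embedding)"
  obtains x :: "nat \<Rightarrow> 'a" and h where "range x \<subseteq> A" "\<And>i. h i \<in> cball 0 1"
    "\<And>i n. n < i \<Longrightarrow> blinfun_apply (h i) (x n) = 0" "\<And>i n. i \<le> n \<Longrightarrow> d < blinfun_apply (h i) (x n)"
proof -
  have approx: "\<exists>x\<in>A. \<forall>f\<in>I. d < blinfun_apply f x"
    if I: "finite I" "\<And>f. f \<in> I \<Longrightarrow> d < blinfun_apply F f" for I :: "('a \<Rightarrow>\<^sub>L real) set"
  proof -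
    define U where "U = {G :: ('a \<Rightarrow>\<^sub>L real) \<Rightarrow>\<^sub>L real. \<forall>f\<in>I. blinfun_apply G f \<in> {d<..}}"
    have "openin weak_star_topology U"
      unfolding U_def by (rule strong_operator_topology_basis[OF I(1)]) simp
    moreover have "F \<in> U" using I(2) by (simp add: U_def)
    ultimately have "\<exists>G. G \<in> bidual_embedding ` A \<and> G \<in> U"
      by (intro F[unfolded in_closure_of, THEN conjunct2, rule_format] conjI)
    then obtain x where "x \<in> A" "bidual_embedding x \<in> U" by blast
    then show ?thesis by (intro bexI[of _ x]) (simp_all add: U_def)
  qed
  define P where "P g k r \<longleftrightarrow> fst r \<in> cball 0 1 \<and> (\<forall>i<k. blinfun_apply (fst r) (snd (g i)) = 0) \<and>
      d < blinfun_apply F (fst r) \<and> snd r \<in> A \<and>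
      (\<forall>i<k. d < blinfun_apply (fst (g i)) (snd r)) \<and> d < blinfun_apply (fst r) (snd r)"
    for g :: "nat \<Rightarrow> ('a \<Rightarrow>\<^sub>L real) \<times> 'a" and k r
  have "\<exists>g. \<forall>k. P g k (g k)"
  proof (rule dependent_wellorder_choice)
    fix r k and g g' :: "nat \<Rightarrow> ('a \<Rightarrow>\<^sub>L real) \<times> 'a"
    assume "\<And>i. i < k \<Longrightarrow> g i = g' i"
    then show "P g k r = P g' k r" by (simp add: P_def)
  next
    fix k and g :: "nat \<Rightarrow> ('a \<Rightarrow>\<^sub>L real) \<times> 'a"
    assume g: "\<And>i. i < k \<Longrightarrow> P g i (g i)"
    obtain f where f: "f \<in> cball 0 1" "\<forall>i<k. blinfun_apply f (snd (g i)) = 0" "d < blinfun_apply F f"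
      using annihilating_functional[OF d, of k "\<lambda>i. snd (g i)"] by blast
    let ?I = "insert f ((\<lambda>i. fst (g i)) ` {..<k})"
    have "\<exists>x\<in>A. \<forall>f\<in>?I. d < blinfun_apply f x"
    proof (rule approx)
      show "finite ?I" by simp
      fix f' assume "f' \<in> ?I"
      then consider "f' = f" | i where "i < k" "f' = fst (g i)" by blast
      then show "d < blinfun_apply F f'" using f(3) g unfolding P_def by cases simp_all
    qed
    then obtain x where "x \<in> A" "\<forall>f\<in>?I. d < blinfun_apply f x" by blast
    then show "\<exists>r. P g k r" using f by (intro exI[of _ "(f, x)"]) (simp add: P_def)
  qed
  then obtain g where g: "\<And>k. P g k (g k)" by blast
  show ?thesis
  proof (rule that[of "\<lambda>n. snd (g n)" "\<lambda>i. fst (g i)"])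
    show "range (\<lambda>n. snd (g n)) \<subseteq> A" using g by (auto simp: P_def)
    show "fst (g i) \<in> cball 0 1" for i using g[of i] unfolding P_def by blast
    show "blinfun_apply (fst (g i)) (snd (g n)) = 0" if "n < i" for i n
      using g[of i] that unfolding P_def by blast
    show "d < blinfun_apply (fst (g i)) (snd (g n))" if "i \<le> n" for i n
      using g[of n] that unfolding P_def by (cases "i = n") auto
  qed
qed

text \<open>The subsequence \<open>s\<close> does not depend on \<open>y\<close>, so the tuples may be used for a vector that is itself
obtained from the subsequence. The number \<open>N\<close> of extreme points depends only on \<open>R\<close> and \<open>\<delta>\<close>.\<close>

theorem extreme_thinning:
  fixes x :: "nat \<Rightarrow> 'a::real_normed_vector" and h :: "nat \<Rightarrow> 'a \<Rightarrow>\<^sub>L real"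
  assumes R: "\<And>n. norm (x n) \<le> R" and h: "\<And>i. h i \<in> cball 0 1" and \<delta>: "\<delta> > 0"
  shows "\<exists>s c N. strict_mono s \<and> N > 0 \<and>
    (\<forall>i k \<eta>. \<eta> > 0 \<longrightarrow> (\<exists>n\<ge>k. \<bar>blinfun_apply (h i) (x n) - c i\<bar> < \<eta>)) \<and>
    (\<forall>i y. \<exists>e. (\<forall>j<N. e j extreme_point_of cball 0 1) \<and>
      real N * (blinfun_apply (h i) y - \<delta>) \<le> (\<Sum>j<N. blinfun_apply (e j) y) \<and>
      (\<forall>m\<ge>i. \<bar>(\<Sum>j<N. blinfun_apply (e j) (x (s m))) - real N * c i\<bar> \<le> real N * \<delta>))"
proof -
  let ?K = "cball (0 :: 'a \<Rightarrow>\<^sub>L real) 1"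
  (* large enough for two fractional entries to be negligible in the average *)
  define N where "N = Suc (nat \<lceil>12 * R / \<delta>\<rceil>)"
  have "12 * R / \<delta> \<le> real N" unfolding N_def by linarith
  then have N: "12 * R \<le> real N * \<delta>" using \<delta> by (simp add: divide_le_eq)
  define rep where "rep f L \<longleftrightarrow> mean_on ?K L \<and> (\<forall>x. L (\<lambda>t. blinfun_apply t x) = blinfun_apply f x) \<and>
    (\<forall>y \<eta>. \<eta> > 0 \<longrightarrow> (\<exists>c x ys. (\<forall>t\<in>?K. (blinfun_apply t y)\<^sup>2 \<le> concave_quadratic c x ys t) \<and>
        L (concave_quadratic c x ys) \<le> L (\<lambda>t. (blinfun_apply t y)\<^sup>2) + \<eta>))" for f L
  have "\<exists>L. rep (h i) L" for i
    by (rule maximal_representing_mean[OF h[of i]]) (unfold rep_def, blast)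
  then obtain L where L: "\<And>i. rep (h i) (L i)" by metis
  have mean: "mean_on ?K (L i)" and Lh: "L i (\<lambda>t. blinfun_apply t x) = blinfun_apply (h i) x" for i x
    using L[of i] unfolding rep_def by blast+
  have max: "\<exists>c x ys. (\<forall>t\<in>?K. (blinfun_apply t y)\<^sup>2 \<le> concave_quadratic c x ys t) \<and>
        L i (concave_quadratic c x ys) \<le> L i (\<lambda>t. (blinfun_apply t y)\<^sup>2) + \<eta>" if "\<eta> > 0" for i y \<eta>
    using L[of i] that unfolding rep_def by blast
  have xR: "\<bar>blinfun_apply t (x n)\<bar> \<le> R" if "t \<in> ?K" for t n
    using dual_ball_bound[OF that, of "x n"] R[of n] by linarith
  obtain s c where s: "strict_mono s"
    and c: "\<And>i k \<eta>. \<eta> > 0 \<Longrightarrow> \<exists>n\<ge>k. \<bar>L i (\<lambda>t. blinfun_apply t (x n)) - c i\<bar> < \<eta>"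
    and tup: "\<And>i k \<psi> \<kappa>. bounded_over ?K \<psi> \<Longrightarrow> \<kappa> > 0 \<Longrightarrow>
      \<exists>t. (\<forall>j<N. t j \<in> ?K) \<and> (\<Sum>j<N. \<psi> (t j)) \<le> real N * (L i \<psi> + \<kappa>) \<and>
        (\<forall>m\<in>{i..<k}. \<bar>(\<Sum>j<N. blinfun_apply (t j) (x (s m))) - real N * c i\<bar> \<le> real N * \<delta>)"
    using simultaneous_thinning[where K="?K" and L=L and \<phi>="\<lambda>n t. blinfun_apply t (x n)", OF mean xR \<delta> N] by blast
  show ?thesis
  proof (rule exI[of _ s], rule exI[of _ c], rule exI[of _ N], intro conjI allI impI)
    show "strict_mono s" by (rule s)
    show "N > 0" by (simp add: N_def)
    show "\<exists>n\<ge>k. \<bar>blinfun_apply (h i) (x n) - c i\<bar> < \<eta>" if "\<eta> > 0" for i k \<eta>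
      using c[OF that, of k i] unfolding Lh .
    show "\<exists>e. (\<forall>j<N. e j extreme_point_of ?K) \<and>
      real N * (blinfun_apply (h i) y - \<delta>) \<le> (\<Sum>j<N. blinfun_apply (e j) y) \<and>
      (\<forall>m\<ge>i. \<bar>(\<Sum>j<N. blinfun_apply (e j) (x (s m))) - real N * c i\<bar> \<le> real N * \<delta>)" for i y
      using extreme_tuple[where L="L i" and f="h i" and x="\<lambda>m. x (s m)", OF mean Lh max tup \<delta>] .
  qed
qed

lemma continuous_map_pointwise_topology_on:
  assumes "f \<in> S"
  shows "continuous_map (pointwise_topology_on S) euclideanreal (blinfun_apply f)"
proof -
  have "continuous_map (pointwise_topology_on S) euclideanreal ((\<lambda>g. g f) \<circ> (\<lambda>x. \<lambda>f\<in>S. blinfun_apply f x))"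
    unfolding pointwise_topology_on_def
    by (rule continuous_map_pullback) (rule continuous_map_product_projection[OF assms])
  moreover have "(\<lambda>g. g f) \<circ> (\<lambda>x. \<lambda>f\<in>S. blinfun_apply f x) = blinfun_apply f"
    using assms by (auto simp: fun_eq_iff)
  ultimately show ?thesis by simp
qed

text \<open>An average of functionals in \<open>S\<close> is affine and continuous for pointwise convergence on \<open>S\<close>. For a general
functional in the ball, even one that is a weak* limit of such averages, continuity fails.\<close>

lemma pointwise_closure_convex_hull_bound:
  fixes N :: nat
  assumes e: "\<And>j. j < N \<Longrightarrow> e j \<in> S" and w: "w \<in> pointwise_topology_on S closure_of (convex hull X)"
    and X: "\<And>u. u \<in> X \<Longrightarrow> \<bar>(\<Sum>j<N. blinfun_apply (e j) u) - C\<bar> \<le> D"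
  shows "\<bar>(\<Sum>j<N. blinfun_apply (e j) w) - C\<bar> \<le> D"
proof -
  let ?g = "\<lambda>u. \<Sum>j<N. blinfun_apply (e j) u"
  have lin: "linear ?g" by (rule linearI) (simp_all add: blinfun.add_right blinfun.scaleR_right sum.distrib sum_distrib_left)
  have "continuous_map (pointwise_topology_on S) euclideanreal ?g"
    using e by (intro continuous_map_sum continuous_map_pointwise_topology_on) auto
  then have "closedin (pointwise_topology_on S) {u \<in> topspace (pointwise_topology_on S). ?g u \<in> {C - D..C + D}}"
    by (rule closedin_continuous_map_preimage) simp
  moreover have top: "topspace (pointwise_topology_on S) = UNIV"
    unfolding pointwise_topology_on_def topspace_pullback_topology by (auto simp: PiE_def)
  ultimately have closed: "closedin (pointwise_topology_on S) (?g -` {C - D..C + D})" by (simp add: vimage_def)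
  have "X \<subseteq> ?g -` {C - D..C + D}" using X by (fastforce simp: abs_le_iff)
  then have "convex hull X \<subseteq> ?g -` {C - D..C + D}"
    by (rule hull_minimal) (rule convex_linear_vimage[OF lin convex_real_interval(5)])
  then have "pointwise_topology_on S closure_of (convex hull X) \<subseteq> ?g -` {C - D..C + D}"
    using closed by (rule closure_of_minimal)
  then have "?g w \<in> {C - D..C + D}" using w by blast
  then show ?thesis by (simp add: abs_le_iff)
qed

section \<open>Weak compactness from closed convex hulls of tails\<close>

theorem corollary2p4:
  fixes A :: "'a::banach set" and \<epsilon> :: real and E :: "('a \<Rightarrow>\<^sub>L real) set"
  assumes "bounded A"
    and "\<epsilon> \<ge> 0"
    and "E = {f. f extreme_point_of cball 0 1}"
    and "\<And>x :: nat \<Rightarrow> 'a. range x \<subseteq> A \<Longrightarrow>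
      (\<Inter>k\<in>{1..}. {c + \<epsilon> *\<^sub>R b |c b.
          c \<in> pointwise_topology_on E closure_of (convex hull {x n |n. n \<ge> k}) \<and>
          b \<in> cball 0 1}) \<noteq> {}"
  shows "delta_WRC (2 * \<epsilon>) A"
  unfolding delta_WRC_def
proof (intro conjI ballI assms(1))
  fix F assume F: "F \<in> weak_star_topology closure_of (bidual_embedding ` A)"
  show "infdist F (range bidual_embedding) \<le> 2 * \<epsilon>"
  proof (rule ccontr)
    assume "\<not> ?thesis"
    then have "2 * \<epsilon> < infdist F (range bidual_embedding)" by simp
    from dense[OF this] obtain d where d: "2 * \<epsilon> < d" "d < infdist F (range bidual_embedding)"
      by blast
    have d0: "0 \<le> d" using d(1) assms(2) by simp
    obtain x :: "nat \<Rightarrow> 'a" and h where xA: "range x \<subseteq> A" and hK: "\<And>i. h i \<in> cball 0 1"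
      and h0: "\<And>i n. n < i \<Longrightarrow> blinfun_apply (h i) (x n) = 0"
      and hd: "\<And>i n. i \<le> n \<Longrightarrow> d < blinfun_apply (h i) (x n)"
      using separated_double_sequence[OF F d0 d(2)] by blast
    (* constant tuples: only a single cluster point of the sequence h is needed *)
    define T where "T n j = h n" for n j :: nat
    have TK: "T n j \<in> cball 0 1" for n j using hK by (simp add: T_def)
    obtain t where t: "\<And>j. t j \<in> cball 0 1"
      and clu: "\<And>k. (\<lambda>(j, x). blinfun_apply (t j) x) \<in> closure ((\<lambda>n (j, x). blinfun_apply (T n j) x) ` {k..})"
      using dual_tuple_cluster_point[of T, OF TK] by blast
    have cont: "continuous_on UNIV (\<lambda>g :: nat \<times> 'a \<Rightarrow> real. g i)" for i
      by (rule continuous_on_product_coordinates)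
    define f where "f = t 0"
    have fx: "blinfun_apply f (x n) = 0" for n
    proof -
      have "closed {g :: nat \<times> 'a \<Rightarrow> real. g (0, x n) = 0}"
        by (rule closed_Collect_eq[OF cont continuous_on_const])
      from cluster_point_closed[OF clu this, of "Suc n"] show ?thesis using h0[of n] by (simp add: f_def T_def)
    qed
    (* index 0 stands for the cluster point *)
    define H where "H = case_nat f h"
    have HK: "H i \<in> cball 0 1" for i using t[of 0] hK by (cases i) (simp_all add: H_def f_def)
    obtain R where R: "\<And>n. norm (x n) \<le> R"
      using assms(1) xA unfolding bounded_iff by blast
    (* f z and all h i z will lie within 2 * \<delta> + \<epsilon> of 0 and of numbers at least d, and
       2 * (2 * \<delta> + \<epsilon>) < d *)
    define \<delta> where "\<delta> = (d - 2 * \<epsilon>) / 8"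
    have \<delta>: "\<delta> > 0" using d(1) by (simp add: \<delta>_def)
    obtain s a N where saN: "strict_mono s \<and> N > 0 \<and>
      (\<forall>i k \<eta>. \<eta> > 0 \<longrightarrow> (\<exists>n\<ge>k. \<bar>blinfun_apply (H i) (x n) - a i\<bar> < \<eta>)) \<and>
      (\<forall>i y. \<exists>e. (\<forall>j<N. e j extreme_point_of cball 0 1) \<and>
        real N * (blinfun_apply (H i) y - \<delta>) \<le> (\<Sum>j<N. blinfun_apply (e j) y) \<and>
        (\<forall>m\<ge>i. \<bar>(\<Sum>j<N. blinfun_apply (e j) (x (s m))) - real N * a i\<bar> \<le> real N * \<delta>))"
      using extreme_thinning[of x R H \<delta>, OF R HK \<delta>] by blast
    note N = saN[THEN conjunct2, THEN conjunct1]
    note a = saN[THEN conjunct2, THEN conjunct2, THEN conjunct1, rule_format]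
    have a0: "a 0 = 0"
    proof (rule ccontr)
      assume "a 0 \<noteq> 0"
      then show False using a[of "\<bar>a 0\<bar>" 0 0] fx by (simp add: H_def)
    qed
    have aS: "d \<le> a (Suc i)" for i
    proof (rule ccontr)
      assume "\<not> ?thesis"
      then have "d - a (Suc i) > 0" by simp
      from a[OF this, of i "Suc i"] obtain n where "n \<ge> i" "\<bar>blinfun_apply (h i) (x n) - a (Suc i)\<bar> < d - a (Suc i)"
        by (auto simp: H_def)
      then show False using hd[of i n] by linarith
    qed
    have "range (\<lambda>n. x (s n)) \<subseteq> A" using xA by blast
    from assms(4)[OF this] obtain z where "z \<in> (\<Inter>k\<in>{1..}. {c + \<epsilon> *\<^sub>R b |c b.
          c \<in> pointwise_topology_on E closure_of (convex hull {x (s n) |n. n \<ge> k}) \<and> b \<in> cball 0 1})"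
      unfolding ex_in_conv[symmetric] by (rule exE)
    then have z: "z \<in> {c + \<epsilon> *\<^sub>R b |c b.
          c \<in> pointwise_topology_on E closure_of (convex hull {x (s n) |n. n \<ge> k}) \<and> b \<in> cball 0 1}"
      if "k \<ge> 1" for k
      by (rule INT_D) (use that in simp)
    have tuple_z: "\<bar>(\<Sum>j<N. blinfun_apply (e j) z) - real N * a i\<bar> \<le> real N * (\<delta> + \<epsilon>)"
      if e: "\<forall>j<N. e j extreme_point_of cball 0 1"
        and con: "\<forall>m\<ge>i. \<bar>(\<Sum>j<N. blinfun_apply (e j) (x (s m))) - real N * a i\<bar> \<le> real N * \<delta>" for e i
    proof -
      (* the constraints start at index i, the hypothesis at tail 1 *)
      have "max 1 i \<ge> (1::nat)" by simp
      from z[OF this] obtain c b where cb: "z = c + \<epsilon> *\<^sub>R b" "b \<in> cball 0 1"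
        "c \<in> pointwise_topology_on E closure_of (convex hull {x (s n) |n. n \<ge> max 1 i})" by blast
      have "\<bar>(\<Sum>j<N. blinfun_apply (e j) c) - real N * a i\<bar> \<le> real N * \<delta>"
      proof (rule pointwise_closure_convex_hull_bound[OF _ cb(3)])
        show "e j \<in> E" if "j < N" for j using e that assms(3) by simp
        fix u assume "u \<in> {x (s n) |n. n \<ge> max 1 i}"
        then obtain n where "u = x (s n)" "n \<ge> i" by auto
        then show "\<bar>(\<Sum>j<N. blinfun_apply (e j) u) - real N * a i\<bar> \<le> real N * \<delta>" using con by simp
      qed
      moreover have "\<bar>\<Sum>j<N. blinfun_apply (e j) b\<bar> \<le> real N"
      proof -
        have "\<bar>blinfun_apply (e j) b\<bar> \<le> 1" if "j < N" for j
        proof -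
          have "e j \<in> cball 0 1" using e that by (simp add: extreme_point_of_def)
          then show ?thesis using dual_ball_bound[of "e j" b] cb(2) by simp
        qed
        then have "(\<Sum>j<N. \<bar>blinfun_apply (e j) b\<bar>) \<le> (\<Sum>j<N. 1)" by (intro sum_mono) simp
        then show ?thesis
          by (intro order_trans[OF sum_abs[of "\<lambda>j. blinfun_apply (e j) b" "{..<N}"]]) simp
      qed
      then have "\<epsilon> * \<bar>\<Sum>j<N. blinfun_apply (e j) b\<bar> \<le> \<epsilon> * real N" using assms(2) by (rule mult_left_mono)
      then have "\<bar>\<epsilon> * (\<Sum>j<N. blinfun_apply (e j) b)\<bar> \<le> \<epsilon> * real N" using assms(2) by (simp add: abs_mult)
      moreover have "(\<Sum>j<N. blinfun_apply (e j) z) = (\<Sum>j<N. blinfun_apply (e j) c) + \<epsilon> * (\<Sum>j<N. blinfun_apply (e j) b)"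
        by (simp add: cb(1) blinfun.add_right blinfun.scaleR_right sum.distrib sum_distrib_left)
      ultimately show ?thesis unfolding distrib_left by (simp add: mult.commute)
    qed
    have upper: "blinfun_apply (H i) y \<le> r + 2 * \<delta> + \<epsilon>"
      if y: "y = z \<and> r = a i \<or> y = - z \<and> r = - a i" for i y r
    proof -
      obtain e where e: "\<forall>j<N. e j extreme_point_of cball 0 1"
        "real N * (blinfun_apply (H i) y - \<delta>) \<le> (\<Sum>j<N. blinfun_apply (e j) y)"
        "\<forall>m\<ge>i. \<bar>(\<Sum>j<N. blinfun_apply (e j) (x (s m))) - real N * a i\<bar> \<le> real N * \<delta>"
        using saN[THEN conjunct2, THEN conjunct2, THEN conjunct2, THEN spec, of i, THEN spec, of y] by blast
      have bound: "\<bar>(\<Sum>j<N. blinfun_apply (e j) z) - real N * a i\<bar> \<le> real N * (\<delta> + \<epsilon>)"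
        by (rule tuple_z[OF e(1,3)])
      from y have "(\<Sum>j<N. blinfun_apply (e j) y) \<le> real N * r + real N * (\<delta> + \<epsilon>)"
      proof
        assume yr: "y = z \<and> r = a i"
        show ?thesis using bound unfolding yr[THEN conjunct1] yr[THEN conjunct2] by linarith
      next
        assume yr: "y = - z \<and> r = - a i"
        show ?thesis using bound unfolding yr[THEN conjunct1] yr[THEN conjunct2] blinfun.minus_right sum_negf
          by (simp only: mult_minus_right)
      qed
      then have "real N * (blinfun_apply (H i) y - \<delta>) \<le> real N * (r + (\<delta> + \<epsilon>))"
        using e(2) by (simp add: distrib_left)
      then show ?thesis using N by simp
    qed
    have fz: "blinfun_apply f z \<le> 2 * \<delta> + \<epsilon>" using upper[of z 0 0] a0 by (simp add: H_def)
    have hz: "d - 2 * \<delta> - \<epsilon> \<le> blinfun_apply (h i) z" for i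
      using upper[of "- z" "- a (Suc i)" "Suc i"] aS[of i] by (simp add: H_def blinfun.minus_right)
    have "closed {g :: nat \<times> 'a \<Rightarrow> real. d - 2 * \<delta> - \<epsilon> \<le> g (0, z)}"
      by (rule closed_Collect_le[OF continuous_on_const cont])
    from cluster_point_closed[OF clu this, of 0] have "d - 2 * \<delta> - \<epsilon> \<le> blinfun_apply f z"
      using hz by (simp add: f_def T_def)
    moreover have "8 * \<delta> = d - 2 * \<epsilon>" by (simp add: \<delta>_def)
    ultimately show False using fz \<delta> by linarith
  qed
qed

end
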